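(* Fix $0<\lambda<1$, $T>0$ and $s^0\in\mathcal{S}^1$. Under each of the three regimes (High Memory, High Message, Constrained), for the coupled sequence of processes $\{(S^n(t),M^n(t))\}_{n}$, if $$\lim_{n\to\infty}\|S^n(0)-s^0\|_w=0\quad\text{a.s.},$$ then $$\lim_{n\to\infty}\ \sup_{0\le t\le T}\|S^n(t)-s(t)\|_w=0\quad\text{a.s.},$$ where $s(t)$ is the unique fluid solution (for the corresponding regime) with initial condition $s^0$.
   Context: Notation: $[x]^+=\max\{x,0\}$; $0^0=1$; $\mathbf{1}_A(x)$ is the indicator of $x\in A$. $\mathcal{S}=\{s\in[0,1]^{\mathbb{Z}_+}: s_0=1,\ s_i\ge s_{i+1}\ \forall i\}$, $\mathcal{S}^1=\{s\in\mathcal{S}:\sum_i s_i<\infty\}$, $\mathcal{I}_n=\{x\in[0,1]^{\mathbb{Z}_+}: nx_i\in\mathbb{Z}_+\ \forall i\}$, $\|x\|_w^2=\sum_{i\ge0}|x_i|^2/2^i$. Model: $n$ unit-rate servers with FIFO queues; jobs arrive as a Poisson process of rate $\lambda n$ with i.i.d. exp(1) sizes; the dispatcher stores up to $c(n)\le n$ tokens (IDs of idle servers); each idle server sends messages at rate $\mu(n)>0$ ($\mu(n)$ nondecreasing), adding its ID to the stored tokens unless it is already stored or memory is full; an arrival goes to a server chosen uniformly among stored tokens (the token is deleted), or to a uniformly random queue if there are no tokens. $S^n_i(t)$ is the fraction of queues with at least $i$ jobs and $M^n(t)\in\{0,\dots,c(n)\}$ the number of tokens. Regimes: High Memory: $c(n)\to\infty$,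 $c(n)/n\to0$, $\mu(n)=\mu>0$ constant. High Message: $c(n)=c\ge1$ constant, $\mu(n)$ nondecreasing, $\mu(n)\to\infty$. Constrained: $c(n)=c\ge1$, $\mu(n)=\mu>0$ constants. Coupled construction (common probability space for all $n$): independent Poisson processes $\mathcal{N}_\lambda$ (rate $\lambda$), $\mathcal{N}_1$ (rate $1$), and, independent of these, Poisson processes $\mathcal{N}_{\mu(n)}$ (rate $\mu(n)$), coupled so that the events of $\mathcal{N}_{\mu(n)}$ are a.s. a subset of those of $\mathcal{N}_{\mu(n+1)}$; three independent i.i.d. uniform$[0,1]$ sequences $U(k),V(k),W(k)$, independent of the Poisson processes; and initial conditions $(S^n(0),M^n(0))=(S^{(0,n)},M^{(0,n)})$ with values in $(\mathcal{S}^1\cap\mathcal{I}_n)\times\{0,\dots,c(n)\}$, with $M^{(0,n)}\le n(1-S^{(0,n)}_1)$, independent of everything else. Then $S^n(t)=S^{(0,n)}+A^n(t)-D^n(t)$ with $A^n_0=D^n_0=0$, where, with $t_j$ denoting the time of the $j$-th event of the process $\mathcal{N}_\lambda(n\,\cdot)$, $\mathcal{N}_1(n\,\cdot)$ or $\mathcal{N}_{\mu(n)}(n\,\cdot)$ indexing the sum, $$A_1^n(t)=\tfrac1n\sum_{j=1}^{\mathcal{N}_\lambda(nt)}\Big[\mathbf{1}_{[1,c(n)]}(M^n(t_j^-))+\mathbf{1}_{\{0\}}(M^n(t_j^-))\mathbf{1}_{[0,1-S_1^n(t_j^-))}(U(j))\Big],$$ $$A_i^n(t)=\tfrac1n\sum_{j=1}^{\mathcal{N}_\lambda(nt)}\mathbf{1}_{\{0\}}(M^n(t_j^-))\mathbf{1}_{[1-S_{i-1}^n(t_j^-),1-S_i^n(t_j^-))}(U(j)),\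 i\ge2,$$ $$D_i^n(t)=\tfrac1n\sum_{j=1}^{\mathcal{N}_1(nt)}\mathbf{1}_{[1-S_i^n(t_j^-),1-S_{i+1}^n(t_j^-))}(W(j)),\ i\ge1,$$ $$M^n(t)=M^{(0,n)}-\sum_{j=1}^{\mathcal{N}_\lambda(nt)}\mathbf{1}_{[1,c(n)]}(M^n(t_j^-))+\sum_{j=1}^{\mathcal{N}_{\mu(n)}(nt)}\mathbf{1}_{[0,c(n)-1]}(M^n(t_j^-))\mathbf{1}_{[0,1-S_1^n(t_j^-)-M^n(t_j^-)/n)}(V(j)).$$ Fluid solution with initial condition $s^0$: a $\|\cdot\|_w$-continuous $s:[0,\infty)\to\mathcal{S}^1$ whose coordinates are Lipschitz in time with a common constant, with $s(0)=s^0$, $s_0(t)=1$ for all $t$, and, for all $t$ outside a Lebesgue-null set and all $i\ge1$, $s_i$ is differentiable at $t$ with $\dot s_1=\lambda(1-P_0(s))+\lambda(1-s_1)P_0(s)-(s_1-s_2)$ and $\dot s_i=\lambda(s_{i-1}-s_i)P_0(s)-(s_i-s_{i+1})$ for $i\ge2$, where $P_0(s)=\left[1-\frac{\mu(1-s_1)}{\lambda}\right]^+$ (High Memory); $P_0(s)=\left[1-\frac{1-s_2}{\lambda}\right]^+\mathbf{1}_{\{s_1=1\}}$ (High Message); $P_0(s)=\left[\sum_{k=0}^{c}\left(\frac{\mu(1-s_1)}{\lambda}\right)^k\right]^{-1}$ (Constrained). For each $s^0\in\mathcal{S}^1$ such a solution exists and is unique. *)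

theory Defs
  imports "HOL-Probability.Probability"
begin

definition state_space :: "(nat \<Rightarrow> real) set" where
  "state_space = {s. (\<forall>i. 0 \<le> s i \<and> s i \<le> 1) \<and> s 0 = 1 \<and> (\<forall>i. s (Suc i) \<le> s i)}"

definition state_space_1 :: "(nat \<Rightarrow> real) set" where
  "state_space_1 = {s \<in> state_space. summable s}"

definition grid :: "nat \<Rightarrow> (nat \<Rightarrow> real) set" where
  "grid n = {x. \<forall>i. 0 \<le> x i \<and> x i \<le> 1 \<and> real n * x i \<in> \<nat>}"

definition wnorm :: "(nat \<Rightarrow> real) \<Rightarrow> real" where
  "wnorm x = sqrt (\<Sum>i. \<bar>x i\<bar>\<^sup>2 / 2 ^ i)"

text \<open>The arguments are the constants of the regime: the message rate \<open>\<mu>\<close> for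
  \<open>High_Memory\<close>, the memory size \<open>c\<close> for \<open>High_Message\<close>, and \<open>c\<close> and \<open>\<mu>\<close> for
  \<open>Constrained\<close>.\<close>

datatype regime = High_Memory real | High_Message nat | Constrained nat real

fun in_regime :: "regime \<Rightarrow> (nat \<Rightarrow> nat) \<Rightarrow> (nat \<Rightarrow> real) \<Rightarrow> bool" where
  "in_regime (High_Memory m) c mu \<longleftrightarrow>
     filterlim c at_top sequentially \<and> (\<lambda>n. real (c n) / real n) \<longlonglongrightarrow> 0 \<and>
     0 < m \<and> (\<forall>n\<ge>1. mu n = m)"
| "in_regime (High_Message k) c mu \<longleftrightarrow>
     1 \<le> k \<and> (\<forall>n\<ge>1. c n = k) \<and>
     (\<forall>n\<ge>1. mu n \<le> mu (Suc n)) \<and> filterlim mu at_top sequentially"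
| "in_regime (Constrained k m) c mu \<longleftrightarrow>
     1 \<le> k \<and> (\<forall>n\<ge>1. c n = k) \<and> 0 < m \<and> (\<forall>n\<ge>1. mu n = m)"

fun P0 :: "real \<Rightarrow> regime \<Rightarrow> (nat \<Rightarrow> real) \<Rightarrow> real" where
  "P0 lam (High_Memory m) s = max (1 - m * (1 - s 1) / lam) 0"
| "P0 lam (High_Message k) s =
     max (1 - (1 - s 2) / lam) 0 * indicator {x. x 1 = 1} s"
| "P0 lam (Constrained k m) s = inverse (\<Sum>j=0..k. (m * (1 - s 1) / lam) ^ j)"

definition drift :: "real \<Rightarrow> regime \<Rightarrow> (nat \<Rightarrow> real) \<Rightarrow> nat \<Rightarrow> real" where
  "drift lam R s i =
     (if i = 1
      then lam * (1 - P0 lam R s) + lam * (1 - s 1) * P0 lam R s - (s 1 - s 2)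
      else lam * (s (i - 1) - s i) * P0 lam R s - (s i - s (i + 1)))"

definition fluid_solution ::
  "real \<Rightarrow> regime \<Rightarrow> (nat \<Rightarrow> real) \<Rightarrow> (real \<Rightarrow> nat \<Rightarrow> real) \<Rightarrow> bool" where
  "fluid_solution lam R s0 s \<longleftrightarrow>
     (\<forall>t\<ge>0. s t \<in> state_space_1) \<and>
     (\<forall>t\<ge>0. ((\<lambda>u. wnorm (\<lambda>i. s u i - s t i)) \<longlongrightarrow> 0) (at t within {0..})) \<and>
     (\<exists>L. \<forall>i. L-lipschitz_on {0..} (\<lambda>t. s t i)) \<and>
     s 0 = s0 \<and>
     (\<forall>t\<ge>0. s t 0 = 1) \<and>
     (AE t in lebesgue. 0 \<le> t \<longrightarrow>
        (\<forall>i\<ge>1. ((\<lambda>u. s u i) has_real_derivative drift lam R (s t) i) (at t within {0..})))"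

definition event_time :: "(real \<Rightarrow> nat) \<Rightarrow> nat \<Rightarrow> real" where
  "event_time N j = Inf {t. 0 \<le> t \<and> j \<le> N t}"

definition event_set :: "(real \<Rightarrow> nat) \<Rightarrow> real set" where
  "event_set N = {t. 0 < t \<and> (\<forall>u. 0 \<le> u \<and> u < t \<longrightarrow> N u < N t)}"

definition left_lim :: "(real \<Rightarrow> 'b::t2_space) \<Rightarrow> real \<Rightarrow> 'b" where
  "left_lim f t = Lim (at_left t) f"

context prob_space
begin

text \<open>Truncated subtraction of the increments is harmless, since the paths are a.s.
  nondecreasing. That all jumps have size one a.s. follows from the Poisson
  increments.\<close>

definition poisson_process :: "real \<Rightarrow> (real \<Rightarrow> 'a \<Rightarrow> nat) \<Rightarrow> bool" where
  "poisson_process rate N \<longleftrightarrow>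
     (\<forall>t\<ge>0. random_variable (count_space UNIV) (N t)) \<and>
     (AE w in M. N 0 w = 0 \<and> mono_on {0..} (\<lambda>t. N t w) \<and>
        (\<forall>t\<ge>0. continuous (at_right t) (\<lambda>u. N u w))) \<and>
     (\<forall>s t. 0 \<le> s \<longrightarrow> s < t \<longrightarrow>
        distr M (count_space UNIV) (\<lambda>w. N t w - N s w) =
          measure_pmf (poisson_pmf (rate * (t - s)))) \<and>
     (\<forall>\<tau>::nat \<Rightarrow> real. 0 \<le> \<tau> 0 \<longrightarrow> mono \<tau> \<longrightarrow>
        indep_vars (\<lambda>_. count_space UNIV) (\<lambda>k w. N (\<tau> (Suc k)) w - N (\<tau> k) w) UNIV)"

definition iid_uniform :: "(nat \<Rightarrow> 'a \<Rightarrow> real) \<Rightarrow> bool" where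
  "iid_uniform X \<longleftrightarrow>
     indep_vars (\<lambda>_. borel) X {1..} \<and>
     (\<forall>k\<ge>1. distr M borel (X k) = uniform_measure lborel {0..1})"

definition generated :: "'b measure \<Rightarrow> ('i \<Rightarrow> 'a \<Rightarrow> 'b) \<Rightarrow> 'i set \<Rightarrow> 'a set set" where
  "generated B X I =
     sigma_sets (space M) {X i -` A \<inter> space M | i A. i \<in> I \<and> A \<in> sets B}"

end

text \<open>The following three functions act on sample paths. \<open>N\<close> is the path of the
  time-scaled process, e.g. \<open>t \<mapsto> N\<^sub>\<lambda> (n t)\<close>.\<close>

definition arrivals ::
  "nat \<Rightarrow> nat \<Rightarrow> (real \<Rightarrow> nat) \<Rightarrow> (nat \<Rightarrow> real) \<Rightarrow> (real \<Rightarrow> nat \<Rightarrow> real) \<Rightarrow> (real \<Rightarrow> nat)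
     \<Rightarrow> nat \<Rightarrow> real \<Rightarrow> real" where
  "arrivals n c N U S M i t =
     (let m = (\<lambda>j. left_lim M (event_time N j));
          s = (\<lambda>i j. left_lim (\<lambda>u. S u i) (event_time N j))
      in if i = 0 then 0
         else if i = 1 then
           1 / real n * (\<Sum>j=1..N t. indicator {1..c} (m j) +
                              indicator {0} (m j) * indicator {0..<1 - s 1 j} (U j))
         else
           1 / real n * (\<Sum>j=1..N t. indicator {0} (m j) *
                              indicator {1 - s (i - 1) j..<1 - s i j} (U j)))"

definition departures ::
  "nat \<Rightarrow> (real \<Rightarrow> nat) \<Rightarrow> (nat \<Rightarrow> real) \<Rightarrow> (real \<Rightarrow> nat \<Rightarrow> real) \<Rightarrow> nat \<Rightarrow> real \<Rightarrow> real" where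
  "departures n N W S i t =
     (let s = (\<lambda>i j. left_lim (\<lambda>u. S u i) (event_time N j))
      in if i = 0 then 0
         else 1 / real n * (\<Sum>j=1..N t. indicator {1 - s i j..<1 - s (i + 1) j} (W j)))"

text \<open>The interval \<open>[0, c - 1]\<close> is taken in the reals, so it is empty for \<open>c = 0\<close>.\<close>

definition token_change ::
  "nat \<Rightarrow> nat \<Rightarrow> (real \<Rightarrow> nat) \<Rightarrow> (real \<Rightarrow> nat) \<Rightarrow> (nat \<Rightarrow> real) \<Rightarrow> (real \<Rightarrow> nat \<Rightarrow> real)
     \<Rightarrow> (real \<Rightarrow> nat) \<Rightarrow> real \<Rightarrow> real" where
  "token_change n c N N' V S M t =
     - (\<Sum>j=1..N t. indicator {1..c} (left_lim M (event_time N j)))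
     + (\<Sum>j=1..N' t.
          (let m = real (left_lim M (event_time N' j));
               s1 = left_lim (\<lambda>u. S u 1) (event_time N' j)
           in indicator {0..real c - 1} m * indicator {0..<1 - s1 - m / real n} (V j)))"

datatype source = Src_Arrivals | Src_Services | Src_Messages | Src_U | Src_V | Src_W | Src_Initial

text \<open>For a constant memory size \<open>c\<close> the requirement \<open>c(n) \<le> n\<close> of the model fails for
  the finitely many \<open>n < c\<close>; accordingly the \<open>n\<close>-th system is only required to exist
  for \<open>n\<close> in \<open>{n. 1 \<le> n \<and> c n \<le> n}\<close>, and the remaining members of the sequences are
  arbitrary. All regimes imply \<open>c n \<le> n\<close> for large \<open>n\<close>.

  In \<open>independence\<close>, the processes \<open>N_mu n\<close> form one source (they are coupled with
  each other), and so do the initial conditions of all systems. The \<open>\<sigma>\<close>-algebra of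
  the latter is generated by the coordinates, i.e. it is that of the Borel sets of
  \<open>\<parallel>\<cdot>\<parallel>\<^sub>w\<close> on \<open>[0,1]\<close>-valued sequences.\<close>

locale coupled_system = prob_space \<Omega>
  for \<Omega> :: "'w measure" +
  fixes lam :: real and c :: "nat \<Rightarrow> nat" and mu :: "nat \<Rightarrow> real"
    and N_lam :: "real \<Rightarrow> 'w \<Rightarrow> nat"
    and N_one :: "real \<Rightarrow> 'w \<Rightarrow> nat"
    and N_mu :: "nat \<Rightarrow> real \<Rightarrow> 'w \<Rightarrow> nat"
    and U V W :: "nat \<Rightarrow> 'w \<Rightarrow> real"
    and S0 :: "nat \<Rightarrow> 'w \<Rightarrow> nat \<Rightarrow> real"
    and M0 :: "nat \<Rightarrow> 'w \<Rightarrow> nat"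
    and S :: "nat \<Rightarrow> real \<Rightarrow> 'w \<Rightarrow> nat \<Rightarrow> real"
    and M :: "nat \<Rightarrow> real \<Rightarrow> 'w \<Rightarrow> nat"
  assumes mu_pos: "n \<ge> 1 \<Longrightarrow> 0 < mu n"
    and mu_mono: "n \<ge> 1 \<Longrightarrow> mu n \<le> mu (Suc n)"
    and poisson_lam: "poisson_process lam N_lam"
    and poisson_one: "poisson_process 1 N_one"
    and poisson_mu: "n \<ge> 1 \<Longrightarrow> poisson_process (mu n) (N_mu n)"
    and coupling: "n \<ge> 1 \<Longrightarrow>
      AE w in \<Omega>. event_set (\<lambda>t. N_mu n t w) \<subseteq> event_set (\<lambda>t. N_mu (Suc n) t w)"
    and uniform: "iid_uniform U" "iid_uniform V" "iid_uniform W"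
    and independence: "indep_sets (\<lambda>k. case k of
          Src_Arrivals \<Rightarrow> generated (count_space UNIV) N_lam {0..}
        | Src_Services \<Rightarrow> generated (count_space UNIV) N_one {0..}
        | Src_Messages \<Rightarrow> generated (count_space UNIV) (\<lambda>(n, t). N_mu n t) ({1..} \<times> {0..})
        | Src_U \<Rightarrow> generated borel U {1..}
        | Src_V \<Rightarrow> generated borel V {1..}
        | Src_W \<Rightarrow> generated borel W {1..}
        | Src_Initial \<Rightarrow> sigma_sets (space \<Omega>)
            (generated borel (\<lambda>(n, i) w. S0 n w i) ({n. 1 \<le> n \<and> c n \<le> n} \<times> UNIV) \<union>
             generated (count_space UNIV) M0 {n. 1 \<le> n \<and> c n \<le> n})) UNIV"
    and initial: "1 \<le> n \<Longrightarrow> c n \<le> n \<Longrightarrow>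
      AE w in \<Omega>. S0 n w \<in> state_space_1 \<inter> grid n \<and> M0 n w \<le> c n \<and>
        real (M0 n w) \<le> real n * (1 - S0 n w 1)"
    and S_evolution: "1 \<le> n \<Longrightarrow> c n \<le> n \<Longrightarrow>
      AE w in \<Omega>. \<forall>t\<ge>0. \<forall>i. S n t w i = S0 n w i
        + arrivals n (c n) (\<lambda>t. N_lam (real n * t) w) (\<lambda>k. U k w)
            (\<lambda>t. S n t w) (\<lambda>t. M n t w) i t
        - departures n (\<lambda>t. N_one (real n * t) w) (\<lambda>k. W k w) (\<lambda>t. S n t w) i t"
    and M_evolution: "1 \<le> n \<Longrightarrow> c n \<le> n \<Longrightarrow>
      AE w in \<Omega>. \<forall>t\<ge>0. real (M n t w) = real (M0 n w)
        + token_change n (c n) (\<lambda>t. N_lam (real n * t) w) (\<lambda>t. N_mu n (real n * t) w)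
            (\<lambda>k. V k w) (\<lambda>t. S n t w) (\<lambda>t. M n t w) t"

end

theory Submission
  imports Defs
begin

text \<open>
  The proof compares the \<open>n\<close>-th system with the fluid solution along a grid in time whose mesh
  shrinks so fast that, almost surely and for all large \<open>n\<close>, no cell of the grid contains two events.
  On such a path the system observed at the grid points is a deterministic recursion (\<open>chain\<close>) driven
  by the increments of the Poisson processes and the uniform marks; this gives a measurable version
  of the state, and shows at each time which part of the randomness the state has already seen.

  All probabilistic input is one law of large numbers. Count the events of one of the three streams
  whose mark falls into an interval that depends on the present state. The compensated count is
  a martingale. With a slightly larger compensator its exponential is a supermartingale, separately in the
  Poisson increments (with all marks known) and in the marks (with all increments known). The maximal inequality
  \<open>predictable_product_maximal\<close> bounds the deviations by \<open>exp (- \<epsilon> n)\<close> uniformly in time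
  (\<open>counts_concentrate\<close>), so by Borel and Cantelli counts and compensators agree up to \<open>o(n)\<close>
  almost surely (\<open>AE_law_of_large_numbers\<close>). The rest is deterministic.

  Write \<open>e\<close> for the difference between the system and the fluid solution, \<open>Y\<close> for the square of its weighted
  norm, and \<open>D\<close> for the indicator that no token is stored. Each coordinate of the system is, up to
  \<open>o(1)\<close>, driven by \<open>lam * D\<close> where the fluid solution is driven by \<open>lam * P0\<close>. Summation by
  parts bounds \<open>e\<close> by its own time integral and by the difference of the integrals of \<open>lam * D\<close> and
  \<open>lam * P0\<close>. By Gronwall's inequality (\<open>Y_null\<close>) everything reduces to estimating the square of the latter
  difference by \<open>o(1)\<close> plus a multiple of the integral of \<open>Y\<close>.

  This estimate is the separation of time scales. In the Constrained and High Memory regimes the token count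
  crosses each level upwards and downwards equally often, up to one. Hence the occupation indicators
  of consecutive levels have ratio \<open>r = mu (1 - x1) / lam\<close> when integrated against Lipschitz functions of the
  slow variable \<open>x1\<close>. Under bounded memory the levels sum to one, which identifies \<open>D\<close> with the inverse
  of the geometric sum (\<open>Y_null_Constrained\<close>). Under growing memory the first \<open>J\<close> levels give
  an upper bound close to \<open>1 - r\<close> or \<open>0\<close>, and the balance of all tokens gives the lower bound
  \<open>1 - r\<close> (\<open>Y_null_High_Memory\<close>). In the High Message regime \<open>P0\<close> is discontinuous and there is no such
  identity. There \<open>(1 - x1) D\<close> integrates to \<open>o(1)\<close> because idle servers would otherwise send too many
  messages, while the fluid solution satisfies \<open>(1 - s1) P0 = 0\<close> exactly. The two complementarity
  relations make the term \<open>(x1 - s1) (D - P0)\<close> nonnegative up to \<open>o(1)\<close>, as for reflection at the barrier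
  \<open>1\<close>; this controls first \<open>x1 - s1\<close> and then, through the first equation, the difference of the
  integrals (\<open>Y_null_High_Message\<close>).
\<close>

section \<open>Exponential supermartingales\<close>

text \<open>A variable independent of the past can be integrated out first while the past is kept fixed,
  because the joint law of the past (as the identity map into the smaller \<open>\<sigma>\<close>-algebra) and the variable is a product.\<close>

lemma (in prob_space) nn_integral_fresh:
  fixes f :: "'a \<Rightarrow> real \<Rightarrow> ennreal"
  assumes sub: "subalgebra M G" and X: "X \<in> borel_measurable M"
    and ind: "indep_set (sets G) (sigma_sets (space M) {X -` A \<inter> space M | A. A \<in> sets borel})"
    and f: "(\<lambda>(w, x). f w x) \<in> borel_measurable (G \<Otimes>\<^sub>M borel)"
  shows "(\<integral>\<^sup>+w. f w (X w) \<partial>M) = (\<integral>\<^sup>+w. (\<integral>\<^sup>+x. f w x \<partial>distr M borel X) \<partial>M)"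
proof -
  have sp: "space G = space M" and le: "sets G \<subseteq> sets M"
    using sub by (auto simp: subalgebra_def)
  have idm: "id \<in> measurable M G"
    using le sp by (auto simp: measurable_def)
  have pr: "(\<lambda>w. (w, X w)) \<in> measurable M (G \<Otimes>\<^sub>M borel)"
    using idm X by (intro measurable_Pair) (auto simp: id_def)
  interpret PX: prob_space "distr M borel X" using X by (rule prob_space_distr)
  interpret PG: prob_space "distr M G id" using idm by (rule prob_space_distr)
  have d: "distr M G id \<Otimes>\<^sub>M distr M borel X = distr M (G \<Otimes>\<^sub>M borel) (\<lambda>w. (w, X w))"
  proof (rule pair_measure_eqI)
    show "sets (distr M G id \<Otimes>\<^sub>M distr M borel X) = sets (distr M (G \<Otimes>\<^sub>M borel) (\<lambda>w. (w, X w)))"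
      unfolding sets_distr by (rule sets_pair_measure_cong) auto
  next
    fix A B assume AB: "A \<in> sets (distr M G id)" "B \<in> sets (distr M borel X)"
    then have A: "A \<in> sets G" and B: "B \<in> sets borel" by auto
    have "X -` B \<inter> space M \<in> sigma_sets (space M) {X -` A \<inter> space M | A. A \<in> sets borel}"
      using B by auto
    from indep_setD[OF ind A this]
    have "prob (A \<inter> (X -` B \<inter> space M)) = prob A * prob (X -` B \<inter> space M)" .
    moreover have "A \<subseteq> space M" using A sets.sets_into_space[of A G] sp by simp
    ultimately have "emeasure M (A \<inter> (X -` B \<inter> space M)) = emeasure M A * emeasure M (X -` B \<inter> space M)"
      by (simp add: emeasure_eq_measure flip: ennreal_mult)
    moreover have "emeasure (distr M G id) A = emeasure M A"
      using A idm \<open>A \<subseteq> space M\<close> by (subst emeasure_distr) (auto simp: Int_absorb2)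
    moreover have "emeasure (distr M borel X) B = emeasure M (X -` B \<inter> space M)"
      using B X by (subst emeasure_distr) auto
    moreover have "emeasure (distr M (G \<Otimes>\<^sub>M borel) (\<lambda>w. (w, X w))) (A \<times> B) = emeasure M (A \<inter> (X -` B \<inter> space M))"
      using A B pr \<open>A \<subseteq> space M\<close> by (subst emeasure_distr) (auto intro!: arg_cong[of _ _ "emeasure M"])
    ultimately show "emeasure (distr M G id) A * emeasure (distr M borel X) B =
      emeasure (distr M (G \<Otimes>\<^sub>M borel) (\<lambda>w. (w, X w))) (A \<times> B)" by simp
  qed unfold_locales
  have "(\<integral>\<^sup>+w. f w (X w) \<partial>M) = (\<integral>\<^sup>+p. (case p of (w, x) \<Rightarrow> f w x) \<partial>distr M (G \<Otimes>\<^sub>M borel) (\<lambda>w. (w, X w)))"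
    using f pr by (subst nn_integral_distr) auto
  also have "\<dots> = (\<integral>\<^sup>+p. (case p of (w, x) \<Rightarrow> f w x) \<partial>(distr M G id \<Otimes>\<^sub>M distr M borel X))"
    by (simp add: d)
  also have "\<dots> = (\<integral>\<^sup>+w. (\<integral>\<^sup>+x. f w x \<partial>distr M borel X) \<partial>distr M G id)"
  proof (subst PX.nn_integral_fst[symmetric])
    have "sets (distr M G id \<Otimes>\<^sub>M distr M borel X) = sets (G \<Otimes>\<^sub>M (borel :: real measure))"
      by (rule sets_pair_measure_cong) auto
    then show "(\<lambda>(w, x). f w x) \<in> borel_measurable (distr M G id \<Otimes>\<^sub>M distr M borel X)"
      using f measurable_cong_sets by blast
  qed simp
  also have "\<dots> = (\<integral>\<^sup>+w. (\<integral>\<^sup>+x. f w x \<partial>distr M borel X) \<partial>M)"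
  proof (subst nn_integral_distr[OF idm])
    have "sets (G \<Otimes>\<^sub>M distr M borel X) = sets (G \<Otimes>\<^sub>M (borel :: real measure))"
      by (rule sets_pair_measure_cong) auto
    then have "(\<lambda>(w, x). f w x) \<in> borel_measurable (G \<Otimes>\<^sub>M distr M borel X)"
      using f measurable_cong_sets by blast
    then have "(\<lambda>w. \<integral>\<^sup>+x. f w x \<partial>distr M borel X) \<in> borel_measurable G"
      using PX.borel_measurable_nn_integral_fst by fastforce
    then show "(\<lambda>w. \<integral>\<^sup>+x. f w x \<partial>distr M borel X) \<in> borel_measurable (distr M G id)"
      by simp
  qed simp
  finally show ?thesis .
qed

text \<open>Ville's inequality for a product of nonnegative factors, each of conditional mean at most one. Stopping
  the product once it has reached the level \<open>C\<close> keeps it a supermartingale, and the stopped product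
  is at least \<open>C\<close> at the last step exactly if the original one is so at some step; Markov's inequality then suffices.\<close>

lemma (in prob_space) predictable_product_maximal:
  fixes f :: "nat \<Rightarrow> 'a \<Rightarrow> real \<Rightarrow> ennreal" and X :: "nat \<Rightarrow> 'a \<Rightarrow> real"
  assumes sub: "\<And>j. subalgebra M (G j)" and inc: "\<And>j. sets (G j) \<subseteq> sets (G (Suc j))"
    and X: "\<And>j. X j \<in> borel_measurable (G (Suc j))"
    and ind: "\<And>j. indep_set (sets (G j)) (sigma_sets (space M) {X j -` A \<inter> space M | A. A \<in> sets borel})"
    and f: "\<And>j. (\<lambda>(w, x). f j w x) \<in> borel_measurable (G j \<Otimes>\<^sub>M borel)"
    and le1: "\<And>j w. w \<in> space M \<Longrightarrow> (\<integral>\<^sup>+x. f j w x \<partial>distr M borel (X j)) \<le> 1"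
    and C: "0 < C"
  shows "{w \<in> space M. \<exists>k\<le>K. ennreal C \<le> (\<Prod>j<k. f j w (X j w))} \<in> sets M" (is "?A \<in> _")
    and "measure M {w \<in> space M. \<exists>k\<le>K. ennreal C \<le> (\<Prod>j<k. f j w (X j w))} \<le> 1 / C"
proof -
  have sp: "space (G j) = space M" and le: "sets (G j) \<subseteq> sets M" for j
    using sub by (auto simp: subalgebra_def)
  have GM: "g \<in> borel_measurable M" if "g \<in> borel_measurable (G j)" for g :: "'a \<Rightarrow> ennreal" and j
    using that measurable_from_subalg[OF sub] by blast
  have XM: "X j \<in> borel_measurable M" for j
    using X measurable_from_subalg[OF sub] by blast
  have incS: "g \<in> borel_measurable (G (Suc j))" if "g \<in> borel_measurable (G j)" for g :: "'a \<Rightarrow> ennreal" and j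
    using that inc sp by (auto simp: measurable_def)
  have fX: "(\<lambda>w. f j w (X j w)) \<in> borel_measurable (G (Suc j))" for j
  proof -
    have id: "(\<lambda>w. w) \<in> measurable (G (Suc j)) (G j)"
      using inc sp by (auto simp: measurable_def sets.Int_space_eq2 simp flip: sp[of "Suc j"])
    have "(\<lambda>w. (w, X j w)) \<in> measurable (G (Suc j)) (G j \<Otimes>\<^sub>M borel)"
      by (intro measurable_Pair id X)
    from measurable_compose[OF this f] show ?thesis by simp
  qed
  \<comment> \<open>The product, stopped as soon as it has reached the level \<open>C\<close>.\<close>
  define Q where "Q = rec_nat (\<lambda>w. 1) (\<lambda>j q w. if ennreal C \<le> q w then q w else q w * f j w (X j w))"
  have Q0: "Q 0 = (\<lambda>w. 1)" and QS: "Q (Suc j) = (\<lambda>w. if ennreal C \<le> Q j w then Q j w else Q j w * f j w (X j w))" for j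
    by (auto simp: Q_def)
  have Qm[measurable]: "Q j \<in> borel_measurable (G j)" for j
  proof (induction j)
    case (Suc j)
    have [measurable]: "Q j \<in> borel_measurable (G (Suc j))" using incS Suc by blast
    note [measurable] = fX[of j]
    show ?case unfolding QS by measurable
  qed (simp add: Q0)
  have Q1: "(\<integral>\<^sup>+w. Q j w \<partial>M) \<le> 1" for j
  proof (induction j)
    case (Suc j)
    let ?g = "\<lambda>w x. if ennreal C \<le> Q j w then Q j w else Q j w * f j w x"
    have [measurable]: "(\<lambda>p. Q j (fst p)) \<in> borel_measurable (G j \<Otimes>\<^sub>M borel)"
      by measurable
    have [measurable]: "(\<lambda>p. f j (fst p) (snd p)) \<in> borel_measurable (G j \<Otimes>\<^sub>M borel)"
      using f[of j] by (simp add: case_prod_beta')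
    have "(\<lambda>p. ?g (fst p) (snd p)) \<in> borel_measurable (G j \<Otimes>\<^sub>M borel)"
      by measurable
    then have "(\<integral>\<^sup>+w. Q (Suc j) w \<partial>M) = (\<integral>\<^sup>+w. (\<integral>\<^sup>+x. ?g w x \<partial>distr M borel (X j)) \<partial>M)"
      unfolding QS by (intro nn_integral_fresh[OF sub XM ind]) (simp add: case_prod_beta')
    also have "\<dots> \<le> (\<integral>\<^sup>+w. Q j w \<partial>M)"
    proof (rule nn_integral_mono)
      fix w assume w: "w \<in> space M"
      interpret PX: prob_space "distr M borel (X j)" using XM by (rule prob_space_distr)
      have "f j w \<in> borel_measurable borel"
        using measurable_compose[OF measurable_Pair1' f[of j]] w sp by force
      then have "(\<integral>\<^sup>+x. Q j w * f j w x \<partial>distr M borel (X j)) = Q j w * (\<integral>\<^sup>+x. f j w x \<partial>distr M borel (X j))"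
        by (intro nn_integral_cmult) simp
      also have "\<dots> \<le> Q j w" using mult_left_mono[OF le1[OF w, of j], of "Q j w"] by simp
      finally show "(\<integral>\<^sup>+x. ?g w x \<partial>distr M borel (X j)) \<le> Q j w"
        using PX.emeasure_space_1 by (cases "ennreal C \<le> Q j w") auto
    qed
    finally show ?case using Suc by simp
  qed (simp add: Q0 emeasure_space_1)
  have Qprod: "(\<exists>k\<le>K. ennreal C \<le> (\<Prod>j<k. f j w (X j w))) \<longleftrightarrow> ennreal C \<le> Q K w" for w
  proof -
    have "(ennreal C \<le> Q K w \<longleftrightarrow> (\<exists>k\<le>K. ennreal C \<le> (\<Prod>j<k. f j w (X j w)))) \<and>
       (\<not> ennreal C \<le> Q K w \<longrightarrow> Q K w = (\<Prod>j<K. f j w (X j w)))" for K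
    proof (induction K)
      case (Suc K)
      have "(\<exists>k\<le>Suc K. ennreal C \<le> (\<Prod>j<k. f j w (X j w))) \<longleftrightarrow>
        (\<exists>k\<le>K. ennreal C \<le> (\<Prod>j<k. f j w (X j w))) \<or> ennreal C \<le> (\<Prod>j<Suc K. f j w (X j w))"
        by (metis le_Suc_eq)
      with Suc show ?case by (auto simp: QS mult.commute)
    qed (auto simp: Q0)
    then show ?thesis by blast
  qed
  have QM: "Q K \<in> borel_measurable M" using GM Qm by blast
  show "?A \<in> sets M" unfolding Qprod using QM by measurable
  have "emeasure M ?A = emeasure M {w \<in> space M. 1 \<le> ennreal (1 / C) * Q K w}"
  proof -
    have "ennreal C \<le> q \<longleftrightarrow> 1 \<le> ennreal (1 / C) * q" for q
    proof -
      have "ennreal (1/C) * ennreal C = 1" using C by (simp flip: ennreal_mult)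
      moreover have "ennreal C * (ennreal (1/C) * q) = q"
        using \<open>ennreal (1/C) * ennreal C = 1\<close> by (metis mult.assoc mult.commute mult_1)
      ultimately show ?thesis
        by (metis mult_left_mono mult.right_neutral zero_le)
    qed
    then show ?thesis unfolding Qprod by simp
  qed
  also have "\<dots> \<le> ennreal (1 / C) * (\<integral>\<^sup>+w. Q K w * indicator (space M) w \<partial>M)"
    by (rule nn_integral_Markov_inequality) (use QM in auto)
  also have "(\<integral>\<^sup>+w. Q K w * indicator (space M) w \<partial>M) = (\<integral>\<^sup>+w. Q K w \<partial>M)"
    by (rule nn_integral_cong) auto
  also have "ennreal (1 / C) * (\<integral>\<^sup>+w. Q K w \<partial>M) \<le> ennreal (1 / C)"
    using mult_left_mono[OF Q1[of K], of "ennreal (1/C)"] by simp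
  finally show "measure M ?A \<le> 1 / C"
    using C by (simp add: emeasure_eq_measure)
qed

section \<open>The dynamics observed on a fine time grid\<close>

datatype flow = Arrival | Service | Message

text \<open>Indices of the independent pieces of randomness that drive the recursion on the grid: the increment of a
  stream in a cell, the mark of an event, and the initial state of the system.\<close>

datatype noise = Inc flow nat | Mark flow nat | Ini

abbreviation state_measure :: "((nat \<Rightarrow> real) \<times> nat) measure" where
  "state_measure \<equiv> PiM UNIV (\<lambda>_. borel) \<Otimes>\<^sub>M count_space UNIV"

text \<open>Intervals are pairs of end points, closed on the left and open on the right.\<close>

definition hit :: "real \<times> real \<Rightarrow> real \<Rightarrow> bool" where
  "hit p u \<longleftrightarrow> fst p \<le> u \<and> u < snd p"

text \<open>The probability that a uniform mark lies in the interval, for arbitrary end points.\<close>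

definition len :: "real \<times> real \<Rightarrow> real" where
  "len p = max 0 (min 1 (snd p) - max 0 (fst p))"

text \<open>Where a mark must fall for the event to change level \<open>i\<close> of the queue lengths or the number of tokens. If a
  token is stored, the interval for level \<open>1\<close> is \<open>[0, 1)\<close>, which every mark hits: the arrival joins an empty queue.\<close>

definition arr_iv :: "nat \<Rightarrow> (nat \<Rightarrow> real) \<times> nat \<Rightarrow> real \<times> real" where
  "arr_iv i z = (if i = 0 then (0, 0)
     else if i = 1 then (0, if snd z = 0 then 1 - fst z 1 else 1)
     else if snd z = 0 then (1 - fst z (i - 1), 1 - fst z i) else (0, 0))"

definition srv_iv :: "nat \<Rightarrow> (nat \<Rightarrow> real) \<times> nat \<Rightarrow> real \<times> real" where
  "srv_iv i z = (if i = 0 then (0, 0) else (1 - fst z i, 1 - fst z (i + 1)))"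

definition msg_iv :: "nat \<Rightarrow> nat \<Rightarrow> (nat \<Rightarrow> real) \<times> nat \<Rightarrow> real \<times> real" where
  "msg_iv n c z = (if snd z < c then (0, 1 - fst z 1 - real (snd z) / real n) else (0, 0))"

text \<open>The effect of the events of one cell of the grid, exact if there is at most one.\<close>

definition step :: "nat \<Rightarrow> nat \<Rightarrow> (flow \<Rightarrow> bool) \<Rightarrow> (flow \<Rightarrow> real) \<Rightarrow> (nat \<Rightarrow> real) \<times> nat \<Rightarrow> (nat \<Rightarrow> real) \<times> nat" where
  "step n c e u z =
     (\<lambda>i. fst z i + (of_bool (e Arrival \<and> hit (arr_iv i z) (u Arrival))
                    - of_bool (e Service \<and> hit (srv_iv i z) (u Service))) / real n,
      snd z - of_bool (e Arrival \<and> 1 \<le> snd z) + of_bool (e Message \<and> hit (msg_iv n c z) (u Message)))"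

text \<open>The marks are consumed one per event, so the mark used in cell \<open>k\<close> has as its index the number
  of earlier events of the stream.\<close>

primrec chain :: "nat \<Rightarrow> nat \<Rightarrow> (nat \<Rightarrow> real) \<times> nat \<Rightarrow> (flow \<Rightarrow> nat \<Rightarrow> nat) \<Rightarrow> (flow \<Rightarrow> nat \<Rightarrow> real)
    \<Rightarrow> nat \<Rightarrow> (nat \<Rightarrow> real) \<times> nat" where
  "chain n c z a u 0 = z"
| "chain n c z a u (Suc k) =
     step n c (\<lambda>s. 1 \<le> a s k) (\<lambda>s. u s (\<Sum>l<k. a s l)) (chain n c z a u k)"

lemma len_nonneg: "0 \<le> len p" and len_le_1: "len p \<le> 1"
  by (auto simp: len_def)

lemma step_cong: "(\<And>s. e s \<Longrightarrow> u s = v s) \<Longrightarrow> step n c e u z = step n c e v z"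
  by (auto simp: step_def intro!: ext)

text \<open>The state after \<open>k\<close> cells depends only on the marks of events in these cells. This is what makes it
  predictable in the order of the marks.\<close>

lemma chain_cong:
  assumes "\<And>s l. l < k \<Longrightarrow> 1 \<le> a s l \<Longrightarrow> u s (\<Sum>m<l. a s m) = v s (\<Sum>m<l. a s m)"
  shows "chain n c z a u k = chain n c z a v k"
  using assms
proof (induction k)
  case (Suc k)
  then have "chain n c z a u k = chain n c z a v k" by simp
  then show ?case using Suc.prems by (auto intro!: step_cong)
qed simp

lemma fst_component_measurable[measurable]:
  "(\<lambda>z. fst z (i::nat)) \<in> borel_measurable state_measure"
  by (rule measurable_compose[OF measurable_fst measurable_component_singleton]) simp

lemma arr_iv_measurable[measurable]: "arr_iv i \<in> measurable state_measure (borel \<Otimes>\<^sub>M borel)"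
  unfolding arr_iv_def[abs_def] by measurable

lemma srv_iv_measurable[measurable]: "srv_iv i \<in> measurable state_measure (borel \<Otimes>\<^sub>M borel)"
  unfolding srv_iv_def[abs_def] by measurable

lemma msg_iv_measurable[measurable]: "msg_iv n c \<in> measurable state_measure (borel \<Otimes>\<^sub>M borel)"
  unfolding msg_iv_def[abs_def] by measurable

lemma hit_measurable[measurable (raw)]:
  assumes [measurable]: "p \<in> measurable G (borel \<Otimes>\<^sub>M borel)" "u \<in> borel_measurable G"
  shows "Measurable.pred G (\<lambda>w. hit (p w) (u w))"
  unfolding hit_def by measurable

lemma len_measurable[measurable]: "len \<in> borel_measurable (borel \<Otimes>\<^sub>M borel)"
  unfolding len_def[abs_def] by measurable

lemma step_measurable:
  assumes [measurable]: "z \<in> measurable G state_measure"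
    "\<And>s. u s \<in> borel_measurable G" "\<And>s. Measurable.pred G (e s)"
  shows "(\<lambda>w. step n c (\<lambda>s. e s w) (\<lambda>s. u s w) (z w)) \<in> measurable G state_measure"
proof -
  have c1: "(\<lambda>w. fst (z w) i) \<in> borel_measurable G" for i
    using measurable_compose[OF assms(1) fst_component_measurable] .
  have c2: "(\<lambda>w. snd (z w)) \<in> measurable G (count_space UNIV)"
    using measurable_compose[OF assms(1) measurable_snd] .
  note c3 = measurable_compose[OF assms(1) arr_iv_measurable] measurable_compose[OF assms(1) srv_iv_measurable]
     measurable_compose[OF assms(1) msg_iv_measurable]
  have h: "Measurable.pred G (\<lambda>w. e Arrival w \<and> hit (arr_iv i (z w)) (u Arrival w))"
    "Measurable.pred G (\<lambda>w. e Service w \<and> hit (srv_iv i (z w)) (u Service w))"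
    "Measurable.pred G (\<lambda>w. e Message w \<and> hit (msg_iv n c (z w)) (u Message w))"
    for i
    by (intro pred_intros_logic assms(3) hit_measurable c3 assms(2))+
  have o: "(\<lambda>w. of_bool (P w) :: real) \<in> borel_measurable G" if "Measurable.pred G P" for P
    using that unfolding of_bool_def by (intro measurable_If) (auto simp: pred_def)
  have o': "(\<lambda>w. of_bool (P w) :: nat) \<in> measurable G (count_space UNIV)" if "Measurable.pred G P" for P
    using that unfolding of_bool_def by (intro measurable_If) (auto simp: pred_def)
  have g: "Measurable.pred G (\<lambda>w. e Arrival w \<and> 1 \<le> snd (z w))"
    by (intro pred_intros_logic assms(3) measurable_compose[OF c2]) simp
  show ?thesis unfolding step_def
  proof (intro measurable_Pair)
    show "(\<lambda>w i. fst (z w) i +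
              (of_bool (e Arrival w \<and> hit (arr_iv i (z w)) (u Arrival w)) -
               of_bool (e Service w \<and> hit (srv_iv i (z w)) (u Service w))) / real n)
      \<in> measurable G (PiM UNIV (\<lambda>_. borel))"
      by (intro measurable_PiM_single' borel_measurable_add borel_measurable_divide borel_measurable_diff
        o h c1 borel_measurable_const) auto
    note o'[OF h(3), measurable] o'[OF g, measurable] c2[measurable]
    show "(\<lambda>w. snd (z w) - of_bool (e Arrival w \<and> 1 \<le> snd (z w)) +
         of_bool (e Message w \<and> hit (msg_iv n c (z w)) (u Message w))) \<in> measurable G (count_space UNIV)"
      by (rule measurable_compose_countable[where g="\<lambda>w. of_bool (e Message w \<and> hit (msg_iv n c (z w)) (u Message w)) :: nat"
         and f="\<lambda>i w. snd (z w) - of_bool (e Arrival w \<and> 1 \<le> snd (z w)) + i", OF _ o'[OF h(3)]])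
       (rule measurable_compose_countable[where g="\<lambda>w. of_bool (e Arrival w \<and> 1 \<le> snd (z w)) :: nat"
         and f="\<lambda>i w. snd (z w) - i + _", OF _ o'[OF g]], rule measurable_compose[OF c2], simp)
  qed
qed

lemma chain_measurable:
  assumes [measurable]: "z \<in> measurable G state_measure"
    and a: "\<And>s l. l < k \<Longrightarrow> a s l \<in> measurable G (count_space UNIV)"
    and u[measurable]: "\<And>s j. u s j \<in> borel_measurable G"
  shows "(\<lambda>w. chain n c (z w) (\<lambda>s l. a s l w) (\<lambda>s j. u s j w) k) \<in> measurable G state_measure"
  using a
proof (induction k)
  case (Suc k)
  have am[measurable]: "a s l \<in> measurable G (count_space UNIV)" if "l \<le> k" for s l
    using that Suc.prems by simp
  have N[measurable]: "(\<lambda>w. \<Sum>l<k. a s l w) \<in> measurable G (count_space UNIV)" for s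
    by (rule measurable_sum_nat) (use am in auto)
  have "(\<lambda>w. u s (\<Sum>l<k. a s l w) w) \<in> borel_measurable G" for s
    by (rule measurable_compose_countable[OF u N])
  moreover have "Measurable.pred G (\<lambda>w. 1 \<le> a s k w)" for s
    using am[of k s] by measurable
  ultimately show ?case
    unfolding chain.simps by (intro step_measurable) (use Suc in auto)
qed simp

lemma prob_uniform_interval:
  "measure (uniform_measure lborel {0..1::real}) {x. hit p x} = len p"
proof -
  let ?P = "uniform_measure lborel {0..1::real}"
  define l r where "l = max 0 (fst p)" and "r = min 1 (snd p)"
  interpret prob_space ?P by (rule prob_space_uniform_measure) auto
  have eq: "{x. hit p x} = {fst p..<snd p}" by (auto simp: hit_def)
  have ms: "{x. hit p x} \<in> sets borel" unfolding eq by simp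
  have Icc: "{a..b} \<in> fmeasurable lborel" for a b :: real
    by (auto simp: fmeasurable_def emeasure_lborel_Icc_eq)
  then have fm: "{l..r} \<in> fmeasurable lborel" "{0..1} \<inter> {x. hit p x} \<in> fmeasurable lborel"
    unfolding eq by (auto intro: fmeasurable_Int_fmeasurable)
  have "measure lborel ({0..1} \<inter> {x. hit p x}) = len p"
  proof (rule antisym)
    have "{0..1} \<inter> {x. hit p x} \<subseteq> {l..r}" by (auto simp: hit_def l_def r_def)
    then have "measure lborel ({0..1} \<inter> {x. hit p x}) \<le> measure lborel {l..r}"
      by (intro measure_mono_fmeasurable fm) (auto simp: ms)
    also have "\<dots> = len p" by (auto simp: len_def l_def r_def measure_def max_def min_def emeasure_lborel_Icc_eq)
    finally show "measure lborel ({0..1} \<inter> {x. hit p x}) \<le> len p" .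
    have "{l<..<r} \<subseteq> {0..1} \<inter> {x. hit p x}" by (auto simp: hit_def l_def r_def)
    then have "measure lborel {l<..<r} \<le> measure lborel ({0..1} \<inter> {x. hit p x})"
      by (intro measure_mono_fmeasurable fm) auto
    moreover have "measure lborel {l<..<r} = len p"
      by (auto simp: len_def l_def r_def measure_def max_def min_def)
    ultimately show "len p \<le> measure lborel ({0..1} \<inter> {x. hit p x})" by simp
  qed
  then show ?thesis
    using ms by (subst measure_uniform_measure) auto
qed

lemma nn_integral_two_values:
  fixes b0 b1 :: real
  assumes "prob_space P" "Measurable.pred P A" "0 \<le> b0" "0 \<le> b1"
  shows "(\<integral>\<^sup>+x. ennreal (if A x then b1 else b0) \<partial>P) =
    ennreal (b1 * measure P {x\<in>space P. A x} + b0 * (1 - measure P {x\<in>space P. A x}))"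
proof -
  interpret prob_space P by fact
  note [measurable] = assms(2)
  have "(\<integral>\<^sup>+x. ennreal (if A x then b1 else b0) \<partial>P) =
     (\<integral>\<^sup>+x. ennreal b1 * indicator {x\<in>space P. A x} x + ennreal b0 * indicator {x\<in>space P. \<not> A x} x \<partial>P)"
    by (intro nn_integral_cong) auto
  also have "\<dots> = ennreal b1 * emeasure P {x\<in>space P. A x} + ennreal b0 * emeasure P {x\<in>space P. \<not> A x}"
    by (subst nn_integral_add) (auto simp: nn_integral_cmult_indicator)
  also have "emeasure P {x\<in>space P. \<not> A x} = ennreal (1 - measure P {x\<in>space P. A x})"
    by (subst prob_neg[symmetric]) (auto simp: emeasure_eq_measure)
  finally show ?thesis using assms(3,4) by (simp add: emeasure_eq_measure flip: ennreal_mult)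
qed

lemma one_minus_exp_bounds:
  fixes x :: real
  assumes "0 \<le> x"
  shows "0 \<le> 1 - exp (- x)" "1 - exp (- x) \<le> x" "x - x\<^sup>2 \<le> 1 - exp (- x)"
proof -
  show "0 \<le> 1 - exp (- x)" using assms by simp
  show "1 - exp (- x) \<le> x" using exp_ge_add_one_self[of "- x"] by linarith
  have "exp (- x) * (1 + x) \<le> exp (- x) * exp x" by (intro mult_left_mono) auto
  then have "exp (- x) * (1 + x) \<le> 1" by (simp flip: exp_add)
  then have "exp (- x) \<le> 1 / (1 + x)" using assms by (simp add: field_simps)
  also have "\<dots> \<le> 1 - x + x\<^sup>2"
  proof -
    have "1 \<le> (1 - x + x\<^sup>2) * (1 + x)" using assms by (simp add: algebra_simps power2_eq_square)
    then show ?thesis using assms by (simp add: field_simps)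
  qed
  finally show "x - x\<^sup>2 \<le> 1 - exp (- x)" by linarith
qed

lemma exp_interpolate: "exp (t * q) - 1 \<le> q * (exp t - (1::real))" if "0 \<le> q" "q \<le> 1"
proof -
  have "exp ((1 - q) *\<^sub>R 0 + q *\<^sub>R t) \<le> (1 - q) * exp 0 + q * exp t"
    by (rule convex_onD[OF exp_convex]) (use that in auto)
  then show ?thesis by (simp add: algebra_simps)
qed

text \<open>The exponential moment of a Bernoulli variable with weight \<open>q\<close>, after compensation. Convexity of the
  exponential makes the compensator linear in \<open>q\<close>, as needed to sum it over cells. With \<open>q = 1\<close> and \<open>p\<close> the
  length of an interval it is the bound for a mark that may fall into the interval.\<close>

lemma thinned_mgf_le:
  fixes t p q :: real
  assumes p: "0 \<le> p" "p \<le> 1" and q: "0 \<le> q" "q \<le> 1"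
  shows "exp (t * q - p * (exp t - 1) * q) * p + exp (- (p * (exp t - 1) * q)) * (1 - p) \<le> 1"
proof -
  have "exp (t * q - p * (exp t - 1) * q) * p + exp (- (p * (exp t - 1) * q)) * (1 - p)
    = exp (- (p * (exp t - 1) * q)) * (1 + p * (exp (t * q) - 1))"
    by (simp add: exp_diff exp_minus divide_inverse) (simp add: ring_distribs mult_ac)
  also have "\<dots> \<le> exp (- (p * (exp t - 1) * q)) * (1 + p * (q * (exp t - 1)))"
    by (intro mult_left_mono add_left_mono exp_interpolate) (use p q in auto)
  also have "\<dots> \<le> exp (- (p * (exp t - 1) * q)) * exp (p * (q * (exp t - 1)))"
    by (intro mult_left_mono) (auto simp: exp_ge_add_one_self)
  also have "\<dots> = 1" by (simp add: mult_ac flip: exp_add)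
  finally show ?thesis .
qed

section \<open>Concentration of predictable thinnings\<close>

text \<open>A recursion \<open>chain\<close> driven by independent noise: Poisson increments \<open>a\<close> with mean \<open>\<rho>\<close>, uniform
  marks \<open>u\<close>, and an initial state that is measurable with respect to \<open>I0\<close>.\<close>

locale grid_noise = prob_space \<Omega> for \<Omega> :: "'w measure" +
  fixes z0 :: "'w \<Rightarrow> (nat \<Rightarrow> real) \<times> nat"
    and a :: "flow \<Rightarrow> nat \<Rightarrow> 'w \<Rightarrow> nat" and u :: "flow \<Rightarrow> nat \<Rightarrow> 'w \<Rightarrow> real"
    and I0 :: "'w set set" and \<rho> :: "flow \<Rightarrow> real" and n c :: nat
  assumes indep: "indep_sets (\<lambda>x. case x of
        Inc s k \<Rightarrow> {a s k -` A \<inter> space \<Omega> | A. A \<in> sets (count_space UNIV)}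
      | Mark s j \<Rightarrow> {u s j -` A \<inter> space \<Omega> | A. A \<in> sets borel}
      | Ini \<Rightarrow> I0) UNIV"
    and I0_stable: "Int_stable I0"
    and z0_meas: "z0 \<in> measurable (sigma (space \<Omega>) I0) state_measure"
    and a_meas: "\<And>s k. a s k \<in> measurable \<Omega> (count_space UNIV)"
    and u_meas: "\<And>s j. u s j \<in> borel_measurable \<Omega>"
    and a_distr: "\<And>s k. distr \<Omega> (count_space UNIV) (a s k) = measure_pmf (poisson_pmf (\<rho> s))"
    and \<rho>_pos: "\<And>s. 0 < \<rho> s"
    and u_distr: "\<And>s j. distr \<Omega> borel (u s j) = uniform_measure lborel {0..1}"
begin

lemma \<rho>_nonneg: "0 \<le> \<rho> s" using \<rho>_pos[of s] by simp

definition noise_sets :: "noise \<Rightarrow> 'w set set" where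
  "noise_sets x = (case x of
        Inc s k \<Rightarrow> {a s k -` A \<inter> space \<Omega> | A. A \<in> sets (count_space UNIV)}
      | Mark s j \<Rightarrow> {u s j -` A \<inter> space \<Omega> | A. A \<in> sets borel}
      | Ini \<Rightarrow> I0)"

text \<open>The \<open>\<sigma>\<close>-algebra of a set of noise indices. For increments and for marks two different filtrations of
  this form are used: the past of an increment contains all marks, and the past of a mark all increments.\<close>

definition past :: "noise set \<Rightarrow> 'w measure" where
  "past P = sigma (space \<Omega>) (\<Union>x\<in>P. noise_sets x)"

definition state :: "nat \<Rightarrow> 'w \<Rightarrow> (nat \<Rightarrow> real) \<times> nat" where
  "state k w = chain n c (z0 w) (\<lambda>s l. a s l w) (\<lambda>s j. u s j w) k"

definition events_before :: "flow \<Rightarrow> nat \<Rightarrow> 'w \<Rightarrow> nat" where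
  "events_before s k w = (\<Sum>l<k. a s l w)"

definition event_prob :: "flow \<Rightarrow> real" where
  "event_prob s = 1 - exp (- \<rho> s)"

lemma noise_sets_events: "noise_sets x \<subseteq> events"
  using indep unfolding indep_sets_def noise_sets_def[symmetric] by auto

lemma noise_sets_Pow: "(\<Union>x\<in>P. noise_sets x) \<subseteq> Pow (space \<Omega>)"
  using noise_sets_events sets.sets_into_space by blast

lemma sets_past: "sets (past P) = sigma_sets (space \<Omega>) (\<Union>x\<in>P. noise_sets x)"
  unfolding past_def by (rule sets_measure_of[OF noise_sets_Pow])

lemma space_past[simp]: "space (past P) = space \<Omega>"
  unfolding past_def by (rule space_measure_of[OF noise_sets_Pow])

lemma past_mono: "P \<subseteq> Q \<Longrightarrow> sets (past P) \<subseteq> sets (past Q)"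
  unfolding sets_past by (intro sigma_sets_mono') auto

lemma past_subalgebra: "subalgebra \<Omega> (past P)"
proof -
  have "sets (past P) \<subseteq> events" unfolding sets_past
    using noise_sets_events by (intro sets.sigma_sets_subset) auto
  then show ?thesis by (simp add: subalgebra_def)
qed

lemma a_past: "Inc s k \<in> P \<Longrightarrow> a s k \<in> measurable (past P) (count_space UNIV)"
proof (rule measurableI)
  fix A :: "nat set" assume P: "Inc s k \<in> P" and "A \<in> sets (count_space UNIV)"
  then have "a s k -` A \<inter> space \<Omega> \<in> noise_sets (Inc s k)" by (auto simp: noise_sets_def)
  with P have "a s k -` A \<inter> space \<Omega> \<in> sets (past P)" unfolding sets_past by blast
  then show "a s k -` A \<inter> space (past P) \<in> sets (past P)" by simp
qed simp

lemma u_past: "Mark s j \<in> P \<Longrightarrow> u s j \<in> borel_measurable (past P)"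
proof (rule measurableI)
  fix A :: "real set" assume P: "Mark s j \<in> P" and "A \<in> sets borel"
  then have "u s j -` A \<inter> space \<Omega> \<in> noise_sets (Mark s j)" by (auto simp: noise_sets_def)
  with P have "u s j -` A \<inter> space \<Omega> \<in> sets (past P)" unfolding sets_past by blast
  then show "u s j -` A \<inter> space (past P) \<in> sets (past P)" by simp
qed simp

lemma z0_past: "Ini \<in> P \<Longrightarrow> z0 \<in> measurable (past P) state_measure"
proof -
  assume P: "Ini \<in> P"
  have I0: "I0 \<subseteq> Pow (space \<Omega>)" using noise_sets_events[of Ini] sets.sets_into_space by (auto simp: noise_sets_def)
  have "sigma_sets (space \<Omega>) I0 \<subseteq> sets (past P)"
    unfolding sets_past by (intro sigma_sets_mono') (use P in \<open>force simp: noise_sets_def\<close>)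
  then show ?thesis using z0_meas I0 by (auto simp: measurable_def)
qed

lemma indep_past:
  assumes "x \<notin> P"
  shows "indep_set (sets (past P)) (sigma_sets (space \<Omega>) (noise_sets x))"
proof -
  have state: "Int_stable (noise_sets x)" for x
  proof (cases x)
    case (Inc s k)
    show ?thesis unfolding Inc noise_sets_def noise.case
      by (auto simp: Int_stable_def) (metis vimage_Int Int_assoc Int_left_commute Int_absorb)
  next
    case (Mark s k)
    show ?thesis unfolding Mark noise_sets_def noise.case Int_stable_def
    proof safe
      fix A B :: "real set" assume "A \<in> sets borel" "B \<in> sets borel"
      then show "\<exists>C. u s k -` A \<inter> space \<Omega> \<inter> (u s k -` B \<inter> space \<Omega>) = u s k -` C \<inter> space \<Omega> \<and> C \<in> sets borel"
        by (intro exI[of _ "A \<inter> B"]) auto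
    qed
  next
    case Ini then show ?thesis using I0_stable by (simp add: noise_sets_def)
  qed
  have "indep_sets noise_sets (\<Union>b\<in>UNIV. (case b of True \<Rightarrow> P | False \<Rightarrow> {x}))"
    using indep unfolding noise_sets_def[symmetric] by (rule indep_sets_mono_index[rotated]) auto
  from indep_sets_collect_sigma[OF this]
  have "indep_sets (\<lambda>b. sigma_sets (space \<Omega>) (\<Union>i\<in>(case b of True \<Rightarrow> P | False \<Rightarrow> {x}). noise_sets i)) UNIV"
    using state assms by (auto simp: disjoint_family_on_def split: bool.splits)
  then show ?thesis unfolding indep_set_def sets_past
    by (rule indep_sets_mono_sets) (auto split: bool.splits)
qed

lemma prob_event: "measure (distr \<Omega> borel (\<lambda>w. real (a s k w))) {x. 1 \<le> x} = event_prob s"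
proof -
  have "measure (distr \<Omega> borel (\<lambda>w. real (a s k w))) {x. 1 \<le> x} = prob {w\<in>space \<Omega>. 1 \<le> a s k w}"
    using measurable_compose[OF a_meas[of s k], of real borel]
    by (subst measure_distr) (auto intro!: arg_cong[of _ _ prob] borel_closed simp: closed_Collect_le)
  also have "\<dots> = measure (distr \<Omega> (count_space UNIV) (a s k)) {j. 1 \<le> j}"
    using a_meas[of s k] by (subst measure_distr) (auto intro!: arg_cong[of _ _ prob])
  also have "\<dots> = 1 - measure (measure_pmf (poisson_pmf (\<rho> s))) {0}"
  proof -
    have "{j::nat. 1 \<le> j} = UNIV - {0}" by auto
    then show ?thesis unfolding a_distr using measure_pmf.prob_compl[of "{0}" "poisson_pmf (\<rho> s)"] by simp
  qed
  also have "\<dots> = event_prob s"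
    using \<rho>_pos[of s] by (simp add: event_prob_def measure_pmf_single)
  finally show ?thesis .
qed

lemma event_prob_bounds: "0 \<le> event_prob s" "event_prob s \<le> 1" "event_prob s \<le> \<rho> s"
  using one_minus_exp_bounds[OF \<rho>_nonneg[of s]] by (auto simp: event_prob_def)

lemma chain_past:
  assumes "Ini \<in> P" "\<And>s l. l < k \<Longrightarrow> Inc s l \<in> P"
    and "\<And>s j. v s j \<in> borel_measurable (past P)"
  shows "(\<lambda>w. chain n c (z0 w) (\<lambda>s l. a s l w) (\<lambda>s j. v s j w) k) \<in> measurable (past P) state_measure"
  using assms by (intro chain_measurable z0_past a_past) auto

text \<open>The past of the \<open>k\<close>-th increment of the stream is all other noise except the later increments of the same
  stream. The state before cell \<open>k\<close> is measurable with respect to it.\<close>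

lemma increments_maximal:
  fixes s :: flow
  assumes iv: "iv \<in> measurable state_measure (borel \<Otimes>\<^sub>M borel)"
  defines "E x K t \<equiv> {w\<in>space \<Omega>. \<exists>k\<le>K. x \<le>
    (\<Sum>l<k. t * len (iv (state l w)) * of_bool (1 \<le> a s l w) - event_prob s * (exp t - 1) * len (iv (state l w)))}"
  shows "E x K t \<in> events" "prob (E x K t) \<le> exp (- x)"
proof -
  define G where "G k = past {y. \<forall>l\<ge>k. y \<noteq> Inc s l}" for k
  define q where "q k w = len (iv (state k w))" for k w
  define f where "f k w y = ennreal (if 1 \<le> y then exp (t * q k w - event_prob s * (exp t - 1) * q k w)
       else exp (- (event_prob s * (exp t - 1) * q k w)))" for k w and y :: real
  have q[measurable]: "q k \<in> borel_measurable (G k)" for k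
  proof -
    have "state k \<in> measurable (G k) state_measure"
      unfolding state_def[abs_def] G_def by (intro chain_past u_past) auto
    from measurable_compose[OF measurable_compose[OF this iv] len_measurable]
    show ?thesis by (simp add: q_def[abs_def])
  qed
  have q01: "0 \<le> q k w" "q k w \<le> 1" for k w by (auto simp: q_def len_nonneg len_le_1)
  have ns: "sigma_sets (space \<Omega>) {(\<lambda>w. real (a s k w)) -` A \<inter> space \<Omega> | A. A \<in> sets borel}
      \<subseteq> sigma_sets (space \<Omega>) (noise_sets (Inc s k))" for k
  proof (intro sigma_sets_mono' subsetI)
    fix B assume "B \<in> {(\<lambda>w. real (a s k w)) -` A \<inter> space \<Omega> | A. A \<in> sets borel}"
    then obtain A where "B = (\<lambda>w. real (a s k w)) -` A \<inter> space \<Omega>" by auto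
    then have "B = a s k -` (real -` A) \<inter> space \<Omega>" by auto
    then show "B \<in> noise_sets (Inc s k)" unfolding noise_sets_def by (auto intro!: exI[of _ "real -` A"])
  qed
  have am: "(\<lambda>w. real (a s k w)) \<in> borel_measurable (G (Suc k))" for k
    unfolding G_def by (rule measurable_compose[OF a_past]) auto
  have am': "(\<lambda>w. real (a s k w)) \<in> borel_measurable \<Omega>" for k
    by (rule measurable_compose[OF a_meas]) simp
  note V = predictable_product_maximal[where G=G and X="\<lambda>k w. real (a s k w)" and f=f and K=K and C="exp x"]
  have 1: "subalgebra \<Omega> (G k)" for k by (simp add: G_def past_subalgebra)
  have 2: "sets (G k) \<subseteq> sets (G (Suc k))" for k unfolding G_def by (rule past_mono, clarsimp) (metis Suc_leD)
  have 3: "indep_set (sets (G k)) (sigma_sets (space \<Omega>) {(\<lambda>w. real (a s k w)) -` A \<inter> space \<Omega> | A. A \<in> sets borel})" for k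
  proof -
    have "indep_set (sets (G k)) (sigma_sets (space \<Omega>) (noise_sets (Inc s k)))"
      unfolding G_def by (rule indep_past) auto
    then show ?thesis unfolding indep_set_def by (rule indep_sets_mono_sets) (use ns in \<open>auto split: bool.splits\<close>)
  qed
  have 4: "(\<lambda>(w, y). f k w y) \<in> borel_measurable (G k \<Otimes>\<^sub>M borel)" for k
    unfolding f_def by measurable
  have 5: "(\<integral>\<^sup>+y. f k w y \<partial>distr \<Omega> borel (\<lambda>w. real (a s k w))) \<le> 1" for k w
  proof -
    have "prob_space (distr \<Omega> borel (\<lambda>w. real (a s k w)))" by (rule prob_space_distr[OF am'])
    then show ?thesis unfolding f_def
      by (subst nn_integral_two_values)
        (auto simp: prob_event intro!: thinned_mgf_le event_prob_bounds q01)
  qed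
  have *: "(\<Prod>j<k. f j w (real (a s j w))) = ennreal (exp (\<Sum>l<k. t * q l w * of_bool (1 \<le> a s l w) - event_prob s * (exp t - 1) * q l w))" for k w
    by (simp add: exp_sum f_def prod_ennreal del: of_bool_eq_1_iff) (auto intro!: arg_cong[of _ _ ennreal] prod.cong)
  have E: "E x K t = {w\<in>space \<Omega>. \<exists>k\<le>K. ennreal (exp x) \<le> (\<Prod>j<k. f j w (real (a s j w)))}"
    unfolding E_def * by (simp add: q_def)
  show "E x K t \<in> events" unfolding E by (rule V(1)[OF 1 2 am 3 4 5]) simp
  have "prob (E x K t) \<le> 1 / exp x" unfolding E by (rule V(2)[OF 1 2 am 3 4 5]) simp
  then show "prob (E x K t) \<le> exp (- x)" by (simp add: exp_minus field_simps)
qed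

lemma events_before_Suc: "events_before s (Suc k) w = events_before s k w + a s k w" by (simp add: events_before_def)

lemma events_before_mono: "k \<le> k' \<Longrightarrow> events_before s k w \<le> events_before s k' w"
  unfolding events_before_def by (intro sum_mono2) auto

lemma ring_index_unique:
  assumes "1 \<le> a s k w" "events_before s k w \<le> j" "j < events_before s k w + a s k w" "events_before s k' w = j" "1 \<le> a s k' w"
  shows "k' = k"
proof (rule ccontr)
  assume "k' \<noteq> k"
  then consider "Suc k \<le> k'" | "Suc k' \<le> k" by linarith
  then show False
  proof cases
    case 1 then show False using events_before_mono[OF 1, of s w] assms by (simp add: events_before_Suc)
  next
    case 2 then show False using events_before_mono[OF 2, of s w] assms by (simp add: events_before_Suc)
  qed
qed

text \<open>In the order of the marks the cell to which the \<open>j\<close>-th mark belongs is random but known, since all increments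
  belong to the past. The state in that cell is made measurable with respect to the earlier
  marks by replacing all later ones by zero in the recursion, which does not change it.\<close>

lemma marks_maximal:
  fixes s :: flow
  assumes iv: "iv \<in> measurable state_measure (borel \<Otimes>\<^sub>M borel)"
  defines "E x K J t \<equiv> {w\<in>space \<Omega>. \<exists>k\<le>K. events_before s k w \<le> J \<and> x \<le>
    (\<Sum>l<k. of_bool (1 \<le> a s l w) *
      (t * of_bool (hit (iv (state l w)) (u s (events_before s l w) w)) - (exp t - 1) * len (iv (state l w))))}"
  shows "\<exists>E'\<in>events. E x K J t \<subseteq> E' \<and> prob E' \<le> exp (- x)"
proof -
  define G where "G j = past {y. \<forall>l\<ge>j. y \<noteq> Mark s l}" for j
  \<comment> \<open>The marks with those from the \<open>j\<close>-th on replaced by zero.\<close>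
  define v where "v j s' i w = (if s' = s \<and> j \<le> i then 0 else u s' i w)" for j s' i w
  define ch where "ch j k w = chain n c (z0 w) (\<lambda>s l. a s l w) (\<lambda>s i. v j s i w) k" for j k w
  define p where "p j k w = iv (ch j k w)" for j k w
  define g where "g j k w y = (if hit (p j k w) y then exp (t - (exp t - 1) * len (p j k w))
       else exp (- ((exp t - 1) * len (p j k w))))" for j k w and y :: real
  \<comment> \<open>At most one cell contains the \<open>j\<close>-th event, so at most one factor differs from one.\<close>
  define f where "f j w y = (\<Prod>k<K. if 1 \<le> a s k w \<and> events_before s k w = j then ennreal (g j k w y) else 1)" for j w y
  have am[measurable]: "a s' k \<in> measurable (G j) (count_space UNIV)" for s' k j
    unfolding G_def by (rule a_past) auto
  have numm[measurable]: "events_before s k \<in> measurable (G j) (count_space UNIV)" for k j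
    unfolding events_before_def by measurable
  have p[measurable]: "p j k \<in> measurable (G j) (borel \<Otimes>\<^sub>M borel)" for j k
  proof -
    have "v j s' i \<in> borel_measurable (G j)" for s' i
    proof (cases "s' = s \<and> j \<le> i")
      case True then have "v j s' i = (\<lambda>_. 0)" by (auto simp: v_def)
      then show ?thesis by simp
    next
      case False then have "v j s' i = u s' i" by (auto simp: v_def)
      then show ?thesis unfolding G_def using False by (auto intro!: u_past)
    qed
    then have "ch j k \<in> measurable (G j) state_measure"
      unfolding ch_def[abs_def] G_def by (intro chain_past) (auto simp: G_def)
    from measurable_compose[OF this iv]
    show ?thesis by (simp add: p_def[abs_def])
  qed
  have um: "u s j \<in> borel_measurable (G (Suc j))" for j unfolding G_def by (rule u_past) auto
  note V = predictable_product_maximal[where G=G and X="u s" and f=f and K=J and C="exp x"]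
  have 1: "subalgebra \<Omega> (G k)" for k by (simp add: G_def past_subalgebra)
  have 2: "sets (G k) \<subseteq> sets (G (Suc k))" for k unfolding G_def by (rule past_mono, clarsimp) (metis Suc_leD)
  have 3: "indep_set (sets (G k)) (sigma_sets (space \<Omega>) {u s k -` A \<inter> space \<Omega> | A. A \<in> sets borel})" for k
    using indep_past[of "Mark s k" "{y. \<forall>l\<ge>k. y \<noteq> Mark s l}"] by (simp add: G_def noise_sets_def)
  have 4: "(\<lambda>(w, y). f j w y) \<in> borel_measurable (G j \<Otimes>\<^sub>M borel)" for j
  proof -
    have [measurable]: "(\<lambda>w. p j k (fst w)) \<in> measurable (G j \<Otimes>\<^sub>M borel) (borel \<Otimes>\<^sub>M borel)" for k
      by (rule measurable_compose[OF measurable_fst p])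
    have "(\<lambda>w. f j (fst w) (snd w)) \<in> borel_measurable (G j \<Otimes>\<^sub>M borel)"
      unfolding f_def g_def by measurable
    then show ?thesis by (simp add: case_prod_beta')
  qed
  have g_le: "(\<integral>\<^sup>+y. ennreal (g j k w y) \<partial>distr \<Omega> borel (u s j)) \<le> 1" for j k w
  proof -
    have P: "prob_space (distr \<Omega> borel (u s j))" by (rule prob_space_distr[OF u_meas])
    have "hit (p j k w) \<in> measurable borel (count_space UNIV)"
      unfolding hit_def by measurable
    moreover have "measure (distr \<Omega> borel (u s j)) {y. hit (p j k w) y} = len (p j k w)"
      unfolding u_distr by (rule prob_uniform_interval)
    ultimately show ?thesis unfolding g_def
      using thinned_mgf_le[of "len (p j k w)" 1 t] len_nonneg[of "p j k w"] len_le_1[of "p j k w"]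
      by (subst nn_integral_two_values[OF P]) (auto simp: algebra_simps)
  qed
  have 5: "(\<integral>\<^sup>+y. f j w y \<partial>distr \<Omega> borel (u s j)) \<le> 1" for j w
  proof (cases "\<exists>k<K. 1 \<le> a s k w \<and> events_before s k w = j")
    case True
    then obtain k where k: "k < K" "1 \<le> a s k w" "events_before s k w = j" by auto
    have "1 \<le> a s k' w \<and> events_before s k' w = j \<longleftrightarrow> k' = k" for k'
      using ring_index_unique[of s k w j k'] k by fastforce
    then have "f j w y = (\<Prod>k'<K. if k' = k then ennreal (g j k' w y) else 1)" for y
      unfolding f_def by (simp only:)
    then have "f j w y = ennreal (g j k w y)" for y using k by (simp add: prod.delta)
    then show ?thesis using g_le by simp
  next
    case False
    then have "f j w y = 1" for y unfolding f_def by (intro prod.neutral) auto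
    then show ?thesis
      using prob_space.emeasure_space_1[OF prob_space_distr[OF u_meas[of s j]]] by simp
  qed
  have ch: "ch (events_before s k w) k w = state k w" for k w
    unfolding ch_def state_def
  proof (rule chain_cong)
    fix s' l assume l: "l < k" "1 \<le> a s' l w"
    show "v (events_before s k w) s' (\<Sum>m<l. a s' m w) w = u s' (\<Sum>m<l. a s' m w) w"
    proof (cases "s' = s")
      case True
      have "events_before s (Suc l) w \<le> events_before s k w" using l by (intro events_before_mono) auto
      then have "(\<Sum>m<l. a s m w) < events_before s k w" using l True by (simp add: events_before_Suc) (simp add: events_before_def)
      then show ?thesis using True by (simp add: v_def)
    qed (simp add: v_def)
  qed
  define r where "r l w = of_bool (1 \<le> a s l w) *
      (t * of_bool (hit (iv (state l w)) (u s (events_before s l w) w)) - (exp t - 1) * len (iv (state l w)))" for l w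
  have *: "(\<Prod>j<events_before s k w. f j w (u s j w)) = ennreal (exp (\<Sum>l<k. r l w))" if "k \<le> K" for k w
    using that
  proof (induction k)
    case 0 then show ?case by (simp add: events_before_def)
  next
    case (Suc k)
    show ?case
    proof (cases "1 \<le> a s k w")
      case False
      then have "a s k w = 0" "r k w = 0" by (auto simp: r_def)
      then show ?thesis using Suc by (simp add: events_before_Suc)
    next
      case True
      let ?N = "events_before s k w"
      have f1: "f j w y = 1" if "?N < j" "j < ?N + a s k w" for j y
      proof -
        have "\<not> (1 \<le> a s k' w \<and> events_before s k' w = j)" for k'
          using ring_index_unique[of s k w j k', OF True] that by fastforce
        then show ?thesis unfolding f_def by (intro prod.neutral) auto
      qed
      have fN: "f ?N w y = ennreal (g ?N k w y)" for y
      proof -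
        have "1 \<le> a s k' w \<and> events_before s k' w = ?N \<longleftrightarrow> k' = k" for k'
          using ring_index_unique[of s k w ?N k'] True by fastforce
        then have "f ?N w y = (\<Prod>k'<K. if k' = k then ennreal (g ?N k' w y) else 1)"
          unfolding f_def by (simp only:)
        then show ?thesis using Suc.prems by (simp add: prod.delta)
      qed
      have "(\<Prod>j<events_before s (Suc k) w. f j w (u s j w)) =
         (\<Prod>j<?N. f j w (u s j w)) * (\<Prod>j\<in>{?N..<?N + a s k w}. f j w (u s j w))"
        unfolding events_before_Suc by (subst prod.union_disjoint[symmetric]) (auto intro!: prod.cong)
      also have "(\<Prod>j\<in>{?N..<?N + a s k w}. f j w (u s j w)) = f ?N w (u s ?N w) * (\<Prod>j\<in>{Suc ?N..<?N + a s k w}. f j w (u s j w))"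
        by (rule prod.atLeast_Suc_lessThan) (use True in auto)
      also have "(\<Prod>j\<in>{Suc ?N..<?N + a s k w}. f j w (u s j w)) = 1"
        by (rule prod.neutral) (use f1 in auto)
      also have "f ?N w (u s ?N w) = ennreal (exp (r k w))"
        unfolding fN g_def r_def p_def ch using True by auto
      finally show ?thesis using Suc by (simp add: exp_add ennreal_mult)
    qed
  qed
  let ?E' = "{w\<in>space \<Omega>. \<exists>k\<le>J. ennreal (exp x) \<le> (\<Prod>j<k. f j w (u s j w))}"
  have E: "E x K J t \<subseteq> ?E'"
  proof
    fix w assume "w \<in> E x K J t"
    then obtain k where k: "w \<in> space \<Omega>" "k \<le> K" "events_before s k w \<le> J" "x \<le> (\<Sum>l<k. r l w)"
      unfolding E_def r_def by auto
    then have "ennreal (exp x) \<le> (\<Prod>j<events_before s k w. f j w (u s j w))"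
      unfolding *[OF k(2)] by (simp add: ennreal_leI)
    with k show "w \<in> ?E'" by blast
  qed
  have "?E' \<in> events" by (rule V(1)[OF 1 2 um 3 4 5]) simp
  moreover have "prob ?E' \<le> 1 / exp x" by (rule V(2)[OF 1 2 um 3 4 5]) simp
  moreover from this have "prob ?E' \<le> exp (- x)" by (simp add: exp_minus inverse_eq_divide)
  ultimately show ?thesis using E by blast
qed

end

context grid_noise begin

definition hit_count :: "flow \<Rightarrow> ((nat \<Rightarrow> real) \<times> nat \<Rightarrow> real \<times> real) \<Rightarrow> nat \<Rightarrow> 'w \<Rightarrow> real" where
  "hit_count s iv k w = (\<Sum>l<k. of_bool (1 \<le> a s l w \<and> hit (iv (state l w)) (u s (events_before s l w) w)))"

definition hit_mass :: "((nat \<Rightarrow> real) \<times> nat \<Rightarrow> real \<times> real) \<Rightarrow> nat \<Rightarrow> 'w \<Rightarrow> real" where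
  "hit_mass iv k w = (\<Sum>l<k. len (iv (state l w)))"

definition uncrowded :: "nat \<Rightarrow> 'w \<Rightarrow> bool" where
  "uncrowded K w \<longleftrightarrow> (\<forall>l<K. a Arrival l w + a Service l w + a Message l w \<le> 1)"

text \<open>Adding the two exponential bounds compares the number of hits with the sum of the interval lengths. The
  exponent \<open>exp t - 1\<close> of the increments is the compensator of the marks with exponent \<open>t\<close>, so the
  random number of events cancels.\<close>

lemma counts_concentrate:
  assumes iv: "iv \<in> measurable state_measure (borel \<Otimes>\<^sub>M borel)"
  shows "\<exists>E\<in>events. prob E \<le> 2 * exp (- x) \<and>
    (\<forall>w\<in>space \<Omega> - E. uncrowded K w \<longrightarrow>
      (\<forall>k\<le>K. t * hit_count s iv k w \<le> (exp (exp t - 1) - 1) * event_prob s * hit_mass iv k w + 2 * x))"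
proof -
  define r1 where "r1 l w = (exp t - 1) * len (iv (state l w)) * of_bool (1 \<le> a s l w)
       - event_prob s * (exp (exp t - 1) - 1) * len (iv (state l w))" for l w
  define r2 where "r2 l w = of_bool (1 \<le> a s l w) *
      (t * of_bool (hit (iv (state l w)) (u s (events_before s l w) w)) - (exp t - 1) * len (iv (state l w)))" for l w
  define E1 where "E1 = {w\<in>space \<Omega>. \<exists>k\<le>K. x \<le> (\<Sum>l<k. r1 l w)}"
  obtain E2 where E2: "E2 \<in> events" "prob E2 \<le> exp (- x)"
    "{w\<in>space \<Omega>. \<exists>k\<le>K. events_before s k w \<le> K \<and> x \<le> (\<Sum>l<k. r2 l w)} \<subseteq> E2"
    unfolding r2_def using marks_maximal[OF iv, of K s K x t] by blast
  have E1: "E1 \<in> events" "prob E1 \<le> exp (- x)"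
    unfolding E1_def r1_def
    by (rule increments_maximal[OF iv, where x=x and K=K and t="exp t - 1" and s=s])+
  have P: "prob (E1 \<union> E2) \<le> 2 * exp (- x)"
    using measure_Un_le[OF E1(1) E2(1)] E1(2) E2(2) by simp
  have main: "t * hit_count s iv k w \<le> (exp (exp t - 1) - 1) * event_prob s * hit_mass iv k w + 2 * x"
    if w: "w \<in> space \<Omega>" "w \<notin> E1" "w \<notin> E2" "uncrowded K w" "k \<le> K" for w k
  proof -
    have "events_before s k w \<le> (\<Sum>l<k. 1)" unfolding events_before_def
    proof (rule sum_mono)
      fix l assume "l \<in> {..<k}"
      then have "a Arrival l w + a Service l w + a Message l w \<le> 1"
        using w(4,5) by (auto simp: uncrowded_def)
      then show "a s l w \<le> 1" by (cases s) auto
    qed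
    then have "events_before s k w \<le> K" using w(5) by simp
    then have "\<not> x \<le> (\<Sum>l<k. r2 l w)" using E2(3) w(1,3,5) by blast
    moreover have "\<not> x \<le> (\<Sum>l<k. r1 l w)" using w(1,2,5) unfolding E1_def by blast
    ultimately have "(\<Sum>l<k. r2 l w) + (\<Sum>l<k. r1 l w) \<le> 2 * x" by simp
    moreover have "r2 l w + r1 l w = t * of_bool (1 \<le> a s l w \<and> hit (iv (state l w)) (u s (events_before s l w) w))
         - (exp (exp t - 1) - 1) * event_prob s * len (iv (state l w))" for l
      unfolding r1_def r2_def by (cases "1 \<le> a s l w") (simp_all add: algebra_simps)
    then have "(\<Sum>l<k. r2 l w) + (\<Sum>l<k. r1 l w) = t * hit_count s iv k w - (exp (exp t - 1) - 1) * event_prob s * hit_mass iv k w"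
      unfolding sum.distrib[symmetric] hit_count_def hit_mass_def by (simp only: sum_subtractf sum_distrib_left)
    ultimately show ?thesis by simp
  qed
  show ?thesis
    using P E1(1) E2(1) main by (intro bexI[of _ "E1 \<union> E2"] conjI ballI impI allI) auto
qed

lemma prob_a: "prob {w\<in>space \<Omega>. a s l w \<in> A} = measure (measure_pmf (poisson_pmf (\<rho> s))) A"
proof -
  have "measure (distr \<Omega> (count_space UNIV) (a s l)) A = prob (a s l -` A \<inter> space \<Omega>)"
    using a_meas[of s l] by (intro measure_distr) auto
  then show ?thesis unfolding a_distr by (simp add: vimage_def Int_def conj_commute)
qed

lemma prob_a_ge1: "prob {w\<in>space \<Omega>. 1 \<le> a s l w} \<le> \<rho> s"
proof -
  have "prob {w\<in>space \<Omega>. 1 \<le> a s l w} = measure (measure_pmf (poisson_pmf (\<rho> s))) (UNIV - {0})"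
    by (subst prob_a[of s l, symmetric]) (auto intro!: arg_cong[of _ _ prob])
  also have "\<dots> = event_prob s"
    using measure_pmf.prob_compl[of "{0}" "poisson_pmf (\<rho> s)"] \<rho>_pos[of s]
    by (simp add: measure_pmf_single event_prob_def)
  finally show ?thesis using event_prob_bounds by simp
qed

lemma prob_a_ge2: "prob {w\<in>space \<Omega>. 2 \<le> a s l w} \<le> (\<rho> s)\<^sup>2"
proof -
  let ?p = "measure_pmf (poisson_pmf (\<rho> s))"
  have "prob {w\<in>space \<Omega>. 2 \<le> a s l w} = measure ?p (UNIV - {0, 1})"
    by (subst prob_a[of s l, symmetric]) (auto intro!: arg_cong[of _ _ prob])
  also have "\<dots> = 1 - measure ?p {0, 1}"
    using measure_pmf.prob_compl[of "{0, 1}" "poisson_pmf (\<rho> s)"] by simp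
  also have "measure ?p {0, 1} = exp (- \<rho> s) + \<rho> s * exp (- \<rho> s)"
    using \<rho>_pos[of s] by (subst measure_measure_pmf_finite) auto
  also have "1 - (exp (- \<rho> s) + \<rho> s * exp (- \<rho> s)) \<le> (\<rho> s)\<^sup>2"
  proof -
    have "(1 - \<rho> s) * (1 + \<rho> s) \<le> exp (- \<rho> s) * (1 + \<rho> s)"
      using exp_ge_add_one_self[of "- \<rho> s"] \<rho>_pos[of s] by (intro mult_right_mono) auto
    then show ?thesis by (simp add: algebra_simps power2_eq_square)
  qed
  finally show ?thesis .
qed

lemma prob_a_both:
  assumes "s \<noteq> s'"
  shows "prob {w\<in>space \<Omega>. 1 \<le> a s l w \<and> 1 \<le> a s' l w} \<le> \<rho> s * \<rho> s'"
proof -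
  let ?A = "\<lambda>s. {w\<in>space \<Omega>. 1 \<le> a s l w}"
  have in_ns: "?A s \<in> noise_sets (Inc s l)" for s
    unfolding noise_sets_def by (auto intro!: exI[of _ "{1..}"])
  define A where "A x = (if x = Inc s l then ?A s else ?A s')" for x
  have "prob (\<Inter>x\<in>{Inc s l, Inc s' l}. A x) = (\<Prod>x\<in>{Inc s l, Inc s' l}. prob (A x))"
    using in_ns assms by (intro indep_setsD[OF indep[folded noise_sets_def]]) (auto simp: A_def)
  then have "prob (?A s \<inter> ?A s') = prob (?A s) * prob (?A s')"
    using assms by (simp add: A_def Int_commute)
  also have "\<dots> \<le> \<rho> s * \<rho> s'"
    by (intro mult_mono prob_a_ge1 \<rho>_nonneg) auto
  also have "?A s \<inter> ?A s' = {w\<in>space \<Omega>. 1 \<le> a s l w \<and> 1 \<le> a s' l w}" by auto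
  finally show ?thesis .
qed

lemma crowding_unlikely:
  "\<exists>E\<in>events. prob E \<le> real K * (\<rho> Arrival + \<rho> Service + \<rho> Message)\<^sup>2 \<and>
    (\<forall>w\<in>space \<Omega> - E. uncrowded K w)"
proof -
  have am[measurable]: "a s l \<in> measurable \<Omega> (count_space UNIV)" for s l by (rule a_meas)
  let ?D = "\<lambda>s l. {w\<in>space \<Omega>. 2 \<le> a s l w}"
  let ?B = "\<lambda>s s' l. {w\<in>space \<Omega>. 1 \<le> a s l w \<and> 1 \<le> a s' l w}"
  define C where "C l = ((?D Arrival l \<union> ?D Service l) \<union> (?D Message l \<union> ?B Arrival Service l))
     \<union> (?B Arrival Message l \<union> ?B Service Message l)" for l
  have D[measurable]: "?D s l \<in> events" and B[measurable]: "?B s s' l \<in> events" for s s' l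
    by measurable
  have Cm: "C l \<in> events" for l unfolding C_def using D B by blast
  let ?r = "(\<rho> Arrival + \<rho> Service + \<rho> Message)\<^sup>2"
  have C: "prob (C l) \<le> ?r" for l
  proof -
    have "prob (C l) \<le> ((prob (?D Arrival l) + prob (?D Service l)) + (prob (?D Message l) + prob (?B Arrival Service l)))
       + (prob (?B Arrival Message l) + prob (?B Service Message l))"
      unfolding C_def
      by (intro order.trans[OF measure_Un_le] add_mono sets.Un D B) auto
    also have "\<dots> \<le> (((\<rho> Arrival)\<^sup>2 + (\<rho> Service)\<^sup>2) + ((\<rho> Message)\<^sup>2 + \<rho> Arrival * \<rho> Service))
       + (\<rho> Arrival * \<rho> Message + \<rho> Service * \<rho> Message)"
      by (intro add_mono prob_a_ge2 prob_a_both) auto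
    also have "\<dots> \<le> ?r"
      using mult_nonneg_nonneg[OF \<rho>_nonneg[of Arrival] \<rho>_nonneg[of Service]]
        mult_nonneg_nonneg[OF \<rho>_nonneg[of Arrival] \<rho>_nonneg[of Message]]
        mult_nonneg_nonneg[OF \<rho>_nonneg[of Service] \<rho>_nonneg[of Message]]
      by (simp add: power2_eq_square algebra_simps)
    finally show ?thesis .
  qed
  have "prob (\<Union>l\<in>{..<K}. C l) \<le> (\<Sum>l\<in>{..<K}. prob (C l))"
    by (rule finite_measure_subadditive_finite) (use Cm in auto)
  also have "\<dots> \<le> (\<Sum>l\<in>{..<K}. ?r)" by (intro sum_mono C)
  finally have P: "prob (\<Union>l\<in>{..<K}. C l) \<le> real K * ?r" by simp
  moreover have "uncrowded K w" if "w \<in> space \<Omega> - (\<Union>l\<in>{..<K}. C l)" for w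
    unfolding uncrowded_def
  proof (intro allI impI)
    fix l assume "l < K"
    then have "w \<notin> C l" "w \<in> space \<Omega>" using that by auto
    then show "a Arrival l w + a Service l w + a Message l w \<le> 1"
      unfolding C_def by (simp add: not_le) linarith
  qed
  ultimately show ?thesis using Cm by (intro bexI[of _ "\<Union>l\<in>{..<K}. C l"]) auto
qed

end

section \<open>From sample paths to the grid recursion\<close>

text \<open>The invariant of the recursion. That queue fractions are multiples of \<open>1 / n\<close> is what preserves their
  monotonicity: a strict inequality between them leaves room for a jump of size \<open>1 / n\<close>.\<close>

definition valid :: "nat \<Rightarrow> nat \<Rightarrow> (nat \<Rightarrow> real) \<times> nat \<Rightarrow> bool" where
  "valid n c z \<longleftrightarrow> fst z 0 = 1 \<and> (\<forall>i. fst z (Suc i) \<le> fst z i) \<and> (\<forall>i. 0 \<le> fst z i) \<and>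
     (\<forall>i. real n * fst z i \<in> \<int>) \<and> snd z \<le> c \<and> real (snd z) \<le> real n * (1 - fst z 1)"

lemma Ints_less_imp_add1_le: "x + 1 \<le> y" if "x \<in> \<int>" "y \<in> \<int>" "x < (y::real)"
proof -
  from that(1) obtain i where "x = of_int i" by (elim Ints_cases)
  moreover from that(2) obtain j where "y = of_int j" by (elim Ints_cases)
  ultimately show ?thesis using that by simp
qed

lemma valid_le_1: "valid n c z \<Longrightarrow> fst z i \<le> 1"
  by (induction i) (auto simp: valid_def intro: order_trans)

lemma grid_gap:
  assumes "valid n c z" "0 < n" "fst z i < fst z j"
  shows "fst z i + 1 / real n \<le> fst z j"
proof -
  have "real n * fst z i + 1 \<le> real n * fst z j"
    using assms by (intro Ints_less_imp_add1_le) (auto simp: valid_def)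
  then show ?thesis using assms(2) by (simp add: field_simps)
qed

lemma valid_step:
  assumes v: "valid n c z" and n: "0 < n"
    and e: "\<And>s s'. e s \<Longrightarrow> e s' \<Longrightarrow> s = s'"
  shows "valid n c (step n c e u z)"
proof -
  obtain S M where z: "z = (S, M)" by (cases z)
  have S0: "S 0 = 1" and mono: "\<And>i. S (Suc i) \<le> S i" and nn: "\<And>i. 0 \<le> S i" and int: "\<And>i. real n * S i \<in> \<int>"
    and Mc: "M \<le> c" and Mn: "real M \<le> real n * (1 - S 1)"
    using v by (auto simp: valid_def z)
  have gap: "S i + 1 / real n \<le> S j" if "S i < S j" for i j
    using grid_gap[OF v n, of i j] that by (simp add: z)
  have int': "real n * (S i + 1 / real n) \<in> \<int>" "real n * (S i - 1 / real n) \<in> \<int>" for i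
    using int[of i] n by (auto simp: algebra_simps)
  consider (none) "\<And>s. \<not> e s" | (A) "e Arrival" "\<not> e Service" "\<not> e Message"
    | (B) "\<not> e Arrival" "e Service" "\<not> e Message" | (C) "\<not> e Arrival" "\<not> e Service" "e Message"
    using e flow.exhaust flow.distinct by metis
  then show ?thesis
  proof cases
    case none
    then have "step n c e u z = z" by (auto simp: step_def intro!: prod_eqI)
    then show ?thesis using v by simp
  next
    case A
    define h where "h i = hit (arr_iv i z) (u Arrival)" for i
    define S' where "S' i = S i + of_bool (h i) / real n" for i
    have st: "step n c e u z = (S', M - of_bool (1 \<le> M))"
      using A by (auto simp: step_def S'_def h_def z intro!: ext)
    have h0: "\<not> h 0" by (simp add: h_def arr_iv_def hit_def)
    have hS: "S (Suc i) + 1 / real n \<le> S i" if "h (Suc i)" for i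
    proof (cases "i = 0")
      case True
      show ?thesis
      proof (cases "M = 0")
        case True
        then have "S 1 < S 0" using that \<open>i = 0\<close> S0 by (simp add: h_def arr_iv_def hit_def z)
        from gap[OF this] show ?thesis using \<open>i = 0\<close> by simp
      next
        case False
        then have "1 \<le> real n * (1 - S 1)" using Mn by simp
        then show ?thesis using \<open>i = 0\<close> n S0 by (simp add: field_simps)
      qed
    next
      case False
      then have "S (Suc i) < S i" using that by (auto simp: h_def arr_iv_def hit_def z split: if_splits)
      from gap[OF this] show ?thesis .
    qed
    have "S' (Suc i) \<le> S' i" for i
    proof -
      have "S i \<le> S' i" by (simp add: S'_def)
      moreover have "S' (Suc i) \<le> S i" using hS[of i] mono[of i] by (auto simp: S'_def)
      ultimately show ?thesis by simp
    qed
    moreover have "S' 0 = 1" using h0 S0 by (simp add: S'_def)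
    moreover have "0 \<le> S' i" for i using nn[of i] by (simp add: S'_def)
    moreover have "real n * S' i \<in> \<int>" for i using int int' by (simp add: S'_def)
    moreover have "real (M - of_bool (1 \<le> M)) \<le> real n * (1 - S' 1)"
    proof (cases "1 \<le> M")
      case True
      then show ?thesis using Mn n by (auto simp: S'_def of_nat_diff algebra_simps)
    next
      case False
      from False have "S' 1 \<le> 1" using \<open>S' (Suc 0) \<le> S' 0\<close> \<open>S' 0 = 1\<close> by simp
      moreover have "M = 0" using False by simp
      ultimately show ?thesis by (simp add: zero_le_mult_iff)
    qed
    ultimately show ?thesis using Mc unfolding st valid_def by auto
  next
    case B
    define h where "h i = hit (srv_iv i z) (u Service)" for i
    define S' where "S' i = S i - of_bool (h i) / real n" for i
    have st: "step n c e u z = (S', M)"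
      using B by (auto simp: step_def S'_def h_def z intro!: ext)
    have h0: "\<not> h 0" by (simp add: h_def srv_iv_def hit_def)
    have hS: "S (Suc i) + 1 / real n \<le> S i" if "h i" for i
    proof -
      have "S (Suc i) < S i" using that by (auto simp: h_def srv_iv_def hit_def z split: if_splits)
      from gap[OF this] show ?thesis .
    qed
    have le: "S' i \<le> S i" for i by (simp add: S'_def)
    have ge: "S (Suc i) \<le> S' i" for i using hS[of i] mono[of i] by (auto simp: S'_def)
    have "S' (Suc i) \<le> S' i" for i using le[of "Suc i"] ge[of i] by simp
    moreover have "S' 0 = 1" using h0 S0 by (simp add: S'_def)
    moreover have "0 \<le> S' i" for i using nn[of "Suc i"] ge[of i] by simp
    moreover have "real n * S' i \<in> \<int>" for i using int int' by (simp add: S'_def)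
    moreover have "real M \<le> real n * (1 - S' 1)"
      using Mn le[of 1] n by (meson diff_left_mono mult_left_mono of_nat_0_le_iff order_trans)
    ultimately show ?thesis using Mc unfolding st valid_def by auto
  next
    case C
    define h where "h = hit (msg_iv n c z) (u Message)"
    have st: "step n c e u z = (S, M + of_bool h)"
      using C by (auto simp: step_def h_def z intro!: ext)
    have "M + 1 \<le> c \<and> real M + 1 \<le> real n * (1 - S 1)" if h
    proof -
      have *: "M < c" "0 < 1 - S 1 - real M / real n"
        using that by (auto simp: h_def msg_iv_def hit_def z split: if_splits)
      then have "real M < real n * (1 - S 1)" using n by (simp add: field_simps)
      moreover have "real n * (1 - S 1) \<in> \<int>" using int[of 1] by (simp add: algebra_simps)
      ultimately show ?thesis using Ints_less_imp_add1_le[of "real M"] * by auto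
    qed
    then show ?thesis using v unfolding st by (cases h) (auto simp: valid_def z add.commute)
  qed
qed

lemma event_time_in_cell:
  fixes N :: "real \<Rightarrow> nat"
  assumes mono: "mono_on {0..} N" and rc: "continuous (at_right a) N"
    and a: "0 \<le> a" "a \<le> b" and j: "N a < j" "j \<le> N b"
  shows "a < event_time N j" "event_time N j \<le> b"
    and "0 \<le> t \<Longrightarrow> t < event_time N j \<Longrightarrow> N t < j"
proof -
  let ?X = "{t. 0 \<le> t \<and> j \<le> N t}"
  have bX: "b \<in> ?X" using a j by auto
  have bdd: "bdd_below ?X" by (rule bdd_belowI[of _ 0]) auto
  show "event_time N j \<le> b" unfolding event_time_def by (rule cInf_lower[OF bX bdd])
  show "N t < j" if "0 \<le> t" "t < event_time N j"
    using that cInf_lower[OF _ bdd, of t] unfolding event_time_def by (force simp: not_le[symmetric])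
  have "(N \<longlongrightarrow> N a) (at_right a)" using rc by (simp add: continuous_within)
  then have "eventually (\<lambda>t. N t = N a) (at_right a)"
    by (simp add: tendsto_discrete)
  then obtain d where d: "a < d" "\<And>t. a < t \<Longrightarrow> t < d \<Longrightarrow> N t = N a"
    unfolding eventually_at_right_field by blast
  have "d \<le> t" if "t \<in> ?X" for t
  proof (rule ccontr)
    assume "\<not> d \<le> t"
    have "N t \<le> N a"
    proof (cases "t \<le> a")
      case True
      then show ?thesis using mono_onD[OF mono, of t a] that a by auto
    next
      case False then show ?thesis using d \<open>\<not> d \<le> t\<close> by simp
    qed
    then show False using that j by simp
  qed
  then have "d \<le> event_time N j" unfolding event_time_def using bX by (intro cInf_greatest) auto
  then show "a < event_time N j" using d by simp
qed

lemma left_lim_const: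
  assumes "a < \<tau>" "\<And>t. a \<le> t \<Longrightarrow> t < \<tau> \<Longrightarrow> f t = y"
  shows "left_lim f \<tau> = y"
  unfolding left_lim_def
proof (rule tendsto_Lim)
  have "eventually (\<lambda>t. t \<in> {a<..<\<tau>}) (at_left \<tau>)"
    using assms(1) by (rule eventually_at_left_real)
  then have "eventually (\<lambda>t. f t = y) (at_left \<tau>)"
    by eventually_elim (use assms(2) in auto)
  then show "(f \<longlongrightarrow> y) (at_left \<tau>)" by (rule tendsto_eventually)
qed simp

text \<open>The scaled Poisson paths \<open>N\<close> and the evolution equations for a single outcome, on an initial part of
  the grid in which each cell holds at most one event.\<close>

locale sample_path =
  fixes n c :: nat and N :: "flow \<Rightarrow> real \<Rightarrow> nat" and mark :: "flow \<Rightarrow> nat \<Rightarrow> real"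
    and S :: "real \<Rightarrow> nat \<Rightarrow> real" and M :: "real \<Rightarrow> nat" and S0 :: "nat \<Rightarrow> real" and M0 :: nat
    and d :: real and K :: nat
  assumes n: "0 < n" and d: "0 < d"
    and N_mono: "\<And>s. mono_on {0..} (N s)" and N_0: "\<And>s. N s 0 = 0"
    and N_rc: "\<And>s t. 0 \<le> t \<Longrightarrow> continuous (at_right t) (N s)"
    and mark01: "\<And>s j. 1 \<le> j \<Longrightarrow> 0 \<le> mark s j \<and> mark s j < 1"
    and S_eq: "\<And>t i. 0 \<le> t \<Longrightarrow> S t i = S0 i + arrivals n c (N Arrival) (mark Arrival) S M i t
        - departures n (N Service) (mark Service) S i t"
    and M_eq: "\<And>t. 0 \<le> t \<Longrightarrow> real (M t) = real M0
        + token_change n c (N Arrival) (N Message) (mark Message) S M t"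
    and init: "valid n c (S0, M0)"
    and single: "\<And>k. k < K \<Longrightarrow> (\<Sum>s\<in>{Arrival, Service, Message}. N s (d * real (Suc k)) - N s (d * real k)) \<le> 1"
begin

definition inc :: "flow \<Rightarrow> nat \<Rightarrow> nat" where "inc s k = N s (d * real (Suc k)) - N s (d * real k)"

abbreviation ch :: "nat \<Rightarrow> (nat \<Rightarrow> real) \<times> nat" where
  "ch k \<equiv> chain n c (S0, M0) inc (\<lambda>s j. mark s (Suc j)) k"

lemma state_cong:
  assumes "0 \<le> t" "0 \<le> t'" "\<And>s. N s t = N s t'"
  shows "S t = S t'" "M t = M t'"
proof -
  show "S t = S t'" using assms by (auto simp: S_eq arrivals_def departures_def Let_def intro!: ext)
  have "real (M t) = real (M t')" using assms by (simp add: M_eq token_change_def Let_def)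
  then show "M t = M t'" by simp
qed

lemma N_le: "0 \<le> t \<Longrightarrow> t \<le> t' \<Longrightarrow> N s t \<le> N s t'"
  using mono_onD[OF N_mono, of t t' s] by simp

lemma inc_add: "N s (d * real (Suc k)) = N s (d * real k) + inc s k"
  unfolding inc_def using d N_le[of "d * real k" "d * real (Suc k)" s] by simp

lemma N_grid: "N s (d * real k) = (\<Sum>l<k. inc s l)"
  by (induction k) (use inc_add N_0 in auto)

lemma inc_single: "k < K \<Longrightarrow> inc Arrival k + inc Service k + inc Message k \<le> 1"
  using single[of k] by (simp add: inc_def)

lemma inc_le_1: "k < K \<Longrightarrow> inc s k \<le> 1"
  using inc_single[of k] by (cases s) auto

lemma inc_other: "k < K \<Longrightarrow> 1 \<le> inc s k \<Longrightarrow> s' \<noteq> s \<Longrightarrow> inc s' k = 0"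
  using inc_single[of k] by (cases s; cases s') auto

text \<open>Between the left end of the cell and its only event no process jumps, so the left limits in the evolution
  equations are the values at the left end.\<close>

lemma cell_event:
  assumes k: "k < K" and e: "1 \<le> inc s k"
  defines "j \<equiv> Suc (N s (d * real k))"
  defines "\<tau> \<equiv> event_time (N s) j"
  shows "left_lim M \<tau> = M (d * real k)" "left_lim (\<lambda>t. S t i) \<tau> = S (d * real k) i"
    and "N s (d * real (Suc k)) = j"
proof -
  let ?a = "d * real k" and ?b = "d * real (Suc k)"
  have ab: "0 \<le> ?a" "?a \<le> ?b" using d by auto
  show Nb: "N s ?b = j" using inc_add[of s k] inc_le_1[OF k, of s] e by (simp add: j_def)
  have j: "N s ?a < j" "j \<le> N s ?b" using Nb by (auto simp: j_def)
  note E = event_time_in_cell[OF N_mono N_rc[OF ab(1)] ab j, folded \<tau>_def]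
  have et: "?a < \<tau>" "\<tau> \<le> ?b" by (rule E)+
  have eq: "N s' t = N s' ?a" if "?a \<le> t" "t < \<tau>" for s' t
  proof (cases "s' = s")
    case True
    have "0 \<le> t" using ab(1) that(1) by (rule order_trans)
    then have "N s t < j" using E(3) that(2) by blast
    moreover have "N s ?a \<le> N s t" using N_le[OF ab(1) that(1)] .
    ultimately show ?thesis using True by (simp add: j_def)
  next
    case False
    have "N s' ?b = N s' ?a" using inc_add[of s' k] inc_other[OF k e False] by simp
    moreover have "N s' ?a \<le> N s' t" using N_le[OF ab(1) that(1)] .
    moreover have "N s' t \<le> N s' ?b"
      by (rule N_le[OF order_trans[OF ab(1) that(1)]]) (use that(2) et(2) in linarith)
    ultimately show ?thesis by simp
  qed
  have const: "M t = M ?a \<and> S t = S ?a" if "?a \<le> t" "t < \<tau>" for t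
    using state_cong[of t ?a, OF order_trans[OF ab(1) that(1)] ab(1) eq[OF that]] by simp
  show "left_lim M \<tau> = M ?a" by (rule left_lim_const[OF et(1)]) (use const in blast)
  show "left_lim (\<lambda>t. S t i) \<tau> = S ?a i"
    by (rule left_lim_const[OF et(1)]) (use const in metis)
qed

lemma grid_step:
  assumes k: "k < K" and v: "valid n c (S (d * real k), M (d * real k))"
  shows "(S (d * real (Suc k)), M (d * real (Suc k))) =
    step n c (\<lambda>s. 1 \<le> inc s k) (\<lambda>s. mark s (Suc (N s (d * real k)))) (S (d * real k), M (d * real k))"
proof -
  let ?a = "d * real k" and ?b = "d * real (Suc k)"
  have ab: "0 \<le> ?a" "0 \<le> ?b" using d by auto
  note of_nat_Suc[simp del]
  have Nb: "N s ?b = N s ?a" if "\<not> 1 \<le> inc s k" for s using inc_add[of s k] that by simp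
  have Nb1: "N s ?b = Suc (N s ?a)" if "1 \<le> inc s k" for s using cell_event(3)[OF k that] .
  have c1: "M ?a \<le> c" using v by (simp add: valid_def)
  have m: "0 \<le> mark s (Suc j)" "mark s (Suc j) < 1" for s j using mark01[of "Suc j" s] by auto
  have A: "arrivals n c (N Arrival) (mark Arrival) S M i ?b = arrivals n c (N Arrival) (mark Arrival) S M i ?a
      + of_bool (1 \<le> inc Arrival k \<and> hit (arr_iv i (S ?a, M ?a)) (mark Arrival (Suc (N Arrival ?a)))) / real n" for i
  proof (cases "1 \<le> inc Arrival k")
    case False
    then show ?thesis by (simp add: arrivals_def Nb[OF False])
  next
    case True
    have ll: "left_lim M (event_time (N Arrival) (Suc (N Arrival ?a))) = M ?a"
      "left_lim (\<lambda>t. S t i) (event_time (N Arrival) (Suc (N Arrival ?a))) = S ?a i" for i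
      by (rule cell_event[OF k True])+
    have "i = 0 \<or> i = 1 \<or> 2 \<le> i" by linarith
    then show ?thesis
    proof (elim disjE)
      assume "i = 0" then show ?thesis by (simp add: arrivals_def arr_iv_def hit_def)
    next
      assume "i = 1" then show ?thesis
        using True c1 m[of Arrival]
        by (auto simp: arrivals_def arr_iv_def hit_def Nb1[OF True] ll Let_def add_divide_distrib)
    next
      assume "2 \<le> i" then show ?thesis
        using True
        by (auto simp: arrivals_def arr_iv_def hit_def Nb1[OF True] ll Let_def add_divide_distrib)
    qed
  qed
  have D: "departures n (N Service) (mark Service) S i ?b = departures n (N Service) (mark Service) S i ?a
      + of_bool (1 \<le> inc Service k \<and> hit (srv_iv i (S ?a, M ?a)) (mark Service (Suc (N Service ?a)))) / real n" for i
  proof (cases "1 \<le> inc Service k")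
    case False
    then show ?thesis by (simp add: departures_def Nb[OF False])
  next
    case True
    have ll: "left_lim (\<lambda>t. S t i) (event_time (N Service) (Suc (N Service ?a))) = S ?a i" for i
      by (rule cell_event[OF k True])
    show ?thesis using True
      by (auto simp: departures_def srv_iv_def hit_def Nb1[OF True] ll Let_def add_divide_distrib)
  qed
  have T: "token_change n c (N Arrival) (N Message) (mark Message) S M ?b =
      token_change n c (N Arrival) (N Message) (mark Message) S M ?a
      - of_bool (1 \<le> inc Arrival k \<and> 1 \<le> M ?a)
      + of_bool (1 \<le> inc Message k \<and> hit (msg_iv n c (S ?a, M ?a)) (mark Message (Suc (N Message ?a))))"
  proof -
    have 1: "(\<Sum>j=1..N Arrival ?b. indicator {1..c} (left_lim M (event_time (N Arrival) j)) :: real) =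
      (\<Sum>j=1..N Arrival ?a. indicator {1..c} (left_lim M (event_time (N Arrival) j))) + of_bool (1 \<le> inc Arrival k \<and> 1 \<le> M ?a)"
    proof (cases "1 \<le> inc Arrival k")
      case True
      show ?thesis using True c1 by (simp add: Nb1[OF True] cell_event(1)[OF k True] indicator_def)
    qed (simp add: Nb)
    let ?f = "\<lambda>j. let m = real (left_lim M (event_time (N Message) j));
               s1 = left_lim (\<lambda>u. S u 1) (event_time (N Message) j)
           in indicator {0..real c - 1} m * indicator {0..<1 - s1 - m / real n} (mark Message j) :: real"
    have 2: "(\<Sum>j=1..N Message ?b. ?f j) = (\<Sum>j=1..N Message ?a. ?f j)
      + of_bool (1 \<le> inc Message k \<and> hit (msg_iv n c (S ?a, M ?a)) (mark Message (Suc (N Message ?a))))"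
    proof (cases "1 \<le> inc Message k")
      case True
      have "?f (Suc (N Message ?a)) = of_bool (hit (msg_iv n c (S ?a, M ?a)) (mark Message (Suc (N Message ?a))))"
        unfolding Let_def cell_event(1,2)[OF k True] by (auto simp: msg_iv_def hit_def indicator_def)
      then show ?thesis using True by (simp add: Nb1[OF True])
    qed (simp add: Nb)
    show ?thesis unfolding token_change_def 1 2 by simp
  qed
  have S: "S ?b i = S ?a i + (of_bool (1 \<le> inc Arrival k \<and> hit (arr_iv i (S ?a, M ?a)) (mark Arrival (Suc (N Arrival ?a))))
      - of_bool (1 \<le> inc Service k \<and> hit (srv_iv i (S ?a, M ?a)) (mark Service (Suc (N Service ?a))))) / real n" for i
    unfolding S_eq[OF ab(2)] S_eq[OF ab(1)] A D by (simp add: diff_divide_distrib)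
  have "real (M ?b) = real (M ?a - of_bool (1 \<le> inc Arrival k \<and> 1 \<le> M ?a)
      + of_bool (1 \<le> inc Message k \<and> hit (msg_iv n c (S ?a, M ?a)) (mark Message (Suc (N Message ?a)))))"
    unfolding M_eq[OF ab(2)] T using M_eq[OF ab(1)] by (auto simp: of_nat_diff)
  then have "M ?b = M ?a - of_bool (1 \<le> inc Arrival k \<and> 1 \<le> M ?a)
      + of_bool (1 \<le> inc Message k \<and> hit (msg_iv n c (S ?a, M ?a)) (mark Message (Suc (N Message ?a))))"
    by (simp only: of_nat_eq_iff)
  then show ?thesis unfolding step_def using S by (auto intro!: ext)
qed

lemma start: "S 0 = S0" "M 0 = M0"
proof -
  show "S 0 = S0" by (auto simp: S_eq arrivals_def departures_def N_0 Let_def intro!: ext)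
  have "real (M 0) = real M0" by (simp add: M_eq token_change_def N_0)
  then show "M 0 = M0" by simp
qed

lemma grid_eq_chain: "k \<le> K \<Longrightarrow> (S (d * real k), M (d * real k)) = ch k \<and> valid n c (ch k)"
proof (induction k)
  case 0 then show ?case using start init by simp
next
  case (Suc k)
  then have IH: "(S (d * real k), M (d * real k)) = ch k" "valid n c (ch k)" and k: "k < K" by auto
  have "(S (d * real (Suc k)), M (d * real (Suc k))) = ch (Suc k)"
    using grid_step[OF k] IH by (simp add: N_grid)
  moreover have "valid n c (ch (Suc k))"
    unfolding chain.simps
  proof (rule valid_step[OF IH(2) n])
    fix s s' assume "1 \<le> inc s k" "1 \<le> inc s' k"
    then show "s = s'" using inc_other[OF k, of s s'] by auto
  qed
  ultimately show ?case by simp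
qed

lemma within_cell:
  assumes k: "k < K" and t: "d * real k \<le> t" "t \<le> d * real (Suc k)"
  shows "S t = S (d * real k) \<or> S t = S (d * real (Suc k))"
proof -
  let ?a = "d * real k" and ?b = "d * real (Suc k)"
  have a: "0 \<le> ?a" using d by auto
  have le: "N s ?a \<le> N s t" "N s t \<le> N s ?b" for s
    using N_le[OF a t(1)] N_le[OF order_trans[OF a t(1)] t(2)] by auto
  show ?thesis
  proof (cases "\<forall>s. N s t = N s ?a")
    case True
    then show ?thesis using state_cong(1)[of t ?a] a t by auto
  next
    case False
    then obtain s where "N s t \<noteq> N s ?a" by blast
    then have s: "N s ?a < N s t" using le[of s] by simp
    then have i: "1 \<le> inc s k" using le(2)[of s] inc_add[of s k] by simp
    have "N s' t = N s' ?b" for s'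
    proof (cases "s' = s")
      case True
      then show ?thesis using s le[of s] inc_add[of s k] inc_le_1[OF k, of s] by simp
    next
      case False
      then show ?thesis using le[of s'] inc_add[of s' k] inc_other[OF k i False] by simp
    qed
    then show ?thesis using state_cong(1)[of t ?b] a t by auto
  qed
qed

end

section \<open>Fluid solutions as integral equations\<close>

text \<open>The drift of level \<open>i\<close> is affine in the fraction of arrivals that find no token; this is the coefficient,
  divided by the arrival rate.\<close>

definition random_gain :: "nat \<Rightarrow> (nat \<Rightarrow> real) \<Rightarrow> real" where
  "random_gain i x = (if i = 1 then 0 else x (i - 1)) - x i"

text \<open>The difference quotients are bounded by the Lipschitz constant and converge almost everywhere, and their
  integrals converge to the increment of \<open>f\<close> by continuity; dominated convergence gives the claim.\<close>

lemma lipschitz_has_integral_derivative: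
  fixes f g :: "real \<Rightarrow> real"
  assumes lip: "L-lipschitz_on {0..} f"
    and ae: "AE t in lebesgue. 0 \<le> t \<longrightarrow> (f has_real_derivative g t) (at t within {0..})"
    and ab: "0 \<le> a" "a \<le> b"
  shows "(g has_integral (f b - f a)) {a..b}"
proof -
  obtain Z where Z: "Z \<in> null_sets lebesgue"
    "{t. \<not> (0 \<le> t \<longrightarrow> (f has_real_derivative g t) (at t within {0..}))} \<subseteq> Z"
    using ae by (auto simp: eventually_ae_filter)
  then have negl: "negligible Z" by (simp add: negligible_iff_null_sets)
  define f' where "f' t = f (max 0 t)" for t
  have L0: "0 \<le> L" using lip by (rule lipschitz_on_nonneg)
  have f'_lip: "\<bar>f' x - f' y\<bar> \<le> L * \<bar>x - y\<bar>" for x y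
  proof -
    have "dist (f (max 0 x)) (f (max 0 y)) \<le> L * dist (max 0 x) (max 0 y)"
      by (rule lipschitz_onD[OF lip]) auto
    also have "\<dots> \<le> L * \<bar>x - y\<bar>"
      by (intro mult_left_mono L0) (auto simp: dist_real_def)
    finally show ?thesis by (simp add: f'_def dist_real_def)
  qed
  have "L-lipschitz_on UNIV f'" by (rule lipschitz_onI) (auto simp: dist_real_def f'_lip L0)
  then have cont: "continuous_on A f'" for A
    using lipschitz_on_continuous_on continuous_on_subset by blast
  define F where "F x = integral {-1..x} f'" for x
  have DF: "(F has_real_derivative f' x) (at x)" if "-1 < x" for x
  proof -
    have "(F has_real_derivative f' x) (at x within {-1..x + 1})"
      unfolding F_def[abs_def] using that by (intro integral_has_real_derivative cont) auto
    moreover have "at x within {-1..x + 1} = at x" by (rule at_within_Icc_at) (use that in auto)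
    ultimately show ?thesis by simp
  qed
  define h where "h k = inverse (real (Suc k))" for k
  have h: "0 < h k" for k by (simp add: h_def)
  have h0: "h \<longlonglongrightarrow> 0" using LIMSEQ_inverse_real_of_nat by (simp add: h_def[abs_def])
  define q where "q k t = (f' (t + h k) - f' t) / h k" for k t
  have qint: "(q k has_integral ((F (b + h k) - F b) / h k - (F (a + h k) - F a) / h k)) {a..b}" for k
  proof -
    have "((\<lambda>t. (F (t + h k) - F t) / h k) has_real_derivative q k t) (at t)" if "t \<in> {a..b}" for t
    proof -
      have "((\<lambda>t. F (t + h k)) has_real_derivative f' (t + h k)) (at t)"
        unfolding DERIV_shift[symmetric] by (rule DF) (use that ab h[of k] in auto)
      moreover have "(F has_real_derivative f' t) (at t)" using DF that ab by simp
      ultimately show ?thesis unfolding q_def by (intro DERIV_cdivide DERIV_diff)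
    qed
    then show ?thesis
      by (intro fundamental_theorem_of_calculus ab)
        (auto simp: has_real_derivative_iff_has_vector_derivative[symmetric] intro: has_field_derivative_at_within)
  qed
  have lim: "(\<lambda>k. (F (x + h k) - F x) / h k) \<longlonglongrightarrow> f' x" if "-1 < x" for x
  proof -
    have "((\<lambda>t. (F (x + t) - F x) / t) \<longlongrightarrow> f' x) (at 0)" using DF[OF that] by (simp add: DERIV_def)
    moreover have "filterlim h (at 0) sequentially"
      unfolding filterlim_at using h0 h less_imp_neq[OF h] by (auto intro!: always_eventually)
    ultimately show ?thesis by (rule filterlim_compose)
  qed
  let ?S = "{a..b} - Z"
  have iS: "(w has_integral y) {a..b} \<Longrightarrow> (w has_integral y) ?S" for w :: "real \<Rightarrow> real" and y
    by (erule has_integral_spike_set_eq[THEN iffD1, rotated 2]; rule negligible_subset[OF negl]) auto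
  have conv: "(\<lambda>k. q k t) \<longlonglongrightarrow> g t" if t: "t \<in> ?S" for t
  proof -
    have t0: "0 \<le> t" using t ab by auto
    have "(f has_real_derivative g t) (at t within {0..})" using Z(2) t t0 by auto
    then have "((\<lambda>y. (f y - f t) / (y - t)) \<longlongrightarrow> g t) (at t within {0..})"
      by (simp add: has_field_derivative_iff)
    moreover have "filterlim (\<lambda>k. t + h k) (at t within {0..}) sequentially"
      unfolding filterlim_at
    proof
      show "\<forall>\<^sub>F k in sequentially. t + h k \<in> {0..} \<and> t + h k \<noteq> t"
        by (rule always_eventually, rule allI) (use t0 in \<open>auto simp: less_imp_le[OF h] add_nonneg_nonneg less_imp_neq[OF h, symmetric]\<close>)
      from tendsto_add[OF tendsto_const[of t] h0] show "(\<lambda>k. t + h k) \<longlonglongrightarrow> t" by simp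
    qed
    ultimately have "(\<lambda>k. (f (t + h k) - f t) / (t + h k - t)) \<longlonglongrightarrow> g t"
      by (rule filterlim_compose)
    moreover have "(f (t + h k) - f t) / (t + h k - t) = q k t" for k
      using t0 h[of k] by (simp add: q_def f'_def max_def)
    ultimately show ?thesis by simp
  qed
  have D: "g integrable_on ?S \<and> (\<lambda>k. integral ?S (q k)) \<longlonglongrightarrow> integral ?S g"
  proof -
    have 1: "q k integrable_on ?S" for k using iS[OF qint] by blast
    have 2: "(\<lambda>_. L) integrable_on ?S" using iS[OF has_integral_const_real[of L a b]] by blast
    have 3: "norm (q k t) \<le> L" for k t
      using f'_lip[of "t + h k" t] h[of k] by (simp add: q_def divide_le_eq)
    show ?thesis
      using dominated_convergence[of q ?S "\<lambda>_. L" g] 1 2 3 conv by auto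
  qed
  have "integral ?S (q k) = (F (b + h k) - F b) / h k - (F (a + h k) - F a) / h k" for k
    using iS[OF qint] by (rule integral_unique)
  then have "(\<lambda>k. integral ?S (q k)) \<longlonglongrightarrow> f' b - f' a"
    using tendsto_diff[OF lim[of b] lim[of a]] ab by simp
  then have "integral ?S g = f b - f a"
    using D LIMSEQ_unique ab by (fastforce simp: f'_def max_def)
  then have "(g has_integral (f b - f a)) ?S" using D by (metis integrable_integral)
  then show ?thesis 
    by (rule has_integral_spike_set_eq[THEN iffD1, rotated 2]; intro negligible_subset[OF negl]) auto
qed

definition proper_regime :: "regime \<Rightarrow> bool" where
  "proper_regime R = (case R of High_Memory m \<Rightarrow> 0 < m | High_Message k \<Rightarrow> True | Constrained k m \<Rightarrow> 0 < m)"

lemma in_regime_proper: "in_regime R c mu \<Longrightarrow> proper_regime R"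
  by (cases R) (auto simp: proper_regime_def)

lemma geometric_ge_1: "1 \<le> (\<Sum>j=0..k. x ^ j)" if "0 \<le> (x::real)"
proof -
  have "(\<Sum>j\<in>{0}. x ^ j) \<le> (\<Sum>j=0..k. x ^ j)" using that by (intro sum_mono2) auto
  then show ?thesis by simp
qed

lemma P0_bounds:
  assumes "proper_regime R" "0 < lam" "x 1 \<le> 1" "x 2 \<le> 1"
  shows "0 \<le> P0 lam R x" "P0 lam R x \<le> 1"
proof -
  have "0 \<le> P0 lam R x \<and> P0 lam R x \<le> 1"
  proof (cases R)
    case (High_Memory m)
    then show ?thesis using assms by (auto simp: proper_regime_def)
  next
    case (High_Message k)
    then show ?thesis using assms by (auto simp: indicator_def)
  next
    case (Constrained k m)
    then have "1 \<le> (\<Sum>j=0..k. (m * (1 - x 1) / lam) ^ j)"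
      using assms by (intro geometric_ge_1) (auto simp: proper_regime_def)
    then show ?thesis using Constrained by (auto simp: inverse_le_1_iff)
  qed
  then show "0 \<le> P0 lam R x" "P0 lam R x \<le> 1" by auto
qed

lemma drift_eq:
  assumes "1 \<le> i"
  shows "drift lam R x i = (if i = 1 then lam else 0) + lam * P0 lam R x * random_gain i x - (x i - x (i + 1))"
  using assms by (auto simp: drift_def random_gain_def algebra_simps numeral_2_eq_2)

locale fluid =
  fixes lam :: real and R :: regime and s0 :: "nat \<Rightarrow> real" and s :: "real \<Rightarrow> nat \<Rightarrow> real"
  assumes lam: "0 < lam" "lam < 1" and R: "proper_regime R" and sol: "fluid_solution lam R s0 s"
begin

lemma ss: "0 \<le> t \<Longrightarrow> s t \<in> state_space" and s_0: "s 0 = s0"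
  using sol by (auto simp: fluid_solution_def state_space_1_def)

lemma s_bounds: "0 \<le> t \<Longrightarrow> 0 \<le> s t i" "0 \<le> t \<Longrightarrow> s t i \<le> 1" "0 \<le> t \<Longrightarrow> s t 0 = 1" "0 \<le> t \<Longrightarrow> s t (Suc i) \<le> s t i"
  using ss by (auto simp: state_space_def)

definition Lip :: real where "Lip = (SOME L. \<forall>i. L-lipschitz_on {0..} (\<lambda>t. s t i))"

lemma lipschitz: "Lip-lipschitz_on {0..} (\<lambda>t. s t i)"
proof -
  have "\<exists>L. \<forall>i. L-lipschitz_on {0..} (\<lambda>t. s t i)" using sol by (simp add: fluid_solution_def)
  then have "\<forall>i. Lip-lipschitz_on {0..} (\<lambda>t. s t i)" unfolding Lip_def by (rule someI_ex)
  then show ?thesis by blast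
qed

lemma Lip_nonneg: "0 \<le> Lip" using lipschitz by (rule lipschitz_on_nonneg)

lemma s_lip: "0 \<le> t \<Longrightarrow> 0 \<le> t' \<Longrightarrow> \<bar>s t i - s t' i\<bar> \<le> Lip * \<bar>t - t'\<bar>"
  using lipschitz_onD[OF lipschitz, of t t' i] by (simp add: dist_real_def)

lemma s_cont: "A \<subseteq> {0..} \<Longrightarrow> continuous_on A (\<lambda>t. s t i)"
  using lipschitz_on_continuous_on[OF lipschitz] continuous_on_subset by blast

lemma drift_integral:
  assumes "1 \<le> i" "0 \<le> a" "a \<le> b"
  shows "((\<lambda>t. drift lam R (s t) i) has_integral (s b i - s a i)) {a..b}"
proof (rule lipschitz_has_integral_derivative[OF lipschitz _ assms(2,3)])
  have "AE t in lebesgue. 0 \<le> t \<longrightarrow>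
        (\<forall>i\<ge>1. ((\<lambda>u. s u i) has_real_derivative drift lam R (s t) i) (at t within {0..}))"
    using sol by (simp add: fluid_solution_def)
  then show "AE t in lebesgue. 0 \<le> t \<longrightarrow> ((\<lambda>u. s u i) has_real_derivative drift lam R (s t) i) (at t within {0..})"
    by (rule AE_mp) (use assms in auto)
qed

abbreviation p :: "real \<Rightarrow> real" where "p t \<equiv> P0 lam R (s t)"

lemma p_bounds: "0 \<le> t \<Longrightarrow> 0 \<le> p t" "0 \<le> t \<Longrightarrow> p t \<le> 1"
  using P0_bounds[OF R lam(1)] s_bounds by auto

lemma p_integrable:
  assumes "0 \<le> a" "a \<le> b"
  shows "p integrable_on {a..b}"
proof (cases R)
  case (High_Memory m)
  have "continuous_on {a..b} p" unfolding High_Memory P0.simps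
    using assms lam by (intro continuous_intros s_cont) auto
  then show ?thesis by (rule integrable_continuous_interval)
next
  case (Constrained k m)
  have "(\<Sum>j=0..k. (m * (1 - s t 1) / lam) ^ j) \<noteq> 0" if "t \<in> {a..b}" for t
  proof -
    have "1 \<le> (\<Sum>j=0..k. (m * (1 - s t 1) / lam) ^ j)"
      using R Constrained lam s_bounds(2)[of t 1] that assms
      by (intro geometric_ge_1) (auto simp: proper_regime_def)
    then show ?thesis by linarith
  qed
  then have "continuous_on {a..b} p" unfolding Constrained P0.simps
    using assms lam by (intro continuous_intros s_cont) auto
  then show ?thesis by (rule integrable_continuous_interval)
next
  case (High_Message k)
  have "(\<lambda>t. lam - (s t 1 - s t 2) - drift lam R (s t) 1) integrable_on {a..b}"
  proof (rule integrable_diff)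
    show "(\<lambda>t. lam - (s t 1 - s t 2)) integrable_on {a..b}"
      using assms by (intro integrable_continuous_interval continuous_intros s_cont) auto
    show "(\<lambda>t. drift lam R (s t) 1) integrable_on {a..b}"
      using drift_integral[of 1 a b] assms by blast
  qed
  moreover have "lam - (s t 1 - s t 2) - drift lam R (s t) 1 = lam * p t" for t
    unfolding High_Message by (subst drift_eq) (auto simp: random_gain_def indicator_def numeral_2_eq_2)
  ultimately have "(\<lambda>t. lam * p t) integrable_on {a..b}" by simp
  from integrable_cmul[OF this, of "1 / lam"] show ?thesis using lam by simp
qed

text \<open>The mass of arrivals that find no token in the fluid model.\<close>

definition ell :: "real \<Rightarrow> real" where "ell t = integral {0..t} (\<lambda>u. lam * p u)"

lemma ell_0: "ell 0 = 0" by (simp add: ell_def)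

lemma ell_integral:
  assumes "0 \<le> a" "a \<le> b"
  shows "((\<lambda>u. lam * p u) has_integral (ell b - ell a)) {a..b}"
proof -
  have i: "(\<lambda>u. lam * p u) integrable_on {0..b}" and i': "(\<lambda>u. lam * p u) integrable_on {a..b}"
    using integrable_cmul[OF p_integrable[of 0 b], of lam] integrable_cmul[OF p_integrable[of a b], of lam] assms
    by auto
  have "ell a + integral {a..b} (\<lambda>u. lam * p u) = ell b"
    unfolding ell_def by (rule Henstock_Kurzweil_Integration.integral_combine[OF assms i])
  then show ?thesis using i' by (metis add_diff_cancel_left' integrable_integral)
qed

lemma ell_increment:
  assumes "0 \<le> a" "a \<le> b"
  shows "0 \<le> ell b - ell a" "ell b - ell a \<le> lam * (b - a)"
proof -
  have pb: "0 \<le> lam * p t" "lam * p t \<le> lam" if "t \<in> {a..b}" for t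
    using p_bounds[of t] that assms lam by (auto simp: mult_left_le)
  show "0 \<le> ell b - ell a"
    by (rule has_integral_nonneg[OF ell_integral[OF assms]]) (use pb in auto)
  have "((\<lambda>_. lam) has_integral (lam * (b - a))) {a..b}"
    using has_integral_const_real[of lam a b] assms by (simp add: mult.commute)
  then show "ell b - ell a \<le> lam * (b - a)"
    by (rule has_integral_le[OF ell_integral[OF assms]]) (use pb in auto)
qed

lemma integral_near_const:
  fixes f :: "real \<Rightarrow> real"
  assumes "(f has_integral I) {a..b}" "a \<le> b" "\<And>u. u \<in> {a..b} \<Longrightarrow> \<bar>f u\<bar> \<le> C * (u - a)" "0 \<le> C"
  shows "\<bar>I\<bar> \<le> C * (b - a)\<^sup>2"
proof -
  have "norm I \<le> (C * (b - a)) * measure lborel {a..b}"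
  proof (rule has_integral_bound_real[where S="{}", OF _ _ assms(1)])
    show "norm (f u) \<le> C * (b - a)" if "u \<in> {a..b} - {}" for u
    proof -
      have "C * (u - a) \<le> C * (b - a)" using that assms(4) by (intro mult_left_mono) auto
      then show ?thesis using assms(3)[of u] that by simp
    qed
  qed (use assms in auto)
  then show ?thesis using assms by (simp add: power2_eq_square)
qed

text \<open>Over a short interval the slow factors of the drift may be replaced by their initial values, but \<open>P0\<close> may not because it need not be
  continuous in time; hence its integral is kept.\<close>

lemma grid_increment:
  assumes "1 \<le> i" "0 \<le> a" "a \<le> b"
  shows "\<bar>s b i - s a i - ((if i = 1 then lam * (b - a) else 0) + random_gain i (s a) * (ell b - ell a) - (b - a) * (s a i - s a (i + 1)))\<bar>
    \<le> 4 * Lip * (b - a)\<^sup>2"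
proof -
  have "((\<lambda>t. drift lam R (s t) i - ((if i = 1 then lam else 0) + random_gain i (s a) * (lam * p t) - (s a i - s a (i + 1))))
    has_integral (s b i - s a i - ((b - a) * (if i = 1 then lam else 0) + random_gain i (s a) * (ell b - ell a) - (b - a) * (s a i - s a (i + 1))))) {a..b}"
    using has_integral_const_real[of "if i = 1 then lam else 0" a b] has_integral_const_real[of "s a i - s a (i + 1)" a b] assms
    by (intro has_integral_diff has_integral_add drift_integral has_integral_mult_right ell_integral) auto
  from integral_near_const[OF this assms(3), of "4 * Lip"]
  have "\<bar>s b i - s a i - ((b - a) * (if i = 1 then lam else 0) + random_gain i (s a) * (ell b - ell a) - (b - a) * (s a i - s a (i + 1)))\<bar> \<le> 4 * Lip * (b - a)\<^sup>2"
  proof (rule meta_mp[OF meta_mp])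
    fix u assume u: "u \<in> {a..b}"
    have sl: "\<bar>s u j - s a j\<bar> \<le> Lip * (u - a)" for j using s_lip[of u a j] u assms by simp
    have "\<bar>lam * p u * (random_gain i (s u) - random_gain i (s a))\<bar> \<le> 1 * (2 * (Lip * (u - a)))"
      unfolding abs_mult
    proof (intro mult_mono)
      show "\<bar>lam\<bar> * \<bar>p u\<bar> \<le> 1" using p_bounds[of u] lam u assms by (simp add: mult_le_one)
      show "\<bar>random_gain i (s u) - random_gain i (s a)\<bar> \<le> 2 * (Lip * (u - a))"
        using sl[of i] sl[of "i - 1"] by (auto simp: random_gain_def)
    qed auto
    then have "\<bar>lam * p u * (random_gain i (s u) - random_gain i (s a)) - ((s u i - s a i) - (s u (i + 1) - s a (i + 1)))\<bar> \<le> 4 * Lip * (u - a)"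
      using sl[of i] sl[of "i + 1"] by linarith
    then show "\<bar>drift lam R (s u) i - ((if i = 1 then lam else 0) + random_gain i (s a) * (lam * p u) - (s a i - s a (i + 1)))\<bar> \<le> 4 * Lip * (u - a)"
      unfolding drift_eq[OF assms(1)] by (simp add: algebra_simps)
  qed (use Lip_nonneg in auto)
  moreover have "(b - a) * (if i = 1 then lam else 0) = (if i = 1 then lam * (b - a) else 0)" by simp
  ultimately show ?thesis by simp
qed

lemma ell_increment_lipschitz:
  assumes lipP: "\<And>u v. 0 \<le> u \<Longrightarrow> 0 \<le> v \<Longrightarrow> \<bar>p u - p v\<bar> \<le> B * \<bar>s u 1 - s v 1\<bar>" and "0 \<le> B"
    and "0 \<le> a" "a \<le> b"
  shows "\<bar>ell b - ell a - lam * (b - a) * p a\<bar> \<le> B * Lip * (b - a)\<^sup>2"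
proof -
  have "((\<lambda>t. lam * p t - lam * p a) has_integral (ell b - ell a - (b - a) * (lam * p a))) {a..b}"
    using has_integral_const_real[of "lam * p a" a b] assms by (intro has_integral_diff ell_integral) auto
  from integral_near_const[OF this assms(4), of "B * Lip"]
  have "\<bar>ell b - ell a - (b - a) * (lam * p a)\<bar> \<le> B * Lip * (b - a)\<^sup>2"
  proof (rule meta_mp[OF meta_mp])
    fix u assume u: "u \<in> {a..b}"
    have "\<bar>p u - p a\<bar> \<le> B * (Lip * (u - a))"
    proof (rule order_trans[OF lipP])
      have "\<bar>s u 1 - s a 1\<bar> \<le> Lip * (u - a)" using s_lip[of u a 1] u assms by simp
      then show "B * \<bar>s u 1 - s a 1\<bar> \<le> B * (Lip * (u - a))" using assms(2) by (rule mult_left_mono)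
    qed (use u assms in auto)
    then have "lam * \<bar>p u - p a\<bar> \<le> 1 * (B * (Lip * (u - a)))"
      using lam by (intro mult_mono) auto
    then show "\<bar>lam * p u - lam * p a\<bar> \<le> B * Lip * (u - a)"
      using lam by (simp add: abs_mult right_diff_distrib[symmetric] mult.assoc)
  qed (use Lip_nonneg assms in auto)
  then show ?thesis by (simp add: algebra_simps)
qed

text \<open>In the High Message regime \<open>P0\<close> vanishes unless \<open>s t 1 = 1\<close>.\<close>

lemma ell_increment_complementary:
  assumes HM: "R = High_Message k" and "0 \<le> a" "a \<le> b"
  shows "\<bar>(1 - s a 1) * (ell b - ell a)\<bar> \<le> Lip * (b - a)\<^sup>2"
proof -
  have "((\<lambda>t. (1 - s a 1) * (lam * p t)) has_integral ((1 - s a 1) * (ell b - ell a))) {a..b}"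
    using assms by (intro has_integral_mult_right ell_integral)
  then show ?thesis
  proof (rule integral_near_const[OF _ assms(3) _ Lip_nonneg])
    fix u assume u: "u \<in> {a..b}"
    show "\<bar>(1 - s a 1) * (lam * p u)\<bar> \<le> Lip * (u - a)"
    proof (cases "s u 1 = 1")
      case True
      have "\<bar>1 - s a 1\<bar> * \<bar>lam * p u\<bar> \<le> (Lip * (u - a)) * 1"
      proof (intro mult_mono)
        show "\<bar>1 - s a 1\<bar> \<le> Lip * (u - a)" using s_lip[of u a 1] True u assms by simp
        show "\<bar>lam * p u\<bar> \<le> 1" using p_bounds[of u] lam u assms by (simp add: mult_le_one abs_mult)
      qed (use u Lip_nonneg in auto)
      then show ?thesis by (simp add: abs_mult)
    next
      case False
      then have "p u = 0" unfolding HM by simp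
      then show ?thesis using u Lip_nonneg by simp
    qed
  qed
qed

end

section \<open>Uniformly vanishing families and weighted sums\<close>

text \<open>Convergence to zero uniformly over the \<open>K n\<close> grid points.\<close>

definition unif_null :: "(nat \<Rightarrow> nat) \<Rightarrow> (nat \<Rightarrow> nat \<Rightarrow> real) \<Rightarrow> bool" where
  "unif_null K f \<longleftrightarrow> (\<forall>\<epsilon>>0. \<forall>\<^sub>F n in sequentially. \<forall>k\<le>K n. \<bar>f n k\<bar> \<le> \<epsilon>)"

lemma unif_nullD: "unif_null K f \<Longrightarrow> 0 < \<epsilon> \<Longrightarrow> \<forall>\<^sub>F n in sequentially. \<forall>k\<le>K n. \<bar>f n k\<bar> \<le> \<epsilon>"
  by (simp add: unif_null_def)

lemma unif_null_mono:
  assumes "unif_null K f" "\<forall>\<^sub>F n in sequentially. \<forall>k\<le>K n. \<bar>g n k\<bar> \<le> \<bar>f n k\<bar>"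
  shows "unif_null K g"
  unfolding unif_null_def
proof (intro allI impI)
  fix \<epsilon> :: real assume "0 < \<epsilon>"
  from unif_nullD[OF assms(1) this] assms(2)
  show "\<forall>\<^sub>F n in sequentially. \<forall>k\<le>K n. \<bar>g n k\<bar> \<le> \<epsilon>"
    by eventually_elim (meson order_trans)
qed

lemma unif_null_add: "unif_null K f \<Longrightarrow> unif_null K g \<Longrightarrow> unif_null K (\<lambda>n k. f n k + g n k)"
  unfolding unif_null_def
proof (intro allI impI)
  fix \<epsilon> :: real
  assume f: "\<forall>\<epsilon>>0. \<forall>\<^sub>F n in sequentially. \<forall>k\<le>K n. \<bar>f n k\<bar> \<le> \<epsilon>"
    and g: "\<forall>\<epsilon>>0. \<forall>\<^sub>F n in sequentially. \<forall>k\<le>K n. \<bar>g n k\<bar> \<le> \<epsilon>" and \<epsilon>: "0 < \<epsilon>"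
  have h: "0 < \<epsilon> / 2" using \<epsilon> by simp
  from f[rule_format, OF h] g[rule_format, OF h]
  show "\<forall>\<^sub>F n in sequentially. \<forall>k\<le>K n. \<bar>f n k + g n k\<bar> \<le> \<epsilon>"
  proof eventually_elim
    case (elim n)
    show ?case
    proof (intro allI impI)
      fix k assume "k \<le> K n"
      then have "\<bar>f n k\<bar> \<le> \<epsilon> / 2" "\<bar>g n k\<bar> \<le> \<epsilon> / 2" using elim by auto
      then show "\<bar>f n k + g n k\<bar> \<le> \<epsilon>" by linarith
    qed
  qed
qed

lemma unif_null_cmult:
  assumes "unif_null K f"
  shows "unif_null K (\<lambda>n k. c * f n k)"
  unfolding unif_null_def
proof (intro allI impI)
  fix \<epsilon> :: real assume \<epsilon>: "0 < \<epsilon>"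
  have "\<forall>\<^sub>F n in sequentially. \<forall>k\<le>K n. \<bar>f n k\<bar> \<le> \<epsilon> / (\<bar>c\<bar> + 1)"
    using \<epsilon> by (intro unif_nullD assms) auto
  then show "\<forall>\<^sub>F n in sequentially. \<forall>k\<le>K n. \<bar>c * f n k\<bar> \<le> \<epsilon>"
  proof eventually_elim
    case (elim n)
    show ?case
    proof (intro allI impI)
      fix k assume "k \<le> K n"
      then have "\<bar>c\<bar> * \<bar>f n k\<bar> \<le> (\<bar>c\<bar> + 1) * (\<epsilon> / (\<bar>c\<bar> + 1))"
        using elim by (intro mult_mono) auto
      then show "\<bar>c * f n k\<bar> \<le> \<epsilon>" by (simp add: abs_mult)
    qed
  qed
qed

lemma unif_null_minus: "unif_null K f \<Longrightarrow> unif_null K (\<lambda>n k. - f n k)"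
  using unif_null_cmult[of K f "-1"] by simp

lemma unif_null_diff: "unif_null K f \<Longrightarrow> unif_null K g \<Longrightarrow> unif_null K (\<lambda>n k. f n k - g n k)"
  using unif_null_add[OF _ unif_null_minus, of K f g] by simp

lemma unif_null_const: "c \<longlonglongrightarrow> 0 \<Longrightarrow> unif_null K (\<lambda>n k. c n)"
  unfolding unif_null_def
proof (intro allI impI)
  fix \<epsilon> :: real assume "c \<longlonglongrightarrow> 0" "0 < \<epsilon>"
  then have "\<forall>\<^sub>F n in sequentially. \<bar>c n\<bar> < \<epsilon>" using tendstoD[of c 0 sequentially \<epsilon>] by (simp add: dist_real_def)
  then show "\<forall>\<^sub>F n in sequentially. \<forall>k\<le>K n. \<bar>c n\<bar> \<le> \<epsilon>" by eventually_elim auto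
qed

lemma unif_null_abs: "unif_null K f \<Longrightarrow> unif_null K (\<lambda>n k. \<bar>f n k\<bar>)"
  by (simp add: unif_null_def)

lemma unif_null_sum: "finite I \<Longrightarrow> (\<And>i. i \<in> I \<Longrightarrow> unif_null K (f i)) \<Longrightarrow> unif_null K (\<lambda>n k. \<Sum>i\<in>I. f i n k)"
  by (induction I rule: finite_induct) (auto intro: unif_null_add unif_null_const[where c="\<lambda>_. 0", simplified])

text \<open>The weights of \<open>wnorm\<close>: its square is the \<open>wsum\<close> of the squares.\<close>

definition wsum :: "(nat \<Rightarrow> real) \<Rightarrow> real" where "wsum f = (\<Sum>i. f i / 2 ^ i)"

lemma geom_half: "(\<lambda>i. b / 2 ^ i) sums (2 * b :: real)"
proof -
  have "(\<lambda>i. b * (1 / 2) ^ i) sums (b * (1 / (1 - 1 / 2)))"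
    by (intro sums_mult geometric_sums) auto
  then show ?thesis by (simp add: power_divide mult.commute)
qed

lemma wsum_summable:
  assumes "\<And>i. 0 \<le> f i" "\<And>i. f i \<le> b"
  shows "summable (\<lambda>i. f i / 2 ^ i :: real)"
  by (rule summable_comparison_test'[OF sums_summable[OF geom_half[of b]], of 0])
     (use assms in \<open>auto simp: divide_right_mono\<close>)

lemma wsum_mono:
  assumes "\<And>i. 0 \<le> f i" "\<And>i. f i \<le> g i" "\<And>i. g i \<le> b"
  shows "wsum f \<le> wsum g"
  unfolding wsum_def
proof (rule suminf_le)
  show "summable (\<lambda>i. f i / 2 ^ i)" using assms by (intro wsum_summable) (auto intro: order_trans)
  show "summable (\<lambda>i. g i / 2 ^ i)" using assms by (intro wsum_summable) (auto intro: order_trans)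
qed (use assms in \<open>auto simp: divide_right_mono\<close>)

lemma wsum_nonneg: "(\<And>i. 0 \<le> f i) \<Longrightarrow> (\<And>i. f i \<le> b) \<Longrightarrow> 0 \<le> wsum f"
  unfolding wsum_def by (intro suminf_nonneg wsum_summable) auto

lemma wsum_const: "wsum (\<lambda>_. b) = 2 * b"
  unfolding wsum_def using geom_half[of b] by (rule sums_unique[symmetric])

lemma wsum_le_const: "(\<And>i. 0 \<le> f i) \<Longrightarrow> (\<And>i. f i \<le> b) \<Longrightarrow> wsum f \<le> 2 * b"
  using wsum_mono[of f "\<lambda>_. b" b] by (simp add: wsum_const)

lemma wsum_add:
  assumes "\<And>i. 0 \<le> f i" "\<And>i. f i \<le> b" "\<And>i. 0 \<le> g i" "\<And>i. g i \<le> b'"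
  shows "wsum (\<lambda>i. f i + g i) = wsum f + wsum g"
  unfolding wsum_def add_divide_distrib
  by (intro suminf_add[symmetric] wsum_summable[of _ b] wsum_summable[of _ b'] assms)

lemma wsum_cmult:
  assumes "\<And>i. 0 \<le> f i" "\<And>i. f i \<le> b"
  shows "wsum (\<lambda>i. c * f i) = c * wsum f"
  unfolding wsum_def using suminf_mult[OF wsum_summable[OF assms], of c] by simp

lemma wsum_sum:
  assumes "\<And>l i. l < (k::nat) \<Longrightarrow> 0 \<le> f l i" "\<And>l i. l < k \<Longrightarrow> f l i \<le> b"
  shows "wsum (\<lambda>i. \<Sum>l<k. f l i) = (\<Sum>l<k. wsum (f l))"
  unfolding wsum_def sum_divide_distrib
  by (intro suminf_sum wsum_summable[of _ b]) (use assms in auto)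

lemma wsum_term_le:
  assumes "\<And>i. 0 \<le> f i" "\<And>i. f i \<le> b"
  shows "f i \<le> 2 ^ i * wsum f"
proof -
  have "(\<Sum>j\<in>{i}. f j / 2 ^ j) \<le> wsum f"
    unfolding wsum_def by (rule sum_le_suminf[OF wsum_summable[OF assms]]) (use assms in auto)
  then show ?thesis by (simp add: field_simps)
qed

lemma wsum_shift_up:
  assumes "\<And>i. 0 \<le> f i" "\<And>i. f i \<le> b"
  shows "wsum (\<lambda>i. f (i + 1)) \<le> 2 * wsum f"
proof -
  have "wsum f = (\<Sum>i. f (i + 1) / 2 ^ (i + 1)) + (\<Sum>i<1. f i / 2 ^ i)"
    unfolding wsum_def by (rule suminf_split_initial_segment[OF wsum_summable[OF assms]])
  moreover have "(\<Sum>i. f (i + 1) / 2 ^ (i + 1)) = (1 / 2) * wsum (\<lambda>i. f (i + 1))"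
    unfolding wsum_def using suminf_mult[OF wsum_summable, of "\<lambda>i. f (i + 1)" b "1 / 2"] assms by simp
  ultimately show ?thesis using assms(1)[of 0] by simp
qed

lemma wsum_shift_down:
  assumes "\<And>i. 0 \<le> f i" "\<And>i. f i \<le> b" "f 0 = 0"
  shows "wsum (\<lambda>i. f (i - 1)) \<le> wsum f"
proof -
  have "wsum (\<lambda>i. f (i - 1)) = (\<Sum>i. f i / 2 ^ (i + 1)) + (\<Sum>i<1. f (i - 1) / 2 ^ i)"
    unfolding wsum_def
    using suminf_split_initial_segment[OF wsum_summable[of "\<lambda>i. f (i - 1)" b], of 1] assms by simp
  also have "(\<Sum>i. f i / 2 ^ (i + 1)) = (1 / 2) * wsum f"
    unfolding wsum_def using suminf_mult[OF wsum_summable[OF assms(1,2)], of "1 / 2"] by simp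
  finally show ?thesis using wsum_nonneg[of f b] assms by simp
qed

text \<open>Dominated convergence: the tail of the weights is uniformly small, and finitely many coordinates remain.\<close>

lemma unif_null_wsum:
  assumes null: "\<And>i. unif_null K (f i)"
    and bd: "\<forall>\<^sub>F n in sequentially. \<forall>k\<le>K n. \<forall>i. 0 \<le> f i n k \<and> f i n k \<le> b" and b: "0 < b"
  shows "unif_null K (\<lambda>n k. wsum (\<lambda>i. f i n k))"
  unfolding unif_null_def
proof (intro allI impI)
  fix \<epsilon> :: real assume \<epsilon>: "0 < \<epsilon>"
  obtain I where I: "(1 / 2) ^ I < \<epsilon> / (4 * b)"
    using real_arch_pow_inv[of "\<epsilon> / (4 * b)" "1 / 2"] \<epsilon> b by auto
  have "unif_null K (\<lambda>n k. \<Sum>i<I. f i n k)" using null by (intro unif_null_sum) auto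
  from unif_nullD[OF this, of "\<epsilon> / 2"] \<epsilon>
  have "\<forall>\<^sub>F n in sequentially. \<forall>k\<le>K n. \<bar>\<Sum>i<I. f i n k\<bar> \<le> \<epsilon> / 2" by simp
  with bd show "\<forall>\<^sub>F n in sequentially. \<forall>k\<le>K n. \<bar>wsum (\<lambda>i. f i n k)\<bar> \<le> \<epsilon>"
  proof eventually_elim
    case (elim n)
    show ?case
    proof (intro allI impI)
      fix k assume k: "k \<le> K n"
      have f: "0 \<le> f i n k" "f i n k \<le> b" for i using elim(1) k by auto
      have "wsum (\<lambda>i. f i n k) = (\<Sum>i. f (i + I) n k / 2 ^ (i + I)) + (\<Sum>i<I. f i n k / 2 ^ i)"
        unfolding wsum_def by (rule suminf_split_initial_segment[OF wsum_summable[of "\<lambda>i. f i n k"]]) (use f in auto)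
      also have "(\<Sum>i. f (i + I) n k / 2 ^ (i + I)) = (1 / 2) ^ I * wsum (\<lambda>i. f (i + I) n k)"
        unfolding wsum_def using suminf_mult[OF wsum_summable[of "\<lambda>i. f (i + I) n k" b], of "(1 / 2) ^ I"] f
        by (simp add: power_add power_divide mult.commute)
      also have "\<dots> \<le> (\<epsilon> / (4 * b)) * (2 * b)"
        using wsum_le_const[of "\<lambda>i. f (i + I) n k" b] wsum_nonneg[of "\<lambda>i. f (i + I) n k" b] f I \<epsilon> b
        by (intro mult_mono) auto
      also have "(\<Sum>i<I. f i n k / 2 ^ i) \<le> (\<Sum>i<I. f i n k)"
      proof (rule sum_mono)
        fix i
        have "f i n k * 1 \<le> f i n k * 2 ^ i" using f by (intro mult_left_mono) auto
        then show "f i n k / 2 ^ i \<le> f i n k" by (simp add: divide_le_eq)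
      qed
      finally have "wsum (\<lambda>i. f i n k) \<le> \<epsilon>" using elim(2) k b by fastforce
      then show "\<bar>wsum (\<lambda>i. f i n k)\<bar> \<le> \<epsilon>" using wsum_nonneg[of "\<lambda>i. f i n k" b] f by simp
    qed
  qed
qed

lemma abel_sum_bound:
  fixes g z :: "nat \<Rightarrow> real"
  assumes "z 0 = 0" "\<And>l. l \<le> k \<Longrightarrow> \<bar>z l\<bar> \<le> m" "\<bar>g k\<bar> \<le> G" "\<And>l. l < k \<Longrightarrow> \<bar>g (Suc l) - g l\<bar> \<le> v"
  shows "\<bar>\<Sum>l<k. g l * (z (Suc l) - z l)\<bar> \<le> (G + real k * v) * m"
proof -
  have parts: "(\<Sum>l<j. g l * (z (Suc l) - z l)) = g j * z j - (\<Sum>l<j. (g (Suc l) - g l) * z (Suc l))" for j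
    by (induction j) (use assms(1) in \<open>auto simp: algebra_simps\<close>)
  have "\<bar>\<Sum>l<k. (g (Suc l) - g l) * z (Suc l)\<bar> \<le> (\<Sum>l<k. v * m)"
    by (rule order_trans[OF sum_abs]) (intro sum_mono, auto simp: abs_mult intro!: mult_mono assms(2,4) order_trans[OF abs_ge_zero assms(4)])
  then have "\<bar>\<Sum>l<k. (g (Suc l) - g l) * z (Suc l)\<bar> \<le> real k * (v * m)" by simp
  moreover have "\<bar>g k * z k\<bar> \<le> G * m"
    unfolding abs_mult by (intro mult_mono assms) (use assms(3) in auto)
  moreover have "(G + real k * v) * m = G * m + real k * (v * m)" by (simp add: algebra_simps)
  ultimately show ?thesis unfolding parts[of k] by linarith
qed

lemma discrete_gronwall:
  fixes y :: "nat \<Rightarrow> real"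
  assumes "\<And>k. k \<le> K \<Longrightarrow> y k \<le> \<epsilon> + c * (\<Sum>l<k. y l)" "0 \<le> c" "0 \<le> \<epsilon>" "k \<le> K"
  shows "y k \<le> \<epsilon> * exp (c * real k)"
proof -
  have main: "\<epsilon> + c * (\<Sum>l<k. y l) \<le> \<epsilon> * (1 + c) ^ k" if "k \<le> K" for k
    using that
  proof (induction k)
    case (Suc k)
    have "\<epsilon> + c * (\<Sum>l<Suc k. y l) = (\<epsilon> + c * (\<Sum>l<k. y l)) + c * y k" by (simp add: algebra_simps)
    also have "\<dots> \<le> (\<epsilon> + c * (\<Sum>l<k. y l)) + c * (\<epsilon> + c * (\<Sum>l<k. y l))"
      using assms(1)[of k] Suc.prems assms(2) by (intro add_left_mono mult_left_mono) auto
    also have "\<dots> = (1 + c) * (\<epsilon> + c * (\<Sum>l<k. y l))" by (simp add: algebra_simps)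
    also have "\<dots> \<le> (1 + c) * (\<epsilon> * (1 + c) ^ k)" using Suc assms(2) by (intro mult_left_mono) auto
    finally show ?case by (simp add: algebra_simps)
  qed simp
  have "(1 + c) ^ k \<le> exp c ^ k" using assms(2) by (intro power_mono) auto
  also have "\<dots> = exp (c * real k)" by (simp add: exp_of_nat_mult[symmetric] mult.commute)
  finally have "\<epsilon> * (1 + c) ^ k \<le> \<epsilon> * exp (c * real k)" using assms(3) by (rule mult_left_mono)
  then show ?thesis using main[OF assms(4)] assms(1)[OF assms(4)] by linarith
qed

section \<open>Stability of the fluid equation\<close>

text \<open>A sequence of paths \<open>x\<close> on grids of mesh \<open>d\<close> that solves the fluid equations up to a vanishing
  error, with the indicator \<open>D\<close> in place of \<open>P0\<close>, beside an exact fluid solution \<open>s\<close>.\<close>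

locale grid_limit = fluid lam R s0 s for lam R s0 s +
  fixes d :: "nat \<Rightarrow> real" and K :: "nat \<Rightarrow> nat" and B :: real
    and x :: "nat \<Rightarrow> nat \<Rightarrow> nat \<Rightarrow> real" and D :: "nat \<Rightarrow> nat \<Rightarrow> real"
  assumes d_pos: "\<And>n. 0 < d n" and d_null: "d \<longlonglongrightarrow> 0"
    and dK: "\<And>n. d n * real (K n) \<le> B"
    and x_bounds: "\<forall>\<^sub>F n in sequentially. \<forall>k\<le>K n. \<forall>i. 0 \<le> x n k i \<and> x n k i \<le> 1 \<and> x n k 0 = 1"
    and D_bounds: "\<And>n k. 0 \<le> D n k \<and> D n k \<le> 1"
    and evolution: "\<And>i. 1 \<le> i \<Longrightarrow> unif_null K (\<lambda>n k. x n k i - x n 0 i -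
        (\<Sum>l<k. (if i = 1 then lam * d n else 0) + random_gain i (x n l) * (lam * d n * D n l) - d n * (x n l i - x n l (i + 1))))"
    and start: "\<And>i. (\<lambda>n. x n 0 i) \<longlonglongrightarrow> s0 i"
begin

text \<open>\<open>Lg\<close> and \<open>lg\<close> are the integrals of \<open>lam * D\<close> and \<open>lam * P0\<close>, and \<open>err\<close> is the
  defect of the path in the fluid equation of level \<open>i\<close>.\<close>

definition e :: "nat \<Rightarrow> nat \<Rightarrow> nat \<Rightarrow> real" where "e n k i = x n k i - s (d n * real k) i"
definition Lg :: "nat \<Rightarrow> nat \<Rightarrow> real" where "Lg n k = (\<Sum>l<k. lam * d n * D n l)"
definition lg :: "nat \<Rightarrow> nat \<Rightarrow> real" where "lg n k = ell (d n * real k)"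
definition Y :: "nat \<Rightarrow> nat \<Rightarrow> real" where "Y n k = wsum (\<lambda>i. (e n k i)\<^sup>2)"
definition err :: "nat \<Rightarrow> nat \<Rightarrow> nat \<Rightarrow> real" where
  "err n k i = x n k i - x n 0 i -
        (\<Sum>l<k. (if i = 1 then lam * d n else 0) + random_gain i (x n l) * (lam * d n * D n l) - d n * (x n l i - x n l (i + 1)))"
definition regular :: "nat \<Rightarrow> bool" where
  "regular n \<longleftrightarrow> (\<forall>k\<le>K n. \<forall>i. 0 \<le> x n k i \<and> x n k i \<le> 1 \<and> x n k 0 = 1) \<and> d n \<le> 1"

lemma B_nonneg: "0 \<le> B"
  using dK[of 0] d_pos[of 0] by (meson mult_nonneg_nonneg of_nat_0_le_iff order.trans less_imp_le)

lemma dk_le: "k \<le> K n \<Longrightarrow> d n * real k \<le> B"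
  using dK[of n] d_pos[of n] by (smt (verit) mult_left_mono of_nat_mono)

lemma eventually_regular: "\<forall>\<^sub>F n in sequentially. regular n"
proof -
  have "\<forall>\<^sub>F n in sequentially. d n < 1" using d_null by (rule order_tendstoD) simp
  with x_bounds show ?thesis by eventually_elim (auto simp: regular_def)
qed

lemma t_nonneg: "0 \<le> d n * real k" using d_pos[of n] by simp

lemma t_Suc: "d n * real (Suc k) - d n * real k = d n" by (simp add: algebra_simps)

lemma t_mono: "d n * real k \<le> d n * real (Suc k)" using d_pos[of n] by simp

lemma lg_increment: "0 \<le> lg n (Suc k) - lg n k" "lg n (Suc k) - lg n k \<le> lam * d n"
  using ell_increment[OF t_nonneg t_mono, of n k] unfolding lg_def t_Suc by auto

lemma Lg_increment: "Lg n (Suc k) - Lg n k = lam * d n * D n k" by (simp add: Lg_def)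

lemma e_0: "regular n \<Longrightarrow> k \<le> K n \<Longrightarrow> e n k 0 = 0"
  using s_bounds(3)[OF t_nonneg] by (simp add: e_def regular_def)

lemma e_le_1: "regular n \<Longrightarrow> k \<le> K n \<Longrightarrow> \<bar>e n k i\<bar> \<le> 1"
  using s_bounds(1,2)[OF t_nonneg, of n k i] unfolding e_def regular_def by (smt (verit))

lemma e2_bounds: "regular n \<Longrightarrow> k \<le> K n \<Longrightarrow> (e n k i)\<^sup>2 \<le> 1"
  using e_le_1 by (simp add: abs_le_square_iff[of _ 1, simplified])

lemma Y_nonneg: "regular n \<Longrightarrow> k \<le> K n \<Longrightarrow> 0 \<le> Y n k"
  unfolding Y_def using e2_bounds by (intro wsum_nonneg[of _ 1]) auto

lemma e2_le_Y: "regular n \<Longrightarrow> k \<le> K n \<Longrightarrow> (e n k i)\<^sup>2 \<le> 2 ^ i * Y n k"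
  unfolding Y_def using e2_bounds by (intro wsum_term_le[of _ 1]) auto

lemma s_grid_error:
  assumes "1 \<le> i" "k \<le> K n"
  shows "\<bar>s (d n * real k) i - s0 i - (\<Sum>l<k. (if i = 1 then lam * d n else 0) + random_gain i (s (d n * real l)) * (lg n (Suc l) - lg n l)
     - d n * (s (d n * real l) i - s (d n * real l) (i + 1)))\<bar> \<le> 4 * Lip * B * d n"
proof -
  have "\<bar>s (d n * real k) i - s0 i - (\<Sum>l<k. (if i = 1 then lam * d n else 0) + random_gain i (s (d n * real l)) * (lg n (Suc l) - lg n l)
     - d n * (s (d n * real l) i - s (d n * real l) (i + 1)))\<bar> \<le> real k * (4 * Lip * (d n)\<^sup>2)" for k
  proof (induction k)
    case (Suc k)
    have "\<bar>s (d n * real (Suc k)) i - s (d n * real k) i - ((if i = 1 then lam * d n else 0) + random_gain i (s (d n * real k)) * (lg n (Suc k) - lg n k)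
     - d n * (s (d n * real k) i - s (d n * real k) (i + 1)))\<bar> \<le> 4 * Lip * (d n)\<^sup>2"
      using grid_increment[OF assms(1) t_nonneg t_mono, of n k] unfolding t_Suc lg_def .
    moreover have "real (Suc k) * (4 * Lip * (d n)\<^sup>2) = real k * (4 * Lip * (d n)\<^sup>2) + 4 * Lip * (d n)\<^sup>2"
      by (simp add: algebra_simps)
    ultimately show ?case using Suc unfolding sum.lessThan_Suc by linarith
  qed (simp add: s_0)
  also have "real k * (4 * Lip * (d n)\<^sup>2) = (d n * real k) * (4 * Lip * d n)" by (simp add: power2_eq_square)
  also have "\<dots> \<le> B * (4 * Lip * d n)"
    using dk_le[OF assms(2)] Lip_nonneg d_pos[of n] by (intro mult_right_mono) auto
  finally show ?thesis by (simp add: mult_ac)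
qed

text \<open>The contributions to \<open>e\<close> that vanish regardless of the dynamics: initial error, defect of the path, and
  discretisation error of the fluid solution. At level \<open>0\<close> there is no error at all.\<close>

definition a :: "nat \<Rightarrow> nat \<Rightarrow> nat \<Rightarrow> real" where
  "a n k i = (if i = 0 then 0 else \<bar>x n 0 i - s0 i\<bar> + \<bar>err n k i\<bar> + 4 * Lip * B * d n)"

text \<open>The difference of the two equations splits into a term in \<open>e\<close>, driven by \<open>D\<close>, and a term in
  the fluid solution, driven by \<open>Lg - lg\<close>. The latter is summed by parts, which moves the increments to the
  Lipschitz fluid solution and leaves only the size of \<open>Lg - lg\<close>.\<close>

lemma e_bound:
  assumes n: "regular n" and k: "k \<le> K n" and i: "1 \<le> i"
    and m: "\<And>j. j \<le> k \<Longrightarrow> \<bar>Lg n j - lg n j\<bar> \<le> m"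
  shows "\<bar>e n k i\<bar> \<le> a n k i + (1 + 2 * Lip * B) * m +
     d n * (\<Sum>l<k. 2 * \<bar>e n l (i - 1)\<bar> + 2 * \<bar>e n l i\<bar> + \<bar>e n l (i + 1)\<bar>)"
proof -
  let ?s = "\<lambda>l. s (d n * real l)"
  let ?al = "if i = 1 then lam * d n else 0"
  have sb: "0 \<le> ?s l j" "?s l j \<le> 1" "?s l (Suc j) \<le> ?s l j" for l j using s_bounds[OF t_nonneg] by auto
  have ge: "random_gain i (x n l) = random_gain i (?s l) + random_gain i (e n l)" for l by (simp add: random_gain_def e_def)
  have summand: "(?al + random_gain i (x n l) * (lam * d n * D n l) - d n * (x n l i - x n l (i + 1)))
      - (?al + random_gain i (?s l) * (lg n (Suc l) - lg n l) - d n * (?s l i - ?s l (i + 1)))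
      = random_gain i (?s l) * ((Lg n (Suc l) - lg n (Suc l)) - (Lg n l - lg n l))
        + (random_gain i (e n l) * (lam * d n * D n l) - d n * (e n l i - e n l (i + 1)))" for l
    unfolding ge using Lg_increment[of n l] by (simp add: e_def algebra_simps)
  have dec: "e n k i = (x n 0 i - s0 i) + err n k i
     - (?s k i - s0 i - (\<Sum>l<k. ?al + random_gain i (?s l) * (lg n (Suc l) - lg n l) - d n * (?s l i - ?s l (i + 1))))
     + (\<Sum>l<k. random_gain i (?s l) * ((Lg n (Suc l) - lg n (Suc l)) - (Lg n l - lg n l)))
     + (\<Sum>l<k. random_gain i (e n l) * (lam * d n * D n l) - d n * (e n l i - e n l (i + 1)))"
  proof -
    have "(\<Sum>l<k. ?al + random_gain i (x n l) * (lam * d n * D n l) - d n * (x n l i - x n l (i + 1)))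
      - (\<Sum>l<k. ?al + random_gain i (?s l) * (lg n (Suc l) - lg n l) - d n * (?s l i - ?s l (i + 1)))
      = (\<Sum>l<k. random_gain i (?s l) * ((Lg n (Suc l) - lg n (Suc l)) - (Lg n l - lg n l)))
     + (\<Sum>l<k. random_gain i (e n l) * (lam * d n * D n l) - d n * (e n l i - e n l (i + 1)))"
      unfolding sum_subtractf[symmetric] sum.distrib[symmetric] summand ..
    then show ?thesis unfolding err_def e_def by linarith
  qed
  have gs: "\<bar>random_gain i (?s l)\<bar> \<le> 1" for l
    using sb[of l i] sb[of l "i - 1"] i by (auto simp: random_gain_def)
  have gv: "\<bar>random_gain i (?s (Suc l)) - random_gain i (?s l)\<bar> \<le> 2 * Lip * d n" for l
  proof -
    have "\<bar>?s (Suc l) j - ?s l j\<bar> \<le> Lip * d n" for j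
      using s_lip[OF t_nonneg t_nonneg, of n "Suc l" j n l] d_pos[of n] unfolding t_Suc by simp
    from this[of i] this[of "i - 1"] show ?thesis by (auto simp: random_gain_def)
  qed
  have m0: "0 \<le> m" using m[of 0] by simp
  have "\<bar>\<Sum>l<k. random_gain i (?s l) * ((Lg n (Suc l) - lg n (Suc l)) - (Lg n l - lg n l))\<bar> \<le> (1 + real k * (2 * Lip * d n)) * m"
    by (rule abel_sum_bound[where z="\<lambda>l. Lg n l - lg n l" and g="\<lambda>l. random_gain i (?s l)"])
       (use m gs gv in \<open>auto simp: Lg_def lg_def ell_0\<close>)
  also have "\<dots> \<le> (1 + 2 * Lip * B) * m"
  proof (intro mult_right_mono add_left_mono m0)
    have "2 * Lip * (d n * real k) \<le> 2 * Lip * B"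
      using dk_le[OF k] Lip_nonneg by (intro mult_left_mono) auto
    then show "real k * (2 * Lip * d n) \<le> 2 * Lip * B" by (simp add: mult_ac)
  qed
  finally have t1: "\<bar>\<Sum>l<k. random_gain i (?s l) * ((Lg n (Suc l) - lg n (Suc l)) - (Lg n l - lg n l))\<bar> \<le> (1 + 2 * Lip * B) * m" .
  have "\<bar>\<Sum>l<k. random_gain i (e n l) * (lam * d n * D n l) - d n * (e n l i - e n l (i + 1))\<bar>
      \<le> (\<Sum>l<k. d n * (2 * \<bar>e n l (i - 1)\<bar> + 2 * \<bar>e n l i\<bar> + \<bar>e n l (i + 1)\<bar>))"
  proof (rule order_trans[OF sum_abs], rule sum_mono)
    fix l
    have "\<bar>random_gain i (e n l) * (lam * d n * D n l)\<bar> \<le> (\<bar>e n l (i - 1)\<bar> + \<bar>e n l i\<bar>) * d n"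
      unfolding abs_mult
    proof (rule mult_mono)
      show "\<bar>lam\<bar> * \<bar>d n\<bar> * \<bar>D n l\<bar> \<le> d n"
        using lam d_pos[of n] D_bounds[of n l] mult_mono[of "lam * D n l" 1 "d n" "d n"] mult_le_one[of lam "D n l"]
        by (simp add: mult_ac)
    qed (auto simp: random_gain_def)
    moreover have "\<bar>d n * (e n l i - e n l (i + 1))\<bar> \<le> d n * (\<bar>e n l i\<bar> + \<bar>e n l (i + 1)\<bar>)"
      using d_pos[of n] by (simp add: abs_mult)
    ultimately have "\<bar>random_gain i (e n l) * (lam * d n * D n l) - d n * (e n l i - e n l (i + 1))\<bar> \<le>
      (\<bar>e n l (i - 1)\<bar> + \<bar>e n l i\<bar>) * d n + d n * (\<bar>e n l i\<bar> + \<bar>e n l (i + 1)\<bar>)" by linarith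
    also have "\<dots> \<le> d n * (2 * \<bar>e n l (i - 1)\<bar> + 2 * \<bar>e n l i\<bar> + \<bar>e n l (i + 1)\<bar>)"
      using mult_nonneg_nonneg[of "d n" "\<bar>e n l (i - 1)\<bar>"] d_pos[of n] by (simp add: algebra_simps)
    finally show "\<bar>random_gain i (e n l) * (lam * d n * D n l) - d n * (e n l i - e n l (i + 1))\<bar> \<le>
      d n * (2 * \<bar>e n l (i - 1)\<bar> + 2 * \<bar>e n l i\<bar> + \<bar>e n l (i + 1)\<bar>)" .
  qed
  then show ?thesis using t1 s_grid_error[OF i k] dec i unfolding a_def sum_distrib_left by auto
qed

lemma sum_square_le:
  fixes f :: "nat \<Rightarrow> real"
  assumes "k \<le> K n"
  shows "(d n * (\<Sum>l<k. f l))\<^sup>2 \<le> B * (d n * (\<Sum>l<k. (f l)\<^sup>2))"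
proof -
  have "(\<Sum>l<k. f l)\<^sup>2 \<le> real k * (\<Sum>l<k. (f l)\<^sup>2)"
    using sum_squared_le_sum_of_squares[of f "{..<k}"] by (simp add: mult.commute)
  then have "(d n)\<^sup>2 * (\<Sum>l<k. f l)\<^sup>2 \<le> (d n)\<^sup>2 * (real k * (\<Sum>l<k. (f l)\<^sup>2))"
    by (intro mult_left_mono) auto
  also have "\<dots> = (d n * real k) * (d n * (\<Sum>l<k. (f l)\<^sup>2))" by (simp add: power2_eq_square)
  also have "\<dots> \<le> B * (d n * (\<Sum>l<k. (f l)\<^sup>2))"
    using dk_le[OF assms] d_pos[of n] by (intro mult_right_mono mult_nonneg_nonneg sum_nonneg) auto
  finally show ?thesis by (simp add: power_mult_distrib)
qed

lemma Y_recursion: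
  assumes n: "regular n" and k: "k \<le> K n"
    and m: "\<And>j. j \<le> k \<Longrightarrow> \<bar>Lg n j - lg n j\<bar> \<le> m" and ab: "\<And>i. (a n k i)\<^sup>2 \<le> b"
  shows "Y n k \<le> 3 * wsum (\<lambda>i. (a n k i)\<^sup>2) + 6 * ((1 + 2 * Lip * B) * m)\<^sup>2 + 108 * B * (d n * (\<Sum>l<k. Y n l))"
proof -
  let ?C = "((1 + 2 * Lip * B) * m)\<^sup>2"
  define q where "q l i = (e n l (i - 1))\<^sup>2 + ((e n l i)\<^sup>2 + (e n l (i + 1))\<^sup>2)" for l i
  have sq3: "(p + q + r)\<^sup>2 \<le> 3 * p\<^sup>2 + 3 * q\<^sup>2 + 3 * r\<^sup>2" for p q r :: real
    using zero_le_power2[of "p - q"] zero_le_power2[of "q - r"] zero_le_power2[of "p - r"]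
    by (simp add: power2_eq_square algebra_simps)
  have sq221: "(2 * p + 2 * q + r)\<^sup>2 \<le> 9 * (p\<^sup>2 + (q\<^sup>2 + r\<^sup>2))" for p q r :: real
  proof -
    have "9 * (p\<^sup>2 + (q\<^sup>2 + r\<^sup>2)) - (2 * p + 2 * q + r)\<^sup>2 = 4 * (p - q)\<^sup>2 + (p - 2 * r)\<^sup>2 + (q - 2 * r)\<^sup>2 + p\<^sup>2 * 0 + q\<^sup>2 * 0"
      by (simp add: power2_eq_square algebra_simps)
    then show ?thesis by (smt (verit) zero_le_power2 mult_zero_right)
  qed
  have lk: "l < k \<Longrightarrow> l \<le> K n" for l using k by simp
  have q0: "0 \<le> q l i" for l i by (simp add: q_def)
  have q3: "q l i \<le> 3" if "l < k" for l i using e2_bounds[OF n lk[OF that]] unfolding q_def by (smt (verit))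
  have pt: "(e n k i)\<^sup>2 \<le> 3 * (a n k i)\<^sup>2 + (3 * ?C + 27 * B * d n * (\<Sum>l<k. q l i))" for i
  proof (cases "i = 0")
    case True
    then show ?thesis using e_0[OF n k] B_nonneg d_pos[of n] q0
      by (simp add: a_def sum_nonneg)
  next
    case False
    let ?r = "d n * (\<Sum>l<k. 2 * \<bar>e n l (i - 1)\<bar> + 2 * \<bar>e n l i\<bar> + \<bar>e n l (i + 1)\<bar>)"
    have "(e n k i)\<^sup>2 = \<bar>e n k i\<bar>\<^sup>2" by simp
    also have "\<dots> \<le> (a n k i + (1 + 2 * Lip * B) * m + ?r)\<^sup>2"
      using e_bound[OF n k _ m, of i] False by (intro power_mono) auto
    also have "\<dots> \<le> 3 * (a n k i)\<^sup>2 + 3 * ?C + 3 * ?r\<^sup>2" by (rule sq3)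
    also have "?r\<^sup>2 \<le> B * (d n * (\<Sum>l<k. (2 * \<bar>e n l (i - 1)\<bar> + 2 * \<bar>e n l i\<bar> + \<bar>e n l (i + 1)\<bar>)\<^sup>2))"
      by (rule sum_square_le[OF k])
    also have "\<dots> \<le> B * (d n * (\<Sum>l<k. 9 * q l i))"
      using sq221[of "\<bar>e n _ (i - 1)\<bar>" "\<bar>e n _ i\<bar>" "\<bar>e n _ (i + 1)\<bar>"] B_nonneg d_pos[of n]
      by (intro mult_left_mono sum_mono) (auto simp: q_def)
    finally show ?thesis by (simp only: sum_distrib_left[symmetric]) (simp add: algebra_simps)
  qed
  have rhs0: "0 \<le> 27 * B * d n * (\<Sum>l<k. q l i)" for i
    using B_nonneg d_pos[of n] q0 by (intro mult_nonneg_nonneg sum_nonneg) auto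
  have qs3: "(\<Sum>l<k. q l i) \<le> real k * 3" for i
    using sum_mono[of "{..<k}" "\<lambda>l. q l i" "\<lambda>_. 3"] q3 by simp
  then have rhsb: "27 * B * d n * (\<Sum>l<k. q l i) \<le> 27 * B * d n * (real k * 3)" for i
    using B_nonneg d_pos[of n] by (intro mult_left_mono) auto
  have wq: "wsum (q l) \<le> 4 * Y n l" if l: "l < k" for l
  proof -
    note eb = e2_bounds[OF n lk[OF l]]
    have "wsum (q l) = wsum (\<lambda>i. (e n l (i - 1))\<^sup>2) + (wsum (\<lambda>i. (e n l i)\<^sup>2) + wsum (\<lambda>i. (e n l (i + 1))\<^sup>2))"
    proof -
      have "wsum (\<lambda>i. (e n l i)\<^sup>2 + (e n l (i + 1))\<^sup>2) = wsum (\<lambda>i. (e n l i)\<^sup>2) + wsum (\<lambda>i. (e n l (i + 1))\<^sup>2)"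
        by (rule wsum_add[where b=1 and b'=1]) (use eb in auto)
      moreover have "wsum (\<lambda>i. (e n l (i - 1))\<^sup>2 + ((e n l i)\<^sup>2 + (e n l (i + 1))\<^sup>2)) =
         wsum (\<lambda>i. (e n l (i - 1))\<^sup>2) + wsum (\<lambda>i. (e n l i)\<^sup>2 + (e n l (i + 1))\<^sup>2)"
      proof (rule wsum_add[where b=1 and b'=2])
        show "(e n l i)\<^sup>2 + (e n l (i + 1))\<^sup>2 \<le> 2" for i using eb[of i] eb[of "i + 1"] by linarith
      qed (use eb in auto)
      ultimately show ?thesis by (simp add: q_def[abs_def])
    qed
    moreover have "wsum (\<lambda>i. (e n l (i - 1))\<^sup>2) \<le> Y n l"
      unfolding Y_def using wsum_shift_down[of "\<lambda>i. (e n l i)\<^sup>2" 1] eb e_0[OF n lk[OF l]] by simp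
    moreover have "wsum (\<lambda>i. (e n l (i + 1))\<^sup>2) \<le> 2 * Y n l"
      unfolding Y_def using wsum_shift_up[of "\<lambda>i. (e n l i)\<^sup>2" 1] eb by simp
    ultimately show ?thesis by (simp add: Y_def)
  qed
  have a0: "0 \<le> (a n k i)\<^sup>2" for i by simp
  have "Y n k \<le> wsum (\<lambda>i. 3 * (a n k i)\<^sup>2 + (3 * ?C + 27 * B * d n * (\<Sum>l<k. q l i)))"
    unfolding Y_def
  proof (rule wsum_mono)
    show "3 * (a n k i)\<^sup>2 + (3 * ?C + 27 * B * d n * (\<Sum>l<k. q l i)) \<le> 3 * b + (3 * ?C + 27 * B * d n * (real k * 3))" for i
      using ab[of i] rhsb[of i] by linarith
  qed (use pt in auto)
  also have "\<dots> = wsum (\<lambda>i. 3 * (a n k i)\<^sup>2) + wsum (\<lambda>i. 3 * ?C + 27 * B * d n * (\<Sum>l<k. q l i))"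
    by (rule wsum_add[where b="3 * b" and b'="3 * ?C + 27 * B * d n * (real k * 3)"])
       (use ab rhs0 rhsb in \<open>auto intro: add_nonneg_nonneg\<close>)
  also have "wsum (\<lambda>i. 3 * (a n k i)\<^sup>2) = 3 * wsum (\<lambda>i. (a n k i)\<^sup>2)"
    by (rule wsum_cmult[where b=b]) (use ab in auto)
  also have "wsum (\<lambda>i. 3 * ?C + 27 * B * d n * (\<Sum>l<k. q l i)) = 6 * ?C + wsum (\<lambda>i. 27 * B * d n * (\<Sum>l<k. q l i))"
    by (subst wsum_add[where b="3 * ?C" and b'="27 * B * d n * (real k * 3)"])
       (use rhs0 rhsb in \<open>auto simp: wsum_const\<close>)
  also have "wsum (\<lambda>i. 27 * B * d n * (\<Sum>l<k. q l i)) = 27 * B * d n * wsum (\<lambda>i. \<Sum>l<k. q l i)"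
    by (rule wsum_cmult[where b="real k * 3"]) (use q0 qs3 in \<open>auto intro: sum_nonneg\<close>)
  also have "wsum (\<lambda>i. \<Sum>l<k. q l i) = (\<Sum>l<k. wsum (q l))"
    by (rule wsum_sum[where b=3]) (use q0 q3 in auto)
  also have "27 * B * d n * (\<Sum>l<k. wsum (q l)) \<le> 27 * B * d n * (\<Sum>l<k. 4 * Y n l)"
    using wq B_nonneg d_pos[of n] by (intro mult_left_mono sum_mono) auto
  finally show ?thesis by (simp add: sum_distrib_left[symmetric] mult_ac)
qed

lemma a_null: "unif_null K (\<lambda>n k. wsum (\<lambda>i. (a n k i)\<^sup>2))"
  and a_bounded: "\<exists>b>0. \<forall>\<^sub>F n in sequentially. \<forall>k\<le>K n. \<forall>i. 0 \<le> a n k i \<and> a n k i \<le> b \<and> (a n k i)\<^sup>2 \<le> b\<^sup>2"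
proof -
  let ?b = "2 + 3 * B + 4 * Lip * B"
  have b1: "0 \<le> a n k i \<and> a n k i \<le> ?b" if n: "regular n" and k: "k \<le> K n" for n k i
  proof (cases "i = 0")
    case True then show ?thesis using B_nonneg Lip_nonneg by (simp add: a_def)
  next
    case False
    have xb: "0 \<le> x n l j" "x n l j \<le> 1" if "l \<le> K n" for l j using n that by (auto simp: regular_def)
    have "\<bar>\<Sum>l<k. (if i = 1 then lam * d n else 0) + random_gain i (x n l) * (lam * d n * D n l) - d n * (x n l i - x n l (i + 1))\<bar>
       \<le> (\<Sum>l<k. 3 * d n)"
    proof (rule order_trans[OF sum_abs], rule sum_mono)
      fix l assume "l \<in> {..<k}"
      then have l: "l \<le> K n" using k by simp
      have ld: "0 \<le> lam * d n" "lam * d n \<le> d n" using lam d_pos[of n] by (auto simp: mult_le_cancel_right1)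
      have "\<bar>random_gain i (x n l) * (lam * d n * D n l)\<bar> \<le> 1 * (d n)"
        unfolding abs_mult
      proof (rule mult_mono)
        show "\<bar>random_gain i (x n l)\<bar> \<le> 1" using xb[OF l, of i] xb[OF l, of "i - 1"] by (auto simp: random_gain_def)
        show "\<bar>lam\<bar> * \<bar>d n\<bar> * \<bar>D n l\<bar> \<le> d n"
          using ld D_bounds[of n l] mult_mono[of "lam * d n" "d n" "D n l" 1] lam d_pos[of n] by simp
      qed auto
      moreover have "\<bar>d n * (x n l i - x n l (i + 1))\<bar> \<le> d n * 1"
        unfolding abs_mult using xb[OF l, of i] xb[OF l, of "i + 1"] d_pos[of n] by (intro mult_mono) auto
      moreover have "\<bar>if i = 1 then lam * d n else 0\<bar> \<le> d n" using ld d_pos[of n] by auto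
      ultimately show "\<bar>(if i = 1 then lam * d n else 0) + random_gain i (x n l) * (lam * d n * D n l) - d n * (x n l i - x n l (i + 1))\<bar> \<le> 3 * d n"
        by linarith
    qed
    also have "\<dots> \<le> 3 * B" using dk_le[OF k] by (simp add: mult_ac)
    finally have "\<bar>err n k i\<bar> \<le> 1 + 3 * B"
      using xb[OF k, of i] xb[of 0 i] unfolding err_def by linarith
    moreover have "\<bar>x n 0 i - s0 i\<bar> \<le> 1" using xb[of 0 i] s_bounds(1,2)[of 0 i] s_0 by (auto simp: abs_le_iff)
    moreover have "4 * Lip * B * d n \<le> 4 * Lip * B * 1"
      using n B_nonneg Lip_nonneg by (intro mult_left_mono) (auto simp: regular_def)
    moreover have "0 \<le> 4 * Lip * B * d n" using B_nonneg Lip_nonneg d_pos[of n] by simp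
    ultimately show ?thesis using False by (simp add: a_def)
  qed
  have sq: "(a n k i)\<^sup>2 \<le> ?b\<^sup>2" if "regular n" "k \<le> K n" for n k i
    using b1[OF that] by (intro power_mono) auto
  have ev: "\<forall>\<^sub>F n in sequentially. \<forall>k\<le>K n. \<forall>i. 0 \<le> a n k i \<and> a n k i \<le> ?b \<and> (a n k i)\<^sup>2 \<le> ?b\<^sup>2"
    using eventually_regular by eventually_elim (use b1 sq in blast)
  have b0: "0 < ?b" using mult_nonneg_nonneg[OF Lip_nonneg B_nonneg] B_nonneg by linarith
  then show "\<exists>b>0. \<forall>\<^sub>F n in sequentially. \<forall>k\<le>K n. \<forall>i. 0 \<le> a n k i \<and> a n k i \<le> b \<and> (a n k i)\<^sup>2 \<le> b\<^sup>2"
    using ev by blast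
  have an: "unif_null K (\<lambda>n k. a n k i)" for i
  proof (cases "i = 0")
    case True
    then show ?thesis unfolding a_def using unif_null_const[of "\<lambda>_. 0" K] by simp
  next
    case False
    have "(\<lambda>n. \<bar>x n 0 i - s0 i\<bar>) \<longlonglongrightarrow> 0"
      using start[of i] by (auto intro!: tendsto_eq_intros)
    moreover have "(\<lambda>n. 4 * Lip * B * d n) \<longlonglongrightarrow> 0" using tendsto_mult_left[OF d_null, of "4 * Lip * B"] by simp
    moreover have "unif_null K (\<lambda>n k. err n k i)" using evolution[of i] False by (simp add: err_def)
    ultimately have "unif_null K (\<lambda>n k. \<bar>x n 0 i - s0 i\<bar> + \<bar>err n k i\<bar> + 4 * Lip * B * d n)"
      by (intro unif_null_add unif_null_abs unif_null_const)
    then show ?thesis using False by (simp add: a_def)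
  qed
  have "unif_null K (\<lambda>n k. (a n k i)\<^sup>2)" for i
  proof (rule unif_null_mono[OF unif_null_cmult[OF an[of i], of ?b]])
    show "\<forall>\<^sub>F n in sequentially. \<forall>k\<le>K n. \<bar>(a n k i)\<^sup>2\<bar> \<le> \<bar>?b * a n k i\<bar>"
      using eventually_regular
    proof eventually_elim
      case (elim n)
      show ?case
      proof (intro allI impI)
        fix k assume "k \<le> K n"
        then have "0 \<le> a n k i" "a n k i \<le> ?b" using b1[OF elim, of k i] by auto
        then show "\<bar>(a n k i)\<^sup>2\<bar> \<le> \<bar>?b * a n k i\<bar>"
          by (simp add: power2_eq_square abs_mult mult_right_mono)
      qed
    qed
  qed
  then show "unif_null K (\<lambda>n k. wsum (\<lambda>i. (a n k i)\<^sup>2))"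
    using ev b0 by (intro unif_null_wsum[where b="?b\<^sup>2"]) (auto elim!: eventually_mono)
qed

text \<open>The hypothesis is the only place where the regime enters.\<close>

theorem Y_null:
  assumes key: "0 \<le> C" "\<And>\<epsilon>. 0 < \<epsilon> \<Longrightarrow> \<forall>\<^sub>F n in sequentially. \<forall>k\<le>K n. (Lg n k - lg n k)\<^sup>2 \<le> \<epsilon> + C * (d n * (\<Sum>l<k. Y n l))"
  shows "unif_null K Y"
  unfolding unif_null_def
proof (intro allI impI)
  fix \<epsilon>' :: real assume \<epsilon>': "0 < \<epsilon>'"
  define G where "G = 6 * (1 + 2 * Lip * B)\<^sup>2"
  define C' where "C' = G * C + 108 * B"
  have G: "0 \<le> G" by (simp add: G_def)
  have C': "0 \<le> C'" using G key(1) B_nonneg by (simp add: C'_def)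
  define \<epsilon> where "\<epsilon> = \<epsilon>' / (exp (C' * B) * (3 + G))"
  have \<epsilon>: "0 < \<epsilon>" using \<epsilon>' G by (simp add: \<epsilon>_def)
  obtain b where "\<forall>\<^sub>F n in sequentially. \<forall>k\<le>K n. \<forall>i. 0 \<le> a n k i \<and> a n k i \<le> b \<and> (a n k i)\<^sup>2 \<le> b\<^sup>2"
    using a_bounded by blast
  with unif_nullD[OF a_null \<epsilon>] key(2)[OF \<epsilon>] eventually_regular
  show "\<forall>\<^sub>F n in sequentially. \<forall>k\<le>K n. \<bar>Y n k\<bar> \<le> \<epsilon>'"
  proof eventually_elim
    case (elim n)
    note n = elim(3)
    have rec: "Y n k \<le> (3 + G) * \<epsilon> + (C' * d n) * (\<Sum>l<k. Y n l)" if k: "k \<le> K n" for k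
    proof -
      \<comment> \<open>A bound on all earlier differences of the integrals, since the right-hand side grows with \<open>k\<close>.\<close>
      define m where "m = sqrt (\<epsilon> + C * (d n * (\<Sum>l<k. Y n l)))"
      have Yn: "0 \<le> Y n l" if "l < k" for l using Y_nonneg[OF n, of l] k that by simp
      have s0: "0 \<le> (\<Sum>l<k. Y n l)" using Yn by (intro sum_nonneg) auto
      have m2: "m\<^sup>2 = \<epsilon> + C * (d n * (\<Sum>l<k. Y n l))"
        unfolding m_def using \<epsilon> key(1) d_pos[of n] s0 by (intro real_sqrt_pow2) simp
      have "\<bar>Lg n j - lg n j\<bar> \<le> m" if j: "j \<le> k" for j
      proof -
        have "(\<Sum>l<j. Y n l) \<le> (\<Sum>l<k. Y n l)" using j Yn by (intro sum_mono2) auto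
        then have "C * (d n * (\<Sum>l<j. Y n l)) \<le> C * (d n * (\<Sum>l<k. Y n l))"
          using key(1) d_pos[of n] by (intro mult_left_mono) auto
        then have "(Lg n j - lg n j)\<^sup>2 \<le> \<epsilon> + C * (d n * (\<Sum>l<k. Y n l))"
          using elim(2) j k by (meson add_left_mono order_trans)
        then show ?thesis unfolding m_def by (rule real_le_rsqrt[of "\<bar>_\<bar>", simplified])
      qed
      from Y_recursion[OF n k this] elim(4) k
      have "Y n k \<le> 3 * wsum (\<lambda>i. (a n k i)\<^sup>2) + 6 * ((1 + 2 * Lip * B) * m)\<^sup>2 + 108 * B * (d n * (\<Sum>l<k. Y n l))" by blast
      also have "6 * ((1 + 2 * Lip * B) * m)\<^sup>2 = G * (\<epsilon> + C * (d n * (\<Sum>l<k. Y n l)))"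
        by (simp add: G_def power_mult_distrib m2)
      finally show ?thesis using elim(1) k by (fastforce simp: C'_def algebra_simps)
    qed
    show ?case
    proof (intro allI impI)
      fix k assume k: "k \<le> K n"
      have "Y n k \<le> (3 + G) * \<epsilon> * exp (C' * d n * real k)"
        by (rule discrete_gronwall[where K="K n" and y="Y n"]) (use rec k C' G \<epsilon> d_pos[of n] in auto)
      also have "\<dots> \<le> (3 + G) * \<epsilon> * exp (C' * B)"
        using dk_le[OF k] C' G \<epsilon> by (intro mult_left_mono) (auto simp: mult.assoc intro!: mult_left_mono)
      also have "\<dots> = \<epsilon>'" using G by (simp add: \<epsilon>_def)
      finally show "\<bar>Y n k\<bar> \<le> \<epsilon>'" using Y_nonneg[OF n k] by simp
    qed
  qed
qed

end

section \<open>Averaging of the token process\<close>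

text \<open>Bounded Lipschitz functions on the unit interval; they serve as test functions of the slow variable.\<close>

definition nice :: "(real \<Rightarrow> real) \<Rightarrow> bool" where
  "nice \<phi> \<longleftrightarrow> (\<exists>C\<ge>0. (\<forall>v\<in>{0..1}. \<bar>\<phi> v\<bar> \<le> C) \<and> (\<forall>v\<in>{0..1}. \<forall>w\<in>{0..1}. \<bar>\<phi> v - \<phi> w\<bar> \<le> C * \<bar>v - w\<bar>))"

lemma niceI:
  assumes "0 \<le> C" "\<And>v. v \<in> {0..1} \<Longrightarrow> \<bar>\<phi> v\<bar> \<le> C"
    "\<And>v w. v \<in> {0..1} \<Longrightarrow> w \<in> {0..1} \<Longrightarrow> \<bar>\<phi> v - \<phi> w\<bar> \<le> C * \<bar>v - w\<bar>"
  shows "nice \<phi>"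
  unfolding nice_def using assms by blast

lemma nice_const: "nice (\<lambda>_. c)"
  by (rule niceI[of "\<bar>c\<bar>"]) auto

lemma nice_id: "nice (\<lambda>v. v)"
  by (rule niceI[of 1]) auto

lemma nice_add: assumes "nice f" "nice g" shows "nice (\<lambda>v. f v + g v)"
proof -
  obtain C where C: "0 \<le> C" "\<forall>v\<in>{0..1}. \<bar>f v\<bar> \<le> C" "\<forall>v\<in>{0..1}. \<forall>w\<in>{0..1}. \<bar>f v - f w\<bar> \<le> C * \<bar>v - w\<bar>"
    using assms(1) unfolding nice_def by blast
  obtain C' where C': "0 \<le> C'" "\<forall>v\<in>{0..1}. \<bar>g v\<bar> \<le> C'" "\<forall>v\<in>{0..1}. \<forall>w\<in>{0..1}. \<bar>g v - g w\<bar> \<le> C' * \<bar>v - w\<bar>"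
    using assms(2) unfolding nice_def by blast
  show ?thesis
  proof (rule niceI[of "C + C'"])
    fix v :: real assume v: "v \<in> {0..1}"
    have "\<bar>f v\<bar> \<le> C" "\<bar>g v\<bar> \<le> C'" using v C C' by auto
    then show "\<bar>f v + g v\<bar> \<le> C + C'" by linarith
    fix w :: real assume w: "w \<in> {0..1}"
    have "\<bar>f v - f w\<bar> \<le> C * \<bar>v - w\<bar>" "\<bar>g v - g w\<bar> \<le> C' * \<bar>v - w\<bar>" using v w C C' by blast+
    then show "\<bar>f v + g v - (f w + g w)\<bar> \<le> (C + C') * \<bar>v - w\<bar>" by (simp only: distrib_right)
  qed (use C C' in auto)
qed

lemma nice_mult: assumes "nice f" "nice g" shows "nice (\<lambda>v. f v * g v)"
proof -
  obtain C where C: "0 \<le> C" "\<forall>v\<in>{0..1}. \<bar>f v\<bar> \<le> C" "\<forall>v\<in>{0..1}. \<forall>w\<in>{0..1}. \<bar>f v - f w\<bar> \<le> C * \<bar>v - w\<bar>"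
    using assms(1) unfolding nice_def by blast
  obtain C' where C': "0 \<le> C'" "\<forall>v\<in>{0..1}. \<bar>g v\<bar> \<le> C'" "\<forall>v\<in>{0..1}. \<forall>w\<in>{0..1}. \<bar>g v - g w\<bar> \<le> C' * \<bar>v - w\<bar>"
    using assms(2) unfolding nice_def by blast
  show ?thesis
  proof (rule niceI[of "2 * (C * C')"])
    fix v :: real assume v: "v \<in> {0..1}"
    have "\<bar>f v * g v\<bar> \<le> C * C'" unfolding abs_mult using v C C' by (intro mult_mono) auto
    then show "\<bar>f v * g v\<bar> \<le> 2 * (C * C')" using C C' mult_nonneg_nonneg[of C C'] by linarith
    fix w :: real assume w: "w \<in> {0..1}"
    have "\<bar>f v * (g v - g w)\<bar> \<le> C * (C' * \<bar>v - w\<bar>)" unfolding abs_mult using v w C C' by (intro mult_mono) auto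
    moreover have "\<bar>(f v - f w) * g w\<bar> \<le> (C * \<bar>v - w\<bar>) * C'" unfolding abs_mult using v w C C' by (intro mult_mono) auto
    moreover have "f v * g v - f w * g w = f v * (g v - g w) + (f v - f w) * g w" by (simp add: algebra_simps)
    moreover have "2 * (C * C') * \<bar>v - w\<bar> = C * (C' * \<bar>v - w\<bar>) + (C * \<bar>v - w\<bar>) * C'" by (simp add: algebra_simps)
    ultimately show "\<bar>f v * g v - f w * g w\<bar> \<le> 2 * (C * C') * \<bar>v - w\<bar>" by linarith
  qed (use C C' in auto)
qed

lemma nice_power: "nice f \<Longrightarrow> nice (\<lambda>v. f v ^ j)"
  by (induction j) (auto intro: nice_const nice_mult)

lemma nice_sum: "finite J \<Longrightarrow> (\<And>j. j \<in> J \<Longrightarrow> nice (f j)) \<Longrightarrow> nice (\<lambda>v. \<Sum>j\<in>J. f j v)"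
  by (induction J rule: finite_induct) (auto intro: nice_const nice_add)

lemma nice_contraction:
  assumes "nice f" and g: "\<And>a b. \<bar>g a - g b\<bar> \<le> \<bar>a - b\<bar>" "\<And>a. \<bar>g a\<bar> \<le> \<bar>a\<bar>"
  shows "nice (\<lambda>v. g (f v))"
  using assms unfolding nice_def by (meson order_trans)

lemma nice_inverse:
  assumes "nice f" and f: "\<And>v. v \<in> {0..1} \<Longrightarrow> 1 \<le> f v"
  shows "nice (\<lambda>v. inverse (f v))"
proof -
  obtain C where C: "0 \<le> C" "\<forall>v\<in>{0..1}. \<forall>w\<in>{0..1}. \<bar>f v - f w\<bar> \<le> C * \<bar>v - w\<bar>"
    using assms(1) unfolding nice_def by blast
  show ?thesis
  proof (rule niceI[of "C + 1"])
    fix v :: real assume v: "v \<in> {0..1}"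
    have "\<bar>inverse (f v)\<bar> \<le> 1" using f[OF v] by (simp add: inverse_le_1_iff)
    then show "\<bar>inverse (f v)\<bar> \<le> C + 1" using C(1) by linarith
    fix w :: real assume w: "w \<in> {0..1}"
    have "\<bar>inverse (f v) - inverse (f w)\<bar> = \<bar>f v - f w\<bar> / (f v * f w)"
      using f[OF v] f[OF w] by (simp add: field_simps abs_divide)
    also have "\<dots> \<le> \<bar>f v - f w\<bar> / 1"
      using f[OF v] f[OF w] mult_mono[of 1 "f v" 1 "f w"] by (intro divide_left_mono) auto
    also have "\<dots> \<le> C * \<bar>v - w\<bar>" using C v w by simp
    finally show "\<bar>inverse (f v) - inverse (f w)\<bar> \<le> (C + 1) * \<bar>v - w\<bar>" by (simp add: distrib_right)
  qed (use C in auto)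
qed

text \<open>The stationary probability of an empty memory with \<open>J - 1\<close> places is close to that with unbounded
  memory, uniformly in the load \<open>r\<close>.\<close>

lemma inverse_geometric_le:
  fixes r :: real
  assumes r: "0 \<le> r" and J: "0 < J"
  shows "inverse (\<Sum>j<J. r ^ j) \<le> max (1 - r) 0 + 1 / real J"
proof -
  define g where "g = (\<Sum>j<J. r ^ j)"
  have "r ^ 0 \<le> g" unfolding g_def using r J by (intro member_le_sum) auto
  then have g: "1 \<le> g" by simp
  show ?thesis
  proof (cases "1 \<le> r")
    case True
    then have "(\<Sum>j<J. 1) \<le> g" unfolding g_def by (intro sum_mono) auto
    then have "inverse g \<le> 1 / real J" using J by (simp add: inverse_eq_divide divide_left_mono)
    then show ?thesis unfolding g_def by simp
  next
    case False
    have "1 - r ^ J = (1 - r) * g" unfolding g_def by (rule one_diff_power_eq)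
    moreover have "real J * r ^ J \<le> g"
    proof -
      have "(\<Sum>j<J. r ^ J) \<le> g" unfolding g_def using False r by (intro sum_mono power_decreasing) auto
      then show ?thesis by simp
    qed
    then have "r ^ J \<le> g / real J" using J by (simp add: field_simps)
    ultimately have "1 \<le> (1 - r) * g + g / real J" by simp
    then have "1 \<le> ((1 - r) + 1 / real J) * g" by (simp add: algebra_simps)
    then have "inverse g \<le> (1 - r) + 1 / real J" using g by (simp add: inverse_eq_divide divide_le_eq)
    then show ?thesis using False unfolding g_def by simp
  qed
qed

context grid_limit
begin

text \<open>Vanishing of all time integrals. Rapidly fluctuating indicators are compared in this sense only.\<close>

definition weak_null :: "(nat \<Rightarrow> nat \<Rightarrow> real) \<Rightarrow> bool" where
  "weak_null f \<longleftrightarrow> unif_null K (\<lambda>n k. d n * (\<Sum>l<k. f n l))"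

text \<open>The path \<open>x\<close> itself jumps; without its defect it is Lipschitz along the grid. Clipping gives the slow
  variable \<open>z\<close>, which stays in the unit interval and close to level \<open>1\<close> of the path.\<close>

definition compensated :: "nat \<Rightarrow> nat \<Rightarrow> real" where "compensated n k = x n k 1 - err n k 1"
definition z :: "nat \<Rightarrow> nat \<Rightarrow> real" where "z n k = max 0 (min 1 (compensated n k))"

lemma err_null: "1 \<le> i \<Longrightarrow> unif_null K (\<lambda>n k. err n k i)"
  using evolution[of i] by (simp add: err_def)

lemma weak_null_cong:
  assumes "weak_null f" "\<forall>\<^sub>F n in sequentially. \<forall>l<K n. f n l = g n l"
  shows "weak_null g"
  unfolding weak_null_def
proof (rule unif_null_mono[OF assms(1)[unfolded weak_null_def]])
  show "\<forall>\<^sub>F n in sequentially. \<forall>k\<le>K n. \<bar>d n * (\<Sum>l<k. g n l)\<bar> \<le> \<bar>d n * (\<Sum>l<k. f n l)\<bar>"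
    using assms(2)
  proof eventually_elim
    case (elim n)
    show ?case
    proof (intro allI impI)
      fix k assume "k \<le> K n"
      then have "(\<Sum>l<k. g n l) = (\<Sum>l<k. f n l)" using elim by (intro sum.cong) auto
      then show "\<bar>d n * (\<Sum>l<k. g n l)\<bar> \<le> \<bar>d n * (\<Sum>l<k. f n l)\<bar>" by simp
    qed
  qed
qed

lemma weak_null_add: "weak_null f \<Longrightarrow> weak_null g \<Longrightarrow> weak_null (\<lambda>n l. f n l + g n l)"
  unfolding weak_null_def sum.distrib distrib_left by (rule unif_null_add)

lemma weak_null_cmult: "weak_null f \<Longrightarrow> weak_null (\<lambda>n l. c * f n l)"
proof -
  assume "weak_null f"
  then have "unif_null K (\<lambda>n k. c * (d n * (\<Sum>l<k. f n l)))" unfolding weak_null_def by (rule unif_null_cmult)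
  then show ?thesis unfolding weak_null_def by (simp add: sum_distrib_left mult_ac)
qed

lemma weak_null_0: "weak_null (\<lambda>n l. 0)"
  unfolding weak_null_def using unif_null_const[of "\<lambda>_. 0" K] by simp

lemma weak_null_sum: "finite J \<Longrightarrow> (\<And>j. j \<in> J \<Longrightarrow> weak_null (f j)) \<Longrightarrow> weak_null (\<lambda>n l. \<Sum>j\<in>J. f j n l)"
  by (induction J rule: finite_induct)
    (auto intro: weak_null_add weak_null_0)

lemma weak_null_strong:
  assumes u: "unif_null K u" and b: "\<And>n l. \<bar>b n l\<bar> \<le> 1"
  shows "weak_null (\<lambda>n l. u n l * b n l)"
  unfolding weak_null_def unif_null_def
proof (intro allI impI)
  fix \<epsilon> :: real assume \<epsilon>: "0 < \<epsilon>"
  have "0 < \<epsilon> / (B + 1)" using \<epsilon> B_nonneg by simp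
  from unif_nullD[OF u this]
  show "\<forall>\<^sub>F n in sequentially. \<forall>k\<le>K n. \<bar>d n * (\<Sum>l<k. u n l * b n l)\<bar> \<le> \<epsilon>"
  proof eventually_elim
    case (elim n)
    show ?case
    proof (intro allI impI)
      fix k assume k: "k \<le> K n"
      have "\<bar>\<Sum>l<k. u n l * b n l\<bar> \<le> (\<Sum>l<k. \<epsilon> / (B + 1))"
      proof (rule order_trans[OF sum_abs], rule sum_mono)
        fix l assume "l \<in> {..<k}"
        then have "\<bar>u n l\<bar> \<le> \<epsilon> / (B + 1)" using elim k by auto
        then have "\<bar>u n l\<bar> * \<bar>b n l\<bar> \<le> \<epsilon> / (B + 1) * 1"
          using b \<open>0 < \<epsilon> / (B + 1)\<close> by (intro mult_mono) auto
        then show "\<bar>u n l * b n l\<bar> \<le> \<epsilon> / (B + 1)" by (simp add: abs_mult)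
      qed
      then have "d n * \<bar>\<Sum>l<k. u n l * b n l\<bar> \<le> d n * (real k * (\<epsilon> / (B + 1)))"
        using d_pos[of n] by (intro mult_left_mono) auto
      also have "\<dots> = (d n * real k) * (\<epsilon> / (B + 1))" by simp
      also have "\<dots> \<le> (B + 1) * (\<epsilon> / (B + 1))"
        using dk_le[OF k] \<open>0 < \<epsilon> / (B + 1)\<close> by (intro mult_right_mono) auto
      also have "\<dots> = \<epsilon>" using B_nonneg by simp
      finally show "\<bar>d n * (\<Sum>l<k. u n l * b n l)\<bar> \<le> \<epsilon>" using d_pos[of n] by (simp add: abs_mult)
    qed
  qed
qed

lemma z01: "z n k \<in> {0..1}" by (simp add: z_def)

lemma z_close: "regular n \<Longrightarrow> k \<le> K n \<Longrightarrow> \<bar>z n k - x n k 1\<bar> \<le> \<bar>err n k 1\<bar>"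
  unfolding z_def compensated_def regular_def by (smt (verit))

lemma z_null: "unif_null K (\<lambda>n k. z n k - x n k 1)"
  by (rule unif_null_mono[OF err_null[of 1]])
    (use eventually_regular z_close in \<open>auto elim!: eventually_mono\<close>)

lemma compensated_increment: "compensated n (Suc k) - compensated n k = lam * d n - x n k 1 * (lam * d n * D n k) - d n * (x n k 1 - x n k 2)"
  unfolding compensated_def err_def by (simp add: random_gain_def numeral_2_eq_2)

lemma z_increment:
  assumes n: "regular n" and k: "k < K n"
  shows "\<bar>z n (Suc k) - z n k\<bar> \<le> 3 * d n"
proof -
  have xb: "0 \<le> x n k j" "x n k j \<le> 1" for j using n k by (auto simp: regular_def)
  have ld: "0 \<le> lam * d n" "lam * d n \<le> d n" using lam d_pos[of n] by (auto simp: mult_le_cancel_right1)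
  have LD: "0 \<le> lam * d n * D n k" "lam * d n * D n k \<le> d n"
    using ld D_bounds[of n k] mult_mono[of "lam * d n" "d n" "D n k" 1] d_pos[of n] by auto
  have "0 \<le> x n k 1 * (lam * d n * D n k)" "x n k 1 * (lam * d n * D n k) \<le> d n"
    using LD xb[of 1] mult_mono[of "x n k 1" 1 "lam * d n * D n k" "d n"] by auto
  moreover have "\<bar>d n * (x n k 1 - x n k 2)\<bar> \<le> d n * 1"
    unfolding abs_mult using xb[of 1] xb[of 2] d_pos[of n] by (intro mult_mono) auto
  ultimately have "\<bar>compensated n (Suc k) - compensated n k\<bar> \<le> 3 * d n"
    unfolding compensated_increment using ld by linarith
  then show ?thesis unfolding z_def by linarith
qed

text \<open>Multiplying by a Lipschitz function of the slow variable preserves the vanishing of integrals, by summation by parts.\<close>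

lemma weak_null_test:
  assumes f: "weak_null f" and \<phi>: "nice \<phi>"
  shows "weak_null (\<lambda>n l. \<phi> (z n l) * f n l)"
proof -
  obtain C where C: "0 \<le> C" "\<forall>v\<in>{0..1}. \<bar>\<phi> v\<bar> \<le> C" "\<forall>v\<in>{0..1}. \<forall>w\<in>{0..1}. \<bar>\<phi> v - \<phi> w\<bar> \<le> C * \<bar>v - w\<bar>"
    using \<phi> unfolding nice_def by blast
  show ?thesis unfolding weak_null_def unif_null_def
  proof (intro allI impI)
    fix \<epsilon> :: real assume \<epsilon>: "0 < \<epsilon>"
    define m where "m = \<epsilon> / (C + 3 * C * B + 1)"
    have pos: "0 < C + 3 * C * B + 1" using C(1) B_nonneg by (simp add: add_nonneg_pos)
    then have m: "0 < m" using \<epsilon> by (simp add: m_def)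
    from unif_nullD[OF f[unfolded weak_null_def] m] eventually_regular
    show "\<forall>\<^sub>F n in sequentially. \<forall>k\<le>K n. \<bar>d n * (\<Sum>l<k. \<phi> (z n l) * f n l)\<bar> \<le> \<epsilon>"
    proof eventually_elim
      case (elim n)
      show ?case
      proof (intro allI impI)
        fix k assume k: "k \<le> K n"
        have "\<bar>\<Sum>l<k. \<phi> (z n l) * (d n * (\<Sum>j<Suc l. f n j) - d n * (\<Sum>j<l. f n j))\<bar> \<le> (C + real k * (3 * C * d n)) * m"
        proof (rule abel_sum_bound[where z="\<lambda>l. d n * (\<Sum>j<l. f n j)" and g="\<lambda>l. \<phi> (z n l)"])
          fix l assume "l < k"
          then have "\<bar>\<phi> (z n (Suc l)) - \<phi> (z n l)\<bar> \<le> C * \<bar>z n (Suc l) - z n l\<bar>" using C(3) z01 by blast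
          also have "\<dots> \<le> C * (3 * d n)" using z_increment[OF elim(2), of l] \<open>l < k\<close> k C(1) by (intro mult_left_mono) auto
          finally show "\<bar>\<phi> (z n (Suc l)) - \<phi> (z n l)\<bar> \<le> 3 * C * d n" by simp
        qed (use elim k C(2) z01 in auto)
        moreover have "(\<Sum>l<k. \<phi> (z n l) * (d n * (\<Sum>j<Suc l. f n j) - d n * (\<Sum>j<l. f n j))) = d n * (\<Sum>l<k. \<phi> (z n l) * f n l)"
          unfolding sum_distrib_left by (rule sum.cong) (auto simp: algebra_simps)
        moreover have "(C + real k * (3 * C * d n)) * m \<le> (C + 3 * C * B + 1) * m"
        proof (rule mult_right_mono)
          have "(3 * C) * (d n * real k) \<le> (3 * C) * B" using dk_le[OF k] C(1) by (intro mult_left_mono) auto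
          then show "C + real k * (3 * C * d n) \<le> C + 3 * C * B + 1" by (simp add: mult_ac)
        qed (use m in auto)
        moreover have "(C + 3 * C * B + 1) * m = \<epsilon>" using pos by (simp add: m_def)
        ultimately show "\<bar>d n * (\<Sum>l<k. \<phi> (z n l) * f n l)\<bar> \<le> \<epsilon>" by simp
      qed
    qed
  qed
qed

lemma Y_null_of_key:
  assumes "0 \<le> C1" "0 \<le> C"
    "\<And>\<epsilon>. 0 < \<epsilon> \<Longrightarrow> \<epsilon> \<le> 1 \<Longrightarrow> \<forall>\<^sub>F n in sequentially. \<forall>k\<le>K n. (Lg n k - lg n k)\<^sup>2 \<le> C1 * \<epsilon> + C * (d n * (\<Sum>l<k. Y n l))"
  shows "unif_null K Y"
proof (rule Y_null[OF assms(2)])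
  fix \<epsilon> :: real assume \<epsilon>: "0 < \<epsilon>"
  define \<epsilon>' where "\<epsilon>' = min 1 (\<epsilon> / (C1 + 1))"
  have \<epsilon>': "0 < \<epsilon>'" "\<epsilon>' \<le> 1" using \<epsilon> assms(1) by (auto simp: \<epsilon>'_def)
  have "C1 * \<epsilon>' \<le> (C1 + 1) * (\<epsilon> / (C1 + 1))"
    using assms(1) \<epsilon> by (intro mult_mono) (auto simp: \<epsilon>'_def)
  then have le: "C1 * \<epsilon>' \<le> \<epsilon>" using assms(1) by simp
  show "\<forall>\<^sub>F n in sequentially. \<forall>k\<le>K n. (Lg n k - lg n k)\<^sup>2 \<le> \<epsilon> + C * (d n * (\<Sum>l<k. Y n l))"
    using assms(3)[OF \<epsilon>'] by eventually_elim (use le in \<open>meson add_right_mono order_trans\<close>)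
qed

lemma sum_e2_le:
  assumes n: "regular n" and k: "k \<le> K n"
  shows "d n * (\<Sum>l<k. (e n l i)\<^sup>2) \<le> 2 ^ i * (d n * (\<Sum>l<k. Y n l))"
proof -
  have "(\<Sum>l<k. (e n l i)\<^sup>2) \<le> (\<Sum>l<k. 2 ^ i * Y n l)"
    using k by (intro sum_mono e2_le_Y[OF n]) auto
  then have "d n * (\<Sum>l<k. (e n l i)\<^sup>2) \<le> d n * (\<Sum>l<k. 2 ^ i * Y n l)" using d_pos[of n] by (intro mult_left_mono) auto
  then show ?thesis by (simp add: sum_distrib_left[symmetric] mult_ac)
qed

text \<open>Where \<open>P0\<close> is a Lipschitz function of level \<open>1\<close>, it suffices that \<open>D\<close> averages to it along the path.\<close>

lemma Y_null_averaging:
  assumes dep: "\<And>y. P0 lam R y = \<phi> (y 1)" and \<phi>: "nice \<phi>"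
    and av: "weak_null (\<lambda>n l. D n l - \<phi> (z n l))"
  shows "unif_null K Y"
proof -
  obtain C where C: "0 \<le> C" "\<forall>v\<in>{0..1}. \<forall>w\<in>{0..1}. \<bar>\<phi> v - \<phi> w\<bar> \<le> C * \<bar>v - w\<bar>"
    using \<phi> unfolding nice_def by blast
  define \<eta> where "\<eta> n k = \<bar>d n * (\<Sum>l<k. D n l - \<phi> (z n l))\<bar> + C * \<bar>d n * (\<Sum>l<k. \<bar>z n l - x n l 1\<bar> * 1)\<bar> + C * Lip * B * d n" for n k
  have "unif_null K \<eta>" unfolding \<eta>_def
  proof (intro unif_null_add unif_null_abs unif_null_cmult)
    show "unif_null K (\<lambda>n k. d n * (\<Sum>l<k. D n l - \<phi> (z n l)))" using av by (simp add: weak_null_def)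
    show "unif_null K (\<lambda>n k. d n * (\<Sum>l<k. \<bar>z n l - x n l 1\<bar> * 1))"
      using weak_null_strong[OF unif_null_abs[OF z_null], of "\<lambda>_ _. 1"] by (simp add: weak_null_def)
    show "unif_null K (\<lambda>n k. d n)" by (rule unif_null_const[OF d_null])
  qed
  show ?thesis
  proof (rule Y_null_of_key[of 2 "4 * C\<^sup>2 * B"])
    fix \<epsilon> :: real assume \<epsilon>: "0 < \<epsilon>" "\<epsilon> \<le> 1"
    from unif_nullD[OF \<open>unif_null K \<eta>\<close> \<epsilon>(1)] eventually_regular
    show "\<forall>\<^sub>F n in sequentially. \<forall>k\<le>K n. (Lg n k - lg n k)\<^sup>2 \<le> 2 * \<epsilon> + 4 * C\<^sup>2 * B * (d n * (\<Sum>l<k. Y n l))"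
    proof eventually_elim
      case (elim n)
      note n = elim(2)
      show ?case
      proof (intro allI impI)
        fix k assume k: "k \<le> K n"
        let ?s = "\<lambda>l. s (d n * real l) 1"
        have s01: "?s l \<in> {0..1}" for l using s_bounds(1,2)[OF t_nonneg] by simp
        have lgk: "(\<Sum>l<k. lg n (Suc l) - lg n l) = lg n k" for k
          by (induction k) (auto simp: lg_def ell_0)
        have "\<bar>\<Sum>l<k. lg n (Suc l) - lg n l - lam * d n * \<phi> (?s l)\<bar> \<le> (\<Sum>l<k. C * Lip * (d n)\<^sup>2)"
        proof (rule order_trans[OF sum_abs], rule sum_mono)
          fix l
          have "\<bar>p u - p v\<bar> \<le> C * \<bar>s u 1 - s v 1\<bar>" if "0 \<le> u" "0 \<le> v" for u v
          proof -
            have "s u 1 \<in> {0..1}" "s v 1 \<in> {0..1}" using s_bounds that by auto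
            then show ?thesis unfolding dep using C(2) by blast
          qed
          from ell_increment_lipschitz[OF this C(1) t_nonneg t_mono, of n l]
          show "\<bar>lg n (Suc l) - lg n l - lam * d n * \<phi> (?s l)\<bar> \<le> C * Lip * (d n)\<^sup>2"
            unfolding lg_def t_Suc dep .
        qed
        also have "\<dots> = (d n * real k) * (C * Lip * d n)" by (simp add: power2_eq_square)
        also have "\<dots> \<le> B * (C * Lip * d n)"
          using dk_le[OF k] C(1) Lip_nonneg d_pos[of n] by (intro mult_right_mono) auto
        finally have 3: "\<bar>\<Sum>l<k. lg n (Suc l) - lg n l - lam * d n * \<phi> (?s l)\<bar> \<le> C * Lip * B * d n" by (simp add: mult_ac)
        have "\<bar>\<Sum>l<k. \<phi> (z n l) - \<phi> (?s l)\<bar> \<le> (\<Sum>l<k. C * (\<bar>z n l - x n l 1\<bar> + \<bar>e n l 1\<bar>))"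
        proof (rule order_trans[OF sum_abs], rule sum_mono)
          fix l
          have "\<bar>\<phi> (z n l) - \<phi> (?s l)\<bar> \<le> C * \<bar>z n l - ?s l\<bar>" using C(2) z01 s01 by blast
          also have "\<dots> \<le> C * (\<bar>z n l - x n l 1\<bar> + \<bar>e n l 1\<bar>)"
            using C(1) by (intro mult_left_mono) (auto simp: e_def)
          finally show "\<bar>\<phi> (z n l) - \<phi> (?s l)\<bar> \<le> C * (\<bar>z n l - x n l 1\<bar> + \<bar>e n l 1\<bar>)" .
        qed
        then have "d n * \<bar>\<Sum>l<k. \<phi> (z n l) - \<phi> (?s l)\<bar> \<le> d n * (\<Sum>l<k. C * (\<bar>z n l - x n l 1\<bar> + \<bar>e n l 1\<bar>))"
          using d_pos[of n] by (intro mult_left_mono) auto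
        also have "\<dots> = C * (d n * (\<Sum>l<k. \<bar>z n l - x n l 1\<bar> * 1)) + C * (d n * (\<Sum>l<k. \<bar>e n l 1\<bar>))"
          by (simp only: sum_distrib_left[symmetric] sum.distrib) (simp add: algebra_simps)
        finally have 2: "\<bar>d n * (\<Sum>l<k. \<phi> (z n l) - \<phi> (?s l))\<bar> \<le> C * \<bar>d n * (\<Sum>l<k. \<bar>z n l - x n l 1\<bar> * 1)\<bar> + C * (d n * (\<Sum>l<k. \<bar>e n l 1\<bar>))"
          using d_pos[of n] by (simp add: abs_mult sum_nonneg)
        have "Lg n k - (\<Sum>l<k. lg n (Suc l) - lg n l) = lam * (d n * (\<Sum>l<k. D n l - \<phi> (z n l))) + lam * (d n * (\<Sum>l<k. \<phi> (z n l) - \<phi> (?s l)))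
           - (\<Sum>l<k. lg n (Suc l) - lg n l - lam * d n * \<phi> (?s l))"
        proof -
          define A1 A2 A3 where "A1 = (\<Sum>l<k. D n l)" and "A2 = (\<Sum>l<k. \<phi> (z n l))" and "A3 = (\<Sum>l<k. \<phi> (?s l))"
          have "Lg n k = lam * d n * A1" unfolding Lg_def A1_def by (rule sum_distrib_left[symmetric])
          moreover have "(\<Sum>l<k. D n l - \<phi> (z n l)) = A1 - A2" "(\<Sum>l<k. \<phi> (z n l) - \<phi> (?s l)) = A2 - A3"
            unfolding A1_def A2_def A3_def by (rule sum_subtractf)+
          moreover have "(\<Sum>l<k. lg n (Suc l) - lg n l - lam * d n * \<phi> (?s l)) = (\<Sum>l<k. lg n (Suc l) - lg n l) - lam * d n * A3"
            unfolding A3_def sum_distrib_left by (rule sum_subtractf)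
          ultimately show ?thesis by (simp only: right_diff_distrib mult.assoc)
        qed
        then have "Lg n k - lg n k = lam * (d n * (\<Sum>l<k. D n l - \<phi> (z n l))) + lam * (d n * (\<Sum>l<k. \<phi> (z n l) - \<phi> (?s l)))
           - (\<Sum>l<k. lg n (Suc l) - lg n l - lam * d n * \<phi> (?s l))" by (simp only: lgk)
        moreover have lam_le: "\<bar>lam * y\<bar> \<le> \<bar>y\<bar>" for y using lam by (simp add: abs_mult mult_left_le_one_le)
        moreover have "\<bar>p1 + p2 - p3\<bar> \<le> \<bar>p1\<bar> + \<bar>p2\<bar> + \<bar>p3\<bar>" for p1 p2 p3 :: real by linarith
        ultimately have "\<bar>Lg n k - lg n k\<bar> \<le> \<bar>lam * (d n * (\<Sum>l<k. D n l - \<phi> (z n l)))\<bar>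
           + \<bar>lam * (d n * (\<Sum>l<k. \<phi> (z n l) - \<phi> (?s l)))\<bar>
           + \<bar>\<Sum>l<k. lg n (Suc l) - lg n l - lam * d n * \<phi> (?s l)\<bar>" by (simp only:)
        also have "\<dots> \<le> \<bar>d n * (\<Sum>l<k. D n l - \<phi> (z n l))\<bar>
           + (C * \<bar>d n * (\<Sum>l<k. \<bar>z n l - x n l 1\<bar> * 1)\<bar> + C * (d n * (\<Sum>l<k. \<bar>e n l 1\<bar>))) + C * Lip * B * d n"
          by (intro add_mono lam_le 3 order_trans[OF lam_le 2])
        also have "\<dots> = \<eta> n k + C * (d n * (\<Sum>l<k. \<bar>e n l 1\<bar>))" by (simp only: \<eta>_def add_ac)
        also have "\<dots> \<le> \<epsilon> + C * (d n * (\<Sum>l<k. \<bar>e n l 1\<bar>))" using elim(1) k by fastforce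
        finally have "\<bar>Lg n k - lg n k\<bar>\<^sup>2 \<le> (\<epsilon> + C * (d n * (\<Sum>l<k. \<bar>e n l 1\<bar>)))\<^sup>2" by (intro power_mono) auto
        also have "\<dots> \<le> 2 * \<epsilon>\<^sup>2 + 2 * (C * (d n * (\<Sum>l<k. \<bar>e n l 1\<bar>)))\<^sup>2"
          using zero_le_power2[of "\<epsilon> - C * (d n * (\<Sum>l<k. \<bar>e n l 1\<bar>))"] by (simp add: power2_eq_square algebra_simps)
        also have "\<epsilon>\<^sup>2 \<le> \<epsilon>" using \<epsilon> by (simp add: power2_eq_square mult_left_le)
        also have "(C * (d n * (\<Sum>l<k. \<bar>e n l 1\<bar>)))\<^sup>2 \<le> C\<^sup>2 * (B * (d n * (\<Sum>l<k. (e n l 1)\<^sup>2)))"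
          unfolding power_mult_distrib[of C] using sum_square_le[OF k, of "\<lambda>l. \<bar>e n l 1\<bar>"] by (intro mult_left_mono) auto
        also have "\<dots> \<le> C\<^sup>2 * (B * (2 ^ 1 * (d n * (\<Sum>l<k. Y n l))))"
          using sum_e2_le[OF n k, of 1] B_nonneg by (intro mult_left_mono) auto
        finally show "(Lg n k - lg n k)\<^sup>2 \<le> 2 * \<epsilon> + 4 * C\<^sup>2 * B * (d n * (\<Sum>l<k. Y n l))" by (simp add: mult_ac)
      qed
    qed
  qed (use B_nonneg in auto)
qed

end

context grid_limit
begin

lemma nice_ratio: "nice (\<lambda>v. b * (1 - v) / c)"
proof -
  have "nice (\<lambda>v. b / c + (- b / c) * v)" by (intro nice_add nice_mult nice_const nice_id)
  then show ?thesis by (simp add: right_diff_distrib diff_divide_distrib mult.commute)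
qed

lemma weak_null_replace:
  assumes "weak_null (\<lambda>n l. b * (1 - x n l 1) * I n l - f n l)" "\<And>n l. \<bar>I n l\<bar> \<le> 1"
  shows "weak_null (\<lambda>n l. b * (1 - z n l) * I n l - f n l)"
proof -
  have "weak_null (\<lambda>n l. b * ((z n l - x n l 1) * I n l))"
    using assms(2) by (intro weak_null_cmult weak_null_strong[OF z_null])
  from weak_null_add[OF assms(1) weak_null_cmult[OF this, of "-1"]]
  show ?thesis by (simp add: algebra_simps)
qed

text \<open>The balance between level \<open>j\<close> and level \<open>j + 1\<close>, multiplied by powers of the slow load, identifies
  the occupation of level \<open>j\<close> with a geometric multiple of that of level \<open>0\<close>.\<close>

lemma geometric_occupation:
  assumes b: "0 < b" and I0: "\<And>n l. I 0 n l = D n l" and I01: "\<And>j n l. \<bar>I j n l\<bar> \<le> 1"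
    and bal: "\<And>j. j < J \<Longrightarrow> weak_null (\<lambda>n l. b * (1 - x n l 1) * I j n l - lam * I (Suc j) n l)"
  shows "j \<le> J \<Longrightarrow> weak_null (\<lambda>n l. (b * (1 - z n l) / lam) ^ j * D n l - I j n l)"
proof (induction j)
  case 0
  then show ?case using weak_null_0 by (simp add: I0)
next
  case (Suc j)
  let ?r = "\<lambda>v. b * (1 - v) / lam"
  have nr: "nice ?r" by (rule nice_ratio)
  have "weak_null (\<lambda>n l. (1 / lam) * (b * (1 - z n l) * I j n l - lam * I (Suc j) n l))"
    using Suc bal I01 by (intro weak_null_cmult weak_null_replace) auto
  moreover have "weak_null (\<lambda>n l. ?r (z n l) * (?r (z n l) ^ j * D n l - I j n l))"
    using Suc nr by (intro weak_null_test) auto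
  ultimately have "weak_null (\<lambda>n l. ?r (z n l) * (?r (z n l) ^ j * D n l - I j n l)
      + (1 / lam) * (b * (1 - z n l) * I j n l - lam * I (Suc j) n l))"
    by (intro weak_null_add)
  moreover have "?r v * (?r v ^ j * p - i) + (1 / lam) * (b * (1 - v) * i - lam * i') = ?r v ^ Suc j * p - i'" for v p i i'
  proof -
    have "(1 / lam) * (b * (1 - v) * i - lam * i') = ?r v * i - i'"
      using lam by (simp add: diff_divide_distrib)
    moreover have "r * (r ^ j * p - i) + (r * i - i') = r ^ Suc j * p - i'" for r :: real
      by (simp add: right_diff_distrib)
    ultimately show ?thesis by (simp only:)
  qed
  ultimately show ?case by simp
qed

theorem Y_null_Constrained:
  assumes R: "R = Constrained c b" and I0: "\<And>n l. I 0 n l = D n l" and I01: "\<And>j n l. \<bar>I j n l\<bar> \<le> 1"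
    and bal: "\<And>j. j < c \<Longrightarrow> weak_null (\<lambda>n l. b * (1 - x n l 1) * I j n l - lam * I (Suc j) n l)"
    and total: "\<forall>\<^sub>F n in sequentially. \<forall>l<K n. (\<Sum>j\<le>c. I j n l) = 1"
  shows "unif_null K Y"
proof -
  have b: "0 < b" using fluid_axioms R by (simp add: fluid_def proper_regime_def)
  let ?r = "\<lambda>v. b * (1 - v) / lam" and ?G = "\<lambda>v. \<Sum>j=0..c. (b * (1 - v) / lam) ^ j"
  let ?H = "\<lambda>n l. \<Sum>j\<in>{0..c}. (?r (z n l)) ^ j * D n l - I j n l"
  have nr: "nice ?r" by (rule nice_ratio)
  have G1: "1 \<le> ?G v" if "v \<in> {0..1}" for v
    using that b lam by (intro geometric_ge_1) auto
  have nG: "nice (\<lambda>v. inverse (?G v))"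
    by (rule nice_inverse[OF nice_sum]) (use G1 nr in \<open>auto intro: nice_power\<close>)
  show ?thesis
  proof (rule Y_null_averaging[where \<phi>="\<lambda>v. inverse (?G v)"])
    show "P0 lam R y = inverse (?G (y 1))" for y unfolding R by simp
    have "weak_null ?H"
      by (intro weak_null_sum geometric_occupation[OF b I0 I01 bal]) auto
    then have "weak_null (\<lambda>n l. inverse (?G (z n l)) * ?H n l)"
      by (rule weak_null_test[OF _ nG])
    then show "weak_null (\<lambda>n l. D n l - inverse (?G (z n l)))"
    proof (rule weak_null_cong)
      show "\<forall>\<^sub>F n in sequentially. \<forall>l<K n. inverse (?G (z n l)) * ?H n l = D n l - inverse (?G (z n l))"
        using total
      proof eventually_elim
        case (elim n)
        show ?case
        proof (intro allI impI)
          fix l assume "l < K n"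
          then have "(\<Sum>j\<in>{0..c}. I j n l) = 1" using elim by (simp add: atMost_atLeast0)
          then have "?H n l = ?G (z n l) * D n l - 1"
            by (simp add: sum_subtractf sum_distrib_right)
          moreover have "?G (z n l) \<noteq> 0" using G1[OF z01[of n l]] by linarith
          ultimately show "inverse (?G (z n l)) * ?H n l = D n l - inverse (?G (z n l))"
            by (simp only: right_diff_distrib mult.assoc[symmetric]) simp
        qed
      qed
    qed
  qed (rule nG)
qed

text \<open>Here \<open>E\<close> is the indicator that the memory is not full. The lower bound for \<open>D\<close> from the token balance only
  matters where the load is below one, and is therefore tested against a cutoff \<open>?\<chi>\<close> to this region.\<close>

theorem Y_null_High_Memory:
  assumes R: "R = High_Memory b" and I0: "\<And>n l. I 0 n l = D n l" and I01: "\<And>j n l. \<bar>I j n l\<bar> \<le> 1"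
    and bal: "\<And>j. weak_null (\<lambda>n l. b * (1 - x n l 1) * I j n l - lam * I (Suc j) n l)"
    and total: "\<And>J n l. (\<Sum>j<J. I j n l) \<le> 1"
    and tokens: "weak_null (\<lambda>n l. b * (1 - x n l 1) * E n l - lam * (1 - D n l))" and E: "\<And>n l. 0 \<le> E n l \<and> E n l \<le> 1"
  shows "unif_null K Y"
proof -
  have b: "0 < b" using fluid_axioms R by (simp add: fluid_def proper_regime_def)
  let ?r = "\<lambda>v. b * (1 - v) / lam"
  have r0: "0 \<le> ?r v" if "v \<in> {0..1}" for v using that b lam by auto
  have nr: "nice ?r" by (rule nice_ratio)
  have n1r: "nice (\<lambda>v. 1 - ?r v)"
    using nice_add[OF nice_const[of 1] nice_mult[OF nice_const[of "-1"] nr]] by simp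
  have nP: "nice (\<lambda>v. max (1 - ?r v) 0)"
    by (rule nice_contraction[OF n1r, of "\<lambda>y. max y 0"]) auto
  let ?P = "\<lambda>v. max (1 - ?r v) 0"
  have upper: "\<forall>\<^sub>F n in sequentially. \<forall>k\<le>K n. d n * (\<Sum>l<k. D n l - ?P (z n l)) \<le> \<epsilon>" if \<epsilon>: "0 < \<epsilon>" for \<epsilon>
  proof -
    \<comment> \<open>So many levels that the error \<open>1 / J\<close> of the stationary probability integrates to at most \<open>\<epsilon> / 2\<close>.\<close>
    obtain J where J: "(B + 1) / (\<epsilon> / 2) < real J" using reals_Archimedean2 by blast
    have B0: "0 \<le> B" by (rule B_nonneg)
    have "0 < (B + 1) / (\<epsilon> / 2)" using \<epsilon> B0 by (intro divide_pos_pos) auto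
    then have J0: "0 < J" using J by (cases J) auto
    let ?G = "\<lambda>v. \<Sum>j<J. (?r v) ^ j"
    let ?H = "\<lambda>n l. inverse (?G (z n l)) * (\<Sum>j<J. (?r (z n l)) ^ j * D n l - I j n l)"
    have G1: "1 \<le> ?G v" if "v \<in> {0..1}" for v
    proof -
      have "?r v ^ 0 \<le> ?G v" using r0[OF that] J0 by (intro member_le_sum[of 0 "{..<J}" "\<lambda>j. ?r v ^ j"]) auto
      then show ?thesis by simp
    qed
    have nG: "nice (\<lambda>v. inverse (?G v))"
      by (rule nice_inverse[OF nice_sum]) (use G1 nr in \<open>auto intro: nice_power\<close>)
    have "weak_null (\<lambda>n l. \<Sum>j<J. (?r (z n l)) ^ j * D n l - I j n l)"
      by (rule weak_null_sum, simp, rule geometric_occupation[OF b I0 I01 bal, where J=J]) simp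
    then have "weak_null (\<lambda>n l. ?H n l)"
      by (rule weak_null_test[OF _ nG])
    from unif_nullD[OF this[unfolded weak_null_def], of "\<epsilon> / 2"] \<epsilon>
    have "\<forall>\<^sub>F n in sequentially. \<forall>k\<le>K n. \<bar>d n * (\<Sum>l<k. ?H n l)\<bar> \<le> \<epsilon> / 2"
      by simp
    then show ?thesis
    proof eventually_elim
      case (elim n)
      show ?case
      proof (intro allI impI)
        fix k assume k: "k \<le> K n"
        have pt: "D n l - ?P (z n l) \<le> ?H n l + 1 / real J" for l
        proof -
          have g: "1 \<le> ?G (z n l)" using G1 z01 by blast
          have "?H n l
            = inverse (?G (z n l)) * (?G (z n l) * D n l - (\<Sum>j<J. I j n l))"
            by (simp add: sum_subtractf sum_distrib_right)
          also have "\<dots> = D n l - inverse (?G (z n l)) * (\<Sum>j<J. I j n l)"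
            using g by (simp only: right_diff_distrib mult.assoc[symmetric]) simp
          also have "\<dots> \<ge> D n l - inverse (?G (z n l)) * 1"
            using g total[where J=J and n=n and l=l] by (intro diff_left_mono mult_left_mono) auto
          finally show ?thesis using inverse_geometric_le[OF r0[OF z01[of n l]] J0] by simp
        qed
        have "(\<Sum>l<k. D n l - ?P (z n l)) \<le> (\<Sum>l<k. ?H n l + 1 / real J)"
          by (intro sum_mono pt)
        then have "d n * (\<Sum>l<k. D n l - ?P (z n l)) \<le> d n * (\<Sum>l<k. ?H n l + 1 / real J)"
          using d_pos[of n] by (intro mult_left_mono) auto
        also have "\<dots> = d n * (\<Sum>l<k. ?H n l) + (d n * real k) * (1 / real J)"
          unfolding sum.distrib by (simp add: distrib_left)
        also have "\<dots> \<le> \<epsilon> / 2 + (B + 1) * (1 / real J)"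
          using elim k dk_le[OF k] J0 by (intro add_mono mult_right_mono) (auto dest: abs_le_D1)
        also have "(B + 1) * (1 / real J) \<le> \<epsilon> / 2" using J \<epsilon> J0 by (simp add: field_simps)
        finally show "d n * (\<Sum>l<k. D n l - ?P (z n l)) \<le> \<epsilon>" by simp
      qed
    qed
  qed
  have lower: "\<forall>\<^sub>F n in sequentially. \<forall>k\<le>K n. - \<epsilon> \<le> d n * (\<Sum>l<k. D n l - ?P (z n l))" if \<epsilon>: "0 < \<epsilon>" for \<epsilon>
  proof -
    \<comment> \<open>The cutoff \<open>?\<chi>\<close> is \<open>1\<close> where \<open>?r \<le> 1 - \<eta>\<close> and \<open>0\<close> where \<open>?r \<ge> 1\<close>; the band in between costs \<open>\<eta>\<close>.\<close>
    define \<eta> where "\<eta> = \<epsilon> / 2 / (B + 1)"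
    have \<eta>: "0 < \<eta>" using \<epsilon> B_nonneg by (simp add: \<eta>_def)
    let ?\<chi> = "\<lambda>v. min 1 (max 0 ((1 - ?r v) / \<eta>))"
    let ?F = "\<lambda>n l. ?\<chi> (z n l) * ((1 / lam) * (b * (1 - z n l) * E n l - lam * (1 - D n l)))"
    have n\<chi>: "nice ?\<chi>"
    proof -
      have "nice (\<lambda>v. (1 - ?r v) / \<eta>)" using nice_mult[OF n1r nice_const[of "1 / \<eta>"]] by simp
      then show ?thesis by (rule nice_contraction[of _ "\<lambda>y. min 1 (max 0 y)"]) auto
    qed
    have "weak_null (\<lambda>n l. (1 / lam) * (b * (1 - z n l) * E n l - lam * (1 - D n l)))"
      using E by (intro weak_null_cmult weak_null_replace tokens) (auto simp: abs_le_iff intro: order_trans[of _ 0])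
    then have "weak_null (\<lambda>n l. ?F n l)"
      by (rule weak_null_test[OF _ n\<chi>])
    from unif_nullD[OF this[unfolded weak_null_def], of "\<epsilon> / 2"] \<epsilon>
    have "\<forall>\<^sub>F n in sequentially. \<forall>k\<le>K n. \<bar>d n * (\<Sum>l<k. ?F n l)\<bar> \<le> \<epsilon> / 2"
      by simp
    then show ?thesis
    proof eventually_elim
      case (elim n)
      show ?case
      proof (intro allI impI)
        fix k assume k: "k \<le> K n"
        have pt: "?F n l - \<eta> \<le> D n l - ?P (z n l)" for l
        proof -
          define c r where "c = ?\<chi> (z n l)" and "r = ?r (z n l)"
          have c: "0 \<le> c" "c \<le> 1" by (auto simp: c_def)
          have r: "0 \<le> r" using r0 z01 by (simp add: r_def)
          have eq: "(1 / lam) * (b * (1 - z n l) * E n l - lam * (1 - D n l)) = r * E n l - 1 + D n l"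
            using lam by (simp add: r_def field_simps)
          have rE: "r * E n l \<le> r" using r E[of n l] by (simp add: mult_left_le)
          have "c * (r * E n l - 1 + D n l) \<le> c * (r - 1) + c * D n l"
            using c rE by (simp add: distrib_left[symmetric] mult_left_mono)
          also have "c * D n l \<le> D n l" using c D_bounds[of n l] by (simp add: mult_left_le_one_le)
          also have "c * (r - 1) \<le> \<eta> - max (1 - r) 0"
          proof (cases "1 - r \<le> \<eta>")
            case True
            have "c * (r - 1) \<le> 0"
            proof (cases "r \<le> 1")
              case False
              then have "(1 - r) / \<eta> \<le> 0" using \<eta> by (simp add: divide_nonpos_pos)
              then have "c = 0" by (simp add: c_def r_def)
              then show ?thesis by simp
            qed (use c in \<open>simp add: mult_nonneg_nonpos\<close>)
            then show ?thesis using True \<eta> by simp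
          next
            case False
            then have "1 \<le> (1 - r) / \<eta>" using \<eta> by simp
            then have "c = 1" by (simp add: c_def r_def)
            then show ?thesis using \<eta> False by simp
          qed
          finally show ?thesis unfolding eq unfolding c_def r_def by simp
        qed
        have "(\<Sum>l<k. ?F n l - \<eta>) \<le> (\<Sum>l<k. D n l - ?P (z n l))"
          by (intro sum_mono pt)
        then have "d n * (\<Sum>l<k. ?F n l - \<eta>) \<le> d n * (\<Sum>l<k. D n l - ?P (z n l))"
          using d_pos[of n] by (intro mult_left_mono) auto
        moreover have "d n * (\<Sum>l<k. ?F n l - \<eta>)
           = d n * (\<Sum>l<k. ?F n l) - (d n * real k) * \<eta>"
          unfolding sum_subtractf by (simp add: right_diff_distrib)
        moreover have "(d n * real k) * \<eta> \<le> (B + 1) * \<eta>" using dk_le[OF k] \<eta> by (intro mult_right_mono) auto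
        moreover have "(B + 1) * \<eta> = \<epsilon> / 2"
        proof -
          have "B + 1 \<noteq> 0" using B_nonneg by linarith
          then show ?thesis unfolding \<eta>_def by (metis nonzero_mult_div_cancel_left times_divide_eq_right)
        qed
        moreover have "- (\<epsilon> / 2) \<le> d n * (\<Sum>l<k. ?F n l)"
          using abs_le_D2[OF elim[rule_format, OF k]] by linarith
        ultimately show "- \<epsilon> \<le> d n * (\<Sum>l<k. D n l - ?P (z n l))" by linarith
      qed
    qed
  qed
  show ?thesis
  proof (rule Y_null_averaging[where \<phi>="?P", OF _ nP])
    show "P0 lam R y = ?P (y 1)" for y unfolding R by simp
    show "weak_null (\<lambda>n l. D n l - ?P (z n l))" unfolding weak_null_def unif_null_def
    proof (intro allI impI)
      fix \<epsilon> :: real assume "0 < \<epsilon>"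
      from upper[OF this] lower[OF this]
      show "\<forall>\<^sub>F n in sequentially. \<forall>k\<le>K n. \<bar>d n * (\<Sum>l<k. D n l - ?P (z n l))\<bar> \<le> \<epsilon>"
      proof eventually_elim
        case (elim n)
        show ?case
        proof (intro allI impI abs_leI)
          fix k assume k: "k \<le> K n"
          show "d n * (\<Sum>l<k. D n l - ?P (z n l)) \<le> \<epsilon>" using elim(1) k by blast
          have "- \<epsilon> \<le> d n * (\<Sum>l<k. D n l - ?P (z n l))" using elim(2) k by blast
          then show "- (d n * (\<Sum>l<k. D n l - ?P (z n l))) \<le> \<epsilon>" by (rule minus_le_iff[THEN iffD1])
        qed
      qed
    qed
  qed
qed

text \<open>The square of \<open>w\<close>, which is level \<open>1\<close> of \<open>e\<close> up to the defect, is followed along the grid. Its increments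
  contain \<open>- 2 w (DL - Dl)\<close>, and by the two complementarity relations this is at most a vanishing
  term; the remaining terms are bounded by \<open>Y\<close>. Then \<open>Lg - lg\<close> is read off from the equation for \<open>w\<close>.\<close>

theorem Y_null_High_Message:
  assumes R: "R = High_Message c" and strong: "unif_null K (\<lambda>n k. d n * (\<Sum>l<k. (1 - x n l 1) * D n l))"
  shows "unif_null K Y"
proof -
  define w where "w n k = compensated n k - s (d n * real k) 1" for n k
  define C1 where "C1 = 4 + 5 * Lip"
  define Q where "Q = 14 + 8 * B + (22 * Lip + C1\<^sup>2) * B"
  have C1: "0 \<le> C1" using Lip_nonneg by (simp add: C1_def)
  have LB: "0 \<le> Lip * B" using Lip_nonneg B_nonneg by simp
  have Q0: "0 \<le> Q" using B_nonneg Lip_nonneg by (simp add: Q_def)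
  let ?A = "5 * (Q + Q + 1 + 25 * (Lip * B)\<^sup>2)" and ?C = "5 * 24 + 5 * B * 12"
  have start0: "(\<lambda>n. x n 0 1 - s0 1) \<longlonglongrightarrow> 0" using start[of 1] by (simp add: LIM_zero)
  show ?thesis
  proof (rule Y_null_of_key[of ?A ?C])
    fix \<epsilon> :: real assume \<epsilon>: "0 < \<epsilon>" "\<epsilon> \<le> 1"
    have "\<forall>\<^sub>F n in sequentially. d n < \<epsilon>" using d_null by (rule order_tendstoD) (use \<epsilon> in simp)
    moreover have "\<forall>\<^sub>F n in sequentially. \<bar>x n 0 1 - s0 1\<bar> < \<epsilon>"
      using tendstoD[OF start0 \<epsilon>(1)] by (simp add: dist_real_def)
    moreover note eventually_regular unif_nullD[OF err_null[OF order_refl] \<epsilon>(1)] unif_nullD[OF strong \<epsilon>(1)]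
    ultimately show "\<forall>\<^sub>F n in sequentially. \<forall>k\<le>K n. (Lg n k - lg n k)\<^sup>2 \<le> ?A * \<epsilon> + ?C * (d n * (\<Sum>l<k. Y n l))"
    proof eventually_elim
      case (elim n)
      note n = elim(3)
      let ?q = "8 * \<epsilon> + (22 * Lip + C1\<^sup>2) * \<epsilon>"
      have d: "0 < d n" "d n \<le> \<epsilon>" "d n \<le> 1" using d_pos[of n] elim(1) \<epsilon> by auto
      have d2: "(d n)\<^sup>2 \<le> d n * \<epsilon>" using d by (simp add: power2_eq_square)
      define \<nu> where "\<nu> l = (1 - x n l 1) * (lam * d n * D n l)" for l
      define DL where "DL l = lam * d n * D n l" for l
      define Dl where "Dl l = lg n (Suc l) - lg n l" for l
      \<comment> \<open>The discretisation error left when the increment of \<open>w\<close> is written with \<open>DL\<close>, \<open>Dl\<close>, \<open>\<nu>\<close> and \<open>e\<close>.\<close>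
      define \<rho> where "\<rho> l = w n (Suc l) - w n l + (DL l - Dl l) - \<nu> l + d n * (e n l 1 - e n l 2)" for l
      have err\<epsilon>: "\<bar>err n l 1\<bar> \<le> \<epsilon>" if "l \<le> K n" for l using elim(4) that by simp
      have ld: "0 \<le> lam * d n" "lam * d n \<le> d n" using lam d by (auto simp: mult_le_cancel_right1)
      have DLb: "0 \<le> DL l" "DL l \<le> d n" for l
        using ld D_bounds[of n l] mult_mono[of "lam * d n" "d n" "D n l" 1] d unfolding DL_def by auto
      have Dlb: "0 \<le> Dl l" "Dl l \<le> d n" for l
        using lg_increment[of n l] ld unfolding Dl_def by auto
      have xb: "0 \<le> x n l j" "x n l j \<le> 1" if "l \<le> K n" for l j using n that by (auto simp: regular_def)
      have sb: "0 \<le> s (d n * real l) j" "s (d n * real l) j \<le> 1" for l j using s_bounds[OF t_nonneg] by auto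
      have \<nu>b: "0 \<le> \<nu> l" "\<nu> l \<le> d n" if "l \<le> K n" for l
        using xb[OF that, of 1] DLb[of l] mult_mono[of "1 - x n l 1" 1 "DL l" "d n"]
        unfolding \<nu>_def DL_def[symmetric] by auto
      have \<nu>sum: "(\<Sum>l<k. \<nu> l) \<le> \<epsilon>" if k: "k \<le> K n" for k
      proof -
        have "(\<Sum>l<k. \<nu> l) = lam * (d n * (\<Sum>l<k. (1 - x n l 1) * D n l))"
          by (simp add: \<nu>_def sum_distrib_left mult_ac)
        moreover have "0 \<le> (\<Sum>l<k. (1 - x n l 1) * D n l)"
          using xb D_bounds k by (intro sum_nonneg mult_nonneg_nonneg) (auto simp: order_trans[of _ 1])
        then have "lam * (d n * (\<Sum>l<k. (1 - x n l 1) * D n l)) \<le> 1 * (d n * (\<Sum>l<k. (1 - x n l 1) * D n l))"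
          using lam d by (intro mult_right_mono mult_nonneg_nonneg) auto
        moreover have "d n * (\<Sum>l<k. (1 - x n l 1) * D n l) \<le> \<epsilon>" using elim(5) k abs_le_D1 by blast
        ultimately show ?thesis by simp
      qed
      have compl: "\<bar>(1 - s (d n * real l) 1) * Dl l\<bar> \<le> Lip * (d n)\<^sup>2" for l
        using ell_increment_complementary[OF R t_nonneg t_mono, of n l] unfolding t_Suc lg_def Dl_def .
      have \<rho>b: "\<bar>\<rho> l\<bar> \<le> 5 * Lip * (d n)\<^sup>2" for l
      proof -
        have "\<bar>s (d n * real (Suc l)) 1 - s (d n * real l) 1 - (lam * d n + random_gain 1 (s (d n * real l)) * Dl l
           - d n * (s (d n * real l) 1 - s (d n * real l) 2))\<bar> \<le> 4 * Lip * (d n)\<^sup>2"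
          using grid_increment[OF order_refl t_nonneg t_mono, of n l] unfolding t_Suc lg_def Dl_def by (simp add: numeral_2_eq_2)
        moreover have "\<rho> l = (1 - s (d n * real l) 1) * (- Dl l) - (s (d n * real (Suc l)) 1 - s (d n * real l) 1 - (lam * d n + random_gain 1 (s (d n * real l)) * Dl l
           - d n * (s (d n * real l) 1 - s (d n * real l) 2)))"
          using compensated_increment[of n l] unfolding \<rho>_def w_def \<nu>_def DL_def e_def
          by (simp add: random_gain_def algebra_simps)
        ultimately show ?thesis using compl[of l] unfolding mult_minus_right by linarith
      qed
      have w_e: "w n l = e n l 1 - err n l 1" for l by (simp add: w_def compensated_def e_def)
      have w2: "\<bar>w n l\<bar> \<le> 2" if "l \<le> K n" for l
        using e_le_1[OF n that, of 1] err\<epsilon>[OF that] \<epsilon> unfolding w_e by linarith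
      have inc: "w n (Suc l) = w n l - (DL l - Dl l) + \<nu> l - d n * (e n l 1 - e n l 2) + \<rho> l" for l
        by (simp add: \<rho>_def)
      have wstep: "(w n (Suc l))\<^sup>2 \<le> (w n l)\<^sup>2 + 6 * \<nu> l + ?q * d n + 4 * (d n * ((e n l 1)\<^sup>2 + (e n l 2)\<^sup>2))"
        if l: "l < K n" for l
      proof -
        have l': "l \<le> K n" using l by simp
        define \<Delta> where "\<Delta> = w n (Suc l) - w n l"
        note e1 = e_le_1[OF n l', of 1] and e2 = e_le_1[OF n l', of 2]
        have \<Delta>: "\<Delta> = - (DL l - Dl l) + \<nu> l - d n * (e n l 1 - e n l 2) + \<rho> l" unfolding \<Delta>_def inc by simp
        have "\<bar>d n * (e n l 1 - e n l 2)\<bar> \<le> 2 * d n"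
          using e1 e2 d by (simp add: abs_mult)
        moreover have "5 * Lip * (d n)\<^sup>2 \<le> 5 * Lip * d n"
          using Lip_nonneg d by (intro mult_left_mono) (auto simp: power2_eq_square mult_left_le)
        ultimately have "\<bar>\<Delta>\<bar> \<le> C1 * d n"
          using DLb[of l] Dlb[of l] \<nu>b[OF l'] \<rho>b[of l] unfolding \<Delta> C1_def distrib_right by linarith
        then have "\<bar>\<Delta>\<bar>\<^sup>2 \<le> (C1 * d n)\<^sup>2" by (intro power_mono) auto
        also have "\<dots> \<le> C1\<^sup>2 * (d n * \<epsilon>)" unfolding power_mult_distrib using d2 by (intro mult_left_mono) auto
        finally have \<Delta>2: "\<Delta>\<^sup>2 \<le> C1\<^sup>2 * \<epsilon> * d n" by (simp add: mult_ac)
        \<comment> \<open>Where the system reflects, \<open>x1\<close> is near \<open>1\<close> and hence not below \<open>s1\<close> by much.\<close>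
        have t1: "- (w n l * DL l) \<le> \<nu> l + \<epsilon> * d n"
        proof -
          have "- (w n l * DL l) = \<nu> l - (1 - s (d n * real l) 1) * DL l + err n l 1 * DL l"
            unfolding w_e e_def \<nu>_def DL_def by (simp add: algebra_simps)
          moreover have "0 \<le> (1 - s (d n * real l) 1) * DL l" using sb DLb by simp
          moreover have "err n l 1 * DL l \<le> \<epsilon> * d n"
            using err\<epsilon>[OF l'] DLb[of l] \<epsilon> by (intro mult_mono) auto
          ultimately show ?thesis by linarith
        qed
        \<comment> \<open>Where the fluid solution reflects, \<open>s1 = 1\<close> and hence \<open>x1 \<le> s1\<close>.\<close>
        have t2: "w n l * Dl l \<le> Lip * (d n)\<^sup>2 + \<epsilon> * d n"
        proof -
          have "w n l * Dl l = (1 - s (d n * real l) 1) * Dl l - (1 - x n l 1) * Dl l + (- err n l 1) * Dl l"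
            unfolding w_e e_def by (simp add: algebra_simps)
          moreover have "0 \<le> (1 - x n l 1) * Dl l" using xb[OF l', of 1] Dlb by simp
          moreover have "(- err n l 1) * Dl l \<le> \<epsilon> * d n"
            using err\<epsilon>[OF l'] Dlb[of l] \<epsilon> by (intro mult_mono) auto
          ultimately show ?thesis using compl[of l] by linarith
        qed
        have t3: "w n l * \<nu> l \<le> 2 * \<nu> l" using w2[OF l'] \<nu>b(1)[OF l'] by (intro mult_right_mono) auto
        have t4: "w n l * \<rho> l \<le> 10 * Lip * (d n)\<^sup>2"
        proof -
          have "\<bar>w n l * \<rho> l\<bar> \<le> 2 * (5 * Lip * (d n)\<^sup>2)"
            unfolding abs_mult using w2[OF l'] \<rho>b[of l] by (intro mult_mono) auto
          then show ?thesis by simp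
        qed
        have t5: "- (w n l * (d n * (e n l 1 - e n l 2))) \<le> 2 * (d n * ((e n l 1)\<^sup>2 + (e n l 2)\<^sup>2)) + 2 * \<epsilon> * d n"
        proof -
          have "- (w n l * (e n l 1 - e n l 2)) = - (e n l 1 * e n l 1) + e n l 1 * e n l 2 + err n l 1 * (e n l 1 - e n l 2)"
            unfolding w_e by (simp add: algebra_simps)
          also have "\<dots> \<le> 2 * ((e n l 1)\<^sup>2 + (e n l 2)\<^sup>2) + 2 * \<epsilon>"
          proof -
            have "e n l 1 * e n l 2 \<le> (e n l 1)\<^sup>2 + (e n l 2)\<^sup>2"
              using zero_le_power2[of "e n l 1 - e n l 2"] zero_le_power2[of "e n l 1"] zero_le_power2[of "e n l 2"]
              unfolding power2_diff by linarith
            moreover have "\<bar>err n l 1 * (e n l 1 - e n l 2)\<bar> \<le> \<epsilon> * 2"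
              unfolding abs_mult using err\<epsilon>[OF l'] e1 e2 \<epsilon> by (intro mult_mono) auto
            moreover have "0 \<le> e n l 1 * e n l 1" by simp
            ultimately show ?thesis using zero_le_power2[of "e n l 1"] zero_le_power2[of "e n l 2"] by (smt (verit))
          qed
          finally have "d n * - (w n l * (e n l 1 - e n l 2)) \<le> d n * (2 * ((e n l 1)\<^sup>2 + (e n l 2)\<^sup>2) + 2 * \<epsilon>)"
            using d by (intro mult_left_mono) auto
          then show ?thesis by (simp add: algebra_simps)
        qed
        have "w n l * \<Delta> = - (w n l * DL l) + w n l * Dl l + w n l * \<nu> l - w n l * (d n * (e n l 1 - e n l 2)) + w n l * \<rho> l"
          unfolding \<Delta> by (simp add: algebra_simps)
        then have "w n l * \<Delta> \<le> 3 * \<nu> l + 4 * (\<epsilon> * d n) + 11 * (Lip * (d n)\<^sup>2) + 2 * (d n * ((e n l 1)\<^sup>2 + (e n l 2)\<^sup>2))"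
          using t1 t2 t3 t4 t5 by linarith
        moreover have "Lip * (d n)\<^sup>2 \<le> Lip * (d n * \<epsilon>)" using d2 Lip_nonneg by (rule mult_left_mono)
        moreover have "(w n (Suc l))\<^sup>2 = (w n l)\<^sup>2 + 2 * (w n l * \<Delta>) + \<Delta>\<^sup>2"
          unfolding \<Delta>_def by (simp add: power2_eq_square algebra_simps)
        ultimately show ?thesis using \<Delta>2 by (simp add: algebra_simps)
      qed
      have Ysum: "d n * (\<Sum>l<k. (e n l 1)\<^sup>2 + (e n l 2)\<^sup>2) \<le> 6 * (d n * (\<Sum>l<k. Y n l))" if "k \<le> K n" for k
        using sum_e2_le[OF n that, of 1] sum_e2_le[OF n that, of 2] by (simp add: sum.distrib distrib_left)
      have w0: "\<bar>w n 0\<bar> \<le> 2 * \<epsilon>"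
        using elim(2) err\<epsilon>[of 0] by (simp add: w_e e_def s_0)
      have wk: "(w n k)\<^sup>2 \<le> Q * \<epsilon> + 24 * (d n * (\<Sum>l<k. Y n l))" if k: "k \<le> K n" for k
      proof -
        have "(w n k)\<^sup>2 \<le> (w n 0)\<^sup>2 + 6 * (\<Sum>l<k. \<nu> l) + ?q * (d n * real k)
            + 4 * (d n * (\<Sum>l<k. (e n l 1)\<^sup>2 + (e n l 2)\<^sup>2))" using k
        proof (induction k)
          case (Suc k)
          then have "(w n (Suc k))\<^sup>2 \<le> (w n 0)\<^sup>2 + 6 * (\<Sum>l<k. \<nu> l) + ?q * (d n * real k)
            + 4 * (d n * (\<Sum>l<k. (e n l 1)\<^sup>2 + (e n l 2)\<^sup>2)) + 6 * \<nu> k + ?q * d n + 4 * (d n * ((e n k 1)\<^sup>2 + (e n k 2)\<^sup>2))"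
            using wstep[of k] by simp
          also have "\<dots> = (w n 0)\<^sup>2 + 6 * (\<Sum>l<Suc k. \<nu> l) + ?q * (d n * real (Suc k))
            + 4 * (d n * (\<Sum>l<Suc k. (e n l 1)\<^sup>2 + (e n l 2)\<^sup>2))"
            unfolding sum.lessThan_Suc of_nat_Suc by (simp only: distrib_left distrib_right mult_1_right)
          finally show ?case .
        qed simp
        moreover have "(w n 0)\<^sup>2 \<le> 8 * \<epsilon>"
        proof -
          have "\<bar>w n 0\<bar>\<^sup>2 \<le> (2 * \<epsilon>)\<^sup>2" using w0 by (intro power_mono) auto
          also have "\<dots> \<le> 4 * \<epsilon>" using \<epsilon> by (simp add: power2_eq_square mult_left_le)
          finally show ?thesis using \<epsilon> by simp
        qed
        moreover have "?q * (d n * real k) \<le> ?q * B"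
          using dk_le[OF k] Lip_nonneg \<epsilon> by (intro mult_left_mono) auto
        moreover note \<nu>sum[OF k] Ysum[OF k]
        moreover have "Q * \<epsilon> = 14 * \<epsilon> + ?q * B" by (simp add: Q_def algebra_simps)
        ultimately show ?thesis by linarith
      qed
      show ?case
      proof (intro allI impI)
        fix k assume k: "k \<le> K n"
        have "(\<Sum>l<k. w n (Suc l) - w n l) = w n k - w n 0" by (rule sum_lessThan_telescope)
        moreover have "w n (Suc l) - w n l = - (DL l - Dl l) + \<nu> l - d n * (e n l 1 - e n l 2) + \<rho> l" for l
          by (simp add: inc)
        moreover have "(\<Sum>l<k. DL l) = Lg n k" by (simp add: DL_def Lg_def)
        moreover have "(\<Sum>l<k. Dl l) = lg n k" unfolding Dl_def by (subst sum_lessThan_telescope) (simp add: lg_def ell_0)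
        ultimately have id: "Lg n k - lg n k = - w n k + w n 0 + (\<Sum>l<k. \<nu> l) - d n * (\<Sum>l<k. e n l 1 - e n l 2) + (\<Sum>l<k. \<rho> l)"
          by (simp add: sum.distrib sum_subtractf sum_distrib_left[symmetric])
        have \<rho>s: "\<bar>\<Sum>l<k. \<rho> l\<bar> \<le> 5 * (Lip * B) * \<epsilon>"
        proof -
          have "\<bar>\<Sum>l<k. \<rho> l\<bar> \<le> (\<Sum>l<k. 5 * Lip * (d n)\<^sup>2)"
            by (rule order_trans[OF sum_abs]) (intro sum_mono \<rho>b)
          also have "\<dots> = (d n * real k) * (5 * Lip * d n)" by (simp add: power2_eq_square)
          also have "\<dots> \<le> B * (5 * Lip * \<epsilon>)"
            using dk_le[OF k] Lip_nonneg d B_nonneg by (intro mult_mono) auto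
          finally show ?thesis by (simp add: mult_ac)
        qed
        have sq5: "(p + q + r + t + u)\<^sup>2 \<le> 5 * (p\<^sup>2 + q\<^sup>2 + r\<^sup>2 + t\<^sup>2 + u\<^sup>2)" for p q r t u :: real
        proof -
          have "5 * (p\<^sup>2 + q\<^sup>2 + r\<^sup>2 + t\<^sup>2 + u\<^sup>2) - (p + q + r + t + u)\<^sup>2 =
            (p-q)\<^sup>2 + (p-r)\<^sup>2 + (p-t)\<^sup>2 + (p-u)\<^sup>2 + (q-r)\<^sup>2 + (q-t)\<^sup>2 + (q-u)\<^sup>2 + (r-t)\<^sup>2 + (r-u)\<^sup>2 + (t-u)\<^sup>2"
            by (simp add: power2_eq_square algebra_simps)
          moreover have "0 \<le> (p-q)\<^sup>2 + (p-r)\<^sup>2 + (p-t)\<^sup>2 + (p-u)\<^sup>2 + (q-r)\<^sup>2 + (q-t)\<^sup>2 + (q-u)\<^sup>2 + (r-t)\<^sup>2 + (r-u)\<^sup>2 + (t-u)\<^sup>2"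
            by (intro add_nonneg_nonneg) auto
          ultimately show ?thesis by linarith
        qed
        have \<epsilon>2: "\<epsilon>\<^sup>2 \<le> \<epsilon>" using \<epsilon> by (simp add: power2_eq_square mult_left_le)
        have "(Lg n k - lg n k)\<^sup>2 \<le> 5 * ((- w n k)\<^sup>2 + (w n 0)\<^sup>2 + (\<Sum>l<k. \<nu> l)\<^sup>2 + (- (d n * (\<Sum>l<k. e n l 1 - e n l 2)))\<^sup>2 + (\<Sum>l<k. \<rho> l)\<^sup>2)"
          unfolding id using sq5[of "- w n k" "w n 0" "\<Sum>l<k. \<nu> l" "- (d n * (\<Sum>l<k. e n l 1 - e n l 2))" "\<Sum>l<k. \<rho> l"] by simp
        moreover have "(w n 0)\<^sup>2 \<le> Q * \<epsilon>" using wk[of 0] by simp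
        moreover have "(\<Sum>l<k. \<nu> l)\<^sup>2 \<le> \<epsilon>"
        proof -
          have "0 \<le> (\<Sum>l<k. \<nu> l)" using \<nu>b k by (intro sum_nonneg) auto
          then have "(\<Sum>l<k. \<nu> l)\<^sup>2 \<le> \<epsilon>\<^sup>2" using \<nu>sum[OF k] by (intro power_mono) auto
          then show ?thesis using \<epsilon>2 by simp
        qed
        moreover have "(\<Sum>l<k. \<rho> l)\<^sup>2 \<le> 25 * (Lip * B)\<^sup>2 * \<epsilon>"
        proof -
          have "\<bar>\<Sum>l<k. \<rho> l\<bar>\<^sup>2 \<le> (5 * (Lip * B) * \<epsilon>)\<^sup>2" using \<rho>s by (intro power_mono) auto
          also have "\<dots> = 25 * (Lip * B)\<^sup>2 * \<epsilon>\<^sup>2" by (simp add: power_mult_distrib)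
          also have "\<dots> \<le> 25 * (Lip * B)\<^sup>2 * \<epsilon>" using \<epsilon>2 by (intro mult_left_mono) auto
          finally show ?thesis by simp
        qed
        moreover have "(d n * (\<Sum>l<k. e n l 1 - e n l 2))\<^sup>2 \<le> B * (12 * (d n * (\<Sum>l<k. Y n l)))"
        proof (rule order_trans[OF sum_square_le[OF k]], rule mult_left_mono[OF _ B_nonneg])
          have "(\<Sum>l<k. (e n l 1 - e n l 2)\<^sup>2) \<le> (\<Sum>l<k. 2 * ((e n l 1)\<^sup>2 + (e n l 2)\<^sup>2))"
          proof (rule sum_mono)
            fix l show "(e n l 1 - e n l 2)\<^sup>2 \<le> 2 * ((e n l 1)\<^sup>2 + (e n l 2)\<^sup>2)"
              using zero_le_power2[of "e n l 1 + e n l 2"] by (simp add: power2_eq_square algebra_simps)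
          qed
          then have "d n * (\<Sum>l<k. (e n l 1 - e n l 2)\<^sup>2) \<le> d n * (\<Sum>l<k. 2 * ((e n l 1)\<^sup>2 + (e n l 2)\<^sup>2))"
            using d by (intro mult_left_mono) auto
          also have "\<dots> = 2 * (d n * (\<Sum>l<k. (e n l 1)\<^sup>2 + (e n l 2)\<^sup>2))" by (simp only: sum_distrib_left[symmetric] mult.left_commute)
          finally show "d n * (\<Sum>l<k. (e n l 1 - e n l 2)\<^sup>2) \<le> 12 * (d n * (\<Sum>l<k. Y n l))" using Ysum[OF k] by linarith
        qed
        ultimately have "(Lg n k - lg n k)\<^sup>2 \<le> 5 * ((Q * \<epsilon> + 24 * (d n * (\<Sum>l<k. Y n l))) + Q * \<epsilon> + \<epsilon> + B * (12 * (d n * (\<Sum>l<k. Y n l))) + 25 * (Lip * B)\<^sup>2 * \<epsilon>)"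
          using wk[OF k] by simp
        also have "\<dots> \<le> 5 * (Q + Q + 1 + 25 * (Lip * B)\<^sup>2) * \<epsilon> + ?C * (d n * (\<Sum>l<k. Y n l))"
          by (simp only: distrib_left distrib_right)
        finally show "(Lg n k - lg n k)\<^sup>2 \<le> ?A * \<epsilon> + ?C * (d n * (\<Sum>l<k. Y n l))" .
      qed
    qed
  qed (use Q0 B_nonneg in auto)
qed

end

section \<open>The coupled system on the grid\<close>

text \<open>Independence of coarse \<open>\<sigma>\<close>-algebras together with independence inside each of them is joint independence.\<close>

lemma (in prob_space) indep_sets_refine_by:
  assumes ind: "indep_sets F I"
    and g: "\<And>x. x \<in> X \<Longrightarrow> g x \<in> I"
    and fine: "\<And>i. i \<in> I \<Longrightarrow> indep_sets E {x\<in>X. g x = i}"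
    and sub: "\<And>x. x \<in> X \<Longrightarrow> E x \<subseteq> F (g x)"
    and stable: "\<And>i. i \<in> I \<Longrightarrow> Int_stable (F i)"
  shows "indep_sets E X"
proof (rule indep_setsI)
  fix x assume x: "x \<in> X"
  then have "indep_sets E {y\<in>X. g y = g x}" using fine g by blast
  then show "E x \<subseteq> events" using x by (auto simp: indep_sets_def)
next
  fix A K assume K: "K \<noteq> {}" "K \<subseteq> X" "finite K" and A: "\<forall>x\<in>K. A x \<in> E x"
  define L where "L i = {x\<in>K. g x = i}" for i
  have L: "finite (L i)" "L i \<subseteq> {x\<in>X. g x = i}" for i using K by (auto simp: L_def)
  have Lne: "L i \<noteq> {}" if "i \<in> g ` K" for i using that by (auto simp: L_def)
  have gI: "g ` K \<subseteq> I" using K g by auto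
  define B where "B i = (\<Inter>x\<in>L i. A x)" for i
  have BF: "B i \<in> F i" if i: "i \<in> g ` K" for i
  proof -
    have AF: "A ` L i \<subseteq> F i" using A sub K by (auto simp: L_def)
    have "\<Inter> C \<in> F i" if "finite C" "C \<noteq> {}" "C \<subseteq> F i" for C
      using that
    proof (induction C rule: finite_ne_induct)
      case (insert x C)
      then show ?case using stable[of i] i gI by (auto simp: Int_stable_def)
    qed auto
    then show ?thesis unfolding B_def using L Lne[OF i] AF by auto
  qed
  have "(\<Inter>x\<in>K. A x) = (\<Inter>i\<in>g ` K. B i)" by (auto simp: B_def L_def)
  then have "prob (\<Inter>x\<in>K. A x) = prob (\<Inter>i\<in>g ` K. B i)" by simp
  also have "\<dots> = (\<Prod>i\<in>g ` K. prob (B i))"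
    using indep_setsD[OF ind gI _ _] BF K by auto
  also have "\<dots> = (\<Prod>i\<in>g ` K. \<Prod>x\<in>{x\<in>K. g x = i}. prob (A x))"
  proof (rule prod.cong[OF refl])
    fix i assume i: "i \<in> g ` K"
    then show "prob (B i) = (\<Prod>x\<in>{x\<in>K. g x = i}. prob (A x))"
      unfolding B_def using indep_setsD[OF fine[of i] L(2) Lne[OF i] L(1), of A] gI A by (auto simp: L_def)
  qed
  also have "\<dots> = (\<Prod>x\<in>K. prob (A x))"
    by (rule prod.group) (use K in auto)
  finally show "prob (\<Inter>x\<in>K. A x) = (\<Prod>x\<in>K. prob (A x))" .
qed

lemma (in prob_space) indep_sets_image:
  assumes "indep_sets (\<lambda>i. E (f i)) I" "inj_on f I"
  shows "indep_sets E (f ` I)"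
proof (rule indep_setsI)
  fix x assume "x \<in> f ` I"
  then show "E x \<subseteq> events" using assms(1) by (auto simp: indep_sets_def)
next
  fix A K assume K: "K \<noteq> {}" "K \<subseteq> f ` I" "finite K" and A: "\<forall>x\<in>K. A x \<in> E x"
  obtain J where J: "J \<subseteq> I" "K = f ` J" using K(2) by (rule subset_imageE)
  have inj: "inj_on f J" using assms(2) J(1) by (rule inj_on_subset)
  have fin: "finite J" using K(3) J(2) inj by (simp add: finite_image_iff)
  have "prob (\<Inter>i\<in>J. A (f i)) = (\<Prod>i\<in>J. prob (A (f i)))"
    by (rule indep_setsD[OF assms(1) J(1)]) (use K J A fin in auto)
  then show "prob (\<Inter>x\<in>K. A x) = (\<Prod>x\<in>K. prob (A x))"
    using J inj by (simp add: prod.reindex)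
qed

lemma Int_stable_sigma_sets:
  assumes "A \<subseteq> Pow X" shows "Int_stable (sigma_sets X A)"
proof -
  interpret sigma_algebra X "sigma_sets X A" by (rule sigma_algebra_sigma_sets[OF assms])
  show ?thesis by (rule Int_stableI) (rule Int)
qed

fun src_of :: "noise \<Rightarrow> source" where
  "src_of (Inc Arrival k) = Src_Arrivals"
| "src_of (Inc Service k) = Src_Services"
| "src_of (Inc Message k) = Src_Messages"
| "src_of (Mark Arrival k) = Src_U"
| "src_of (Mark Service k) = Src_W"
| "src_of (Mark Message k) = Src_V"
| "src_of Ini = Src_Initial"

context coupled_system
begin

definition rate :: "nat \<Rightarrow> flow \<Rightarrow> real" where
  "rate n s = (case s of Arrival \<Rightarrow> lam | Service \<Rightarrow> 1 | Message \<Rightarrow> mu n)"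

definition proc :: "nat \<Rightarrow> flow \<Rightarrow> real \<Rightarrow> 'w \<Rightarrow> nat" where
  "proc n s = (case s of Arrival \<Rightarrow> N_lam | Service \<Rightarrow> N_one | Message \<Rightarrow> N_mu n)"

definition mark :: "flow \<Rightarrow> nat \<Rightarrow> 'w \<Rightarrow> real" where
  "mark s = (case s of Arrival \<Rightarrow> U | Service \<Rightarrow> W | Message \<Rightarrow> V)"

definition incr :: "(nat \<Rightarrow> real) \<Rightarrow> nat \<Rightarrow> flow \<Rightarrow> nat \<Rightarrow> 'w \<Rightarrow> nat" where
  "incr d n s k w = proc n s (real n * (d n * real (Suc k))) w - proc n s (real n * (d n * real k)) w"

definition ini_sets :: "'w set set" where
  "ini_sets = sigma_sets (space \<Omega>)
            (generated borel (\<lambda>(n, i) w. S0 n w i) ({n. 1 \<le> n \<and> c n \<le> n} \<times> UNIV) \<union>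
             generated (count_space UNIV) M0 {n. 1 \<le> n \<and> c n \<le> n})"

definition src_sets :: "source \<Rightarrow> 'w set set" where
  "src_sets k = (case k of
          Src_Arrivals \<Rightarrow> generated (count_space UNIV) N_lam {0..}
        | Src_Services \<Rightarrow> generated (count_space UNIV) N_one {0..}
        | Src_Messages \<Rightarrow> generated (count_space UNIV) (\<lambda>(n, t). N_mu n t) ({1..} \<times> {0..})
        | Src_U \<Rightarrow> generated borel U {1..}
        | Src_V \<Rightarrow> generated borel V {1..}
        | Src_W \<Rightarrow> generated borel W {1..}
        | Src_Initial \<Rightarrow> ini_sets)"

lemma proc_poisson: "1 \<le> n \<Longrightarrow> poisson_process (rate n s) (proc n s)"
  using poisson_lam poisson_one poisson_mu by (cases s) (auto simp: rate_def proc_def)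

lemma rate_pos: "0 < lam \<Longrightarrow> 1 \<le> n \<Longrightarrow> 0 < rate n s"
  using mu_pos by (cases s) (auto simp: rate_def)

lemma mark_uniform: "iid_uniform (mark s)"
  using uniform by (cases s) (auto simp: mark_def)

lemma generated_Pow: "{X i -` A \<inter> space \<Omega> | i A. i \<in> I \<and> A \<in> sets B} \<subseteq> Pow (space \<Omega>)"
  by auto

lemma generated_measurable:
  assumes "i \<in> I" "sets N = generated B X I" "space N = space \<Omega>" "space B = UNIV"
  shows "X i \<in> measurable N B"
proof (rule measurableI)
  fix A assume "A \<in> sets B"
  then show "X i -` A \<inter> space N \<in> sets N" unfolding assms(2,3) generated_def using assms(1) by blast
qed (use assms(4) in auto)

lemma sets_generated: "sets (sigma (space \<Omega>) (generated B X I)) = generated B X I"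
proof -
  have "generated B X I \<subseteq> Pow (space \<Omega>)"
    unfolding generated_def using sigma_sets_into_sp[OF generated_Pow] by blast
  then have "sets (sigma (space \<Omega>) (generated B X I)) = sigma_sets (space \<Omega>) (generated B X I)"
    by (rule sets_measure_of)
  also have "\<dots> = generated B X I" unfolding generated_def by (rule sigma_sets_sigma_sets_eq[OF generated_Pow])
  finally show ?thesis .
qed

lemma generated_subset_Pow: "generated B X I \<subseteq> Pow (space \<Omega>)"
  unfolding generated_def using sigma_sets_into_sp[OF generated_Pow] by blast

lemma generated_Int_stable: "Int_stable (generated B X I)"
  unfolding generated_def by (rule Int_stable_sigma_sets[OF generated_Pow])

lemma ini_generators_Pow:
  "generated borel (\<lambda>(n, i) w. S0 n w i) ({n. 1 \<le> n \<and> c n \<le> n} \<times> UNIV) \<union>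
     generated (count_space UNIV) M0 {n. 1 \<le> n \<and> c n \<le> n} \<subseteq> Pow (space \<Omega>)"
  by (intro Un_least generated_subset_Pow)

lemma ini_sets_Pow: "ini_sets \<subseteq> Pow (space \<Omega>)"
  unfolding ini_sets_def using sigma_sets_into_sp[OF ini_generators_Pow] by blast

lemma sets_ini: "sets (sigma (space \<Omega>) ini_sets) = ini_sets"
proof -
  have "sets (sigma (space \<Omega>) ini_sets) = sigma_sets (space \<Omega>) ini_sets"
    by (rule sets_measure_of[OF ini_sets_Pow])
  also have "\<dots> = ini_sets" unfolding ini_sets_def
    by (rule sigma_sets_sigma_sets_eq[OF ini_generators_Pow])
  finally show ?thesis .
qed

lemma ini_measurable:
  assumes n: "1 \<le> n" "c n \<le> n"
  shows "(\<lambda>w. (S0 n w, M0 n w)) \<in> measurable (sigma (space \<Omega>) ini_sets) state_measure"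
proof (intro measurable_Pair)
  let ?N = "sigma (space \<Omega>) ini_sets"
  have sp: "space ?N = space \<Omega>" by (rule space_measure_of[OF ini_sets_Pow])
  have le: "generated borel (\<lambda>(n, i) w. S0 n w i) ({n. 1 \<le> n \<and> c n \<le> n} \<times> UNIV) \<subseteq> sets ?N"
    "generated (count_space UNIV) M0 {n. 1 \<le> n \<and> c n \<le> n} \<subseteq> sets ?N"
    unfolding sets_ini unfolding ini_sets_def by auto
  have "(\<lambda>w. S0 n w i) \<in> borel_measurable ?N" for i
  proof (rule measurableI)
    fix A :: "real set" assume "A \<in> sets borel"
    then have "(\<lambda>(n, i) w. S0 n w i) (n, i) -` A \<inter> space \<Omega> \<in>
       generated borel (\<lambda>(n, i) w. S0 n w i) ({n. 1 \<le> n \<and> c n \<le> n} \<times> UNIV)"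
      unfolding generated_def using n by blast
    then show "(\<lambda>w. S0 n w i) -` A \<inter> space ?N \<in> sets ?N" using le sp by auto
  qed simp
  then show "(\<lambda>w. S0 n w) \<in> measurable ?N (PiM UNIV (\<lambda>_. borel))"
    by (intro measurable_PiM_single') auto
  show "(\<lambda>w. M0 n w) \<in> measurable ?N (count_space UNIV)"
  proof (rule measurableI)
    fix A :: "nat set" assume "A \<in> sets (count_space UNIV)"
    then have "M0 n -` A \<inter> space \<Omega> \<in> generated (count_space UNIV) M0 {n. 1 \<le> n \<and> c n \<le> n}"
      unfolding generated_def using n by blast
    then show "(\<lambda>w. M0 n w) -` A \<inter> space ?N \<in> sets ?N" using le sp by auto
  qed simp
qed

lemma incr_generated:
  assumes "t1 \<in> I" "t2 \<in> I" "A \<in> sets (count_space UNIV)"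
  shows "(\<lambda>w. X t1 w - X t2 w :: nat) -` A \<inter> space \<Omega> \<in> generated (count_space UNIV) X I"
proof -
  let ?N = "sigma (space \<Omega>) (generated (count_space UNIV) X I)"
  have sp: "space ?N = space \<Omega>" by (rule space_measure_of[OF generated_subset_Pow])
  have "(\<lambda>w. X t1 w - X t2 w) \<in> measurable ?N (count_space UNIV)"
    using generated_measurable[OF assms(1) sets_generated sp] generated_measurable[OF assms(2) sets_generated sp]
    by measurable
  from measurable_sets[OF this assms(3)] show ?thesis unfolding sp sets_generated .
qed

text \<open>Increments of one process over consecutive cells are independent by the definition of a Poisson process, marks by
  assumption, and different sources by the independence assumption of the model. These combine to joint independence.\<close>

lemma grid_noise_instance:
  assumes n: "1 \<le> n" "c n \<le> n" and lam: "0 < lam" and d: "0 < d n"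
  shows "grid_noise \<Omega> (\<lambda>w. (S0 n w, M0 n w)) (incr d n) (\<lambda>s j. mark s (Suc j)) ini_sets (\<lambda>s. rate n s * (real n * d n))"
proof -
  let ?ns = "\<lambda>x. case x of
        Inc s k \<Rightarrow> {incr d n s k -` A \<inter> space \<Omega> | A. A \<in> sets (count_space UNIV)}
      | Mark s j \<Rightarrow> {mark s (Suc j) -` A \<inter> space \<Omega> | A. A \<in> sets borel}
      | Ini \<Rightarrow> ini_sets"
  define tau where "tau k = real n * (d n * real k)" for k :: nat
  have tau: "0 \<le> tau k" "tau k < tau (Suc k)" for k using n d by (auto simp: tau_def)
  have tau_mono: "mono tau" unfolding mono_def tau_def using n d by (auto intro!: mult_left_mono)
  have tau_diff: "tau (Suc k) - tau k = real n * d n" for k by (simp add: tau_def algebra_simps)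
  have inc_eq: "incr d n s k = (\<lambda>w. proc n s (tau (Suc k)) w - proc n s (tau k) w)" for s k
    by (auto simp: incr_def tau_def)
  have iv: "indep_vars (\<lambda>_. count_space UNIV) (\<lambda>k w. proc n s (tau (Suc k)) w - proc n s (tau k) w) UNIV" for s
    using proc_poisson[OF n(1), of s] tau_mono tau unfolding poisson_process_def by blast
  have incm: "incr d n s k \<in> measurable \<Omega> (count_space UNIV)" for s k
    using iv[of s] unfolding indep_vars_def inc_eq by auto
  have mv: "indep_vars (\<lambda>_. borel) (mark s) {1..}" for s
    using mark_uniform[of s] by (simp add: iid_uniform_def)
  have mm: "mark s (Suc j) \<in> borel_measurable \<Omega>" for s j
    using mv[of s] unfolding indep_vars_def by auto
  have src: "src_sets k \<subseteq> events" for k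
    using independence unfolding src_sets_def[symmetric] ini_sets_def[symmetric] by (auto simp: indep_sets_def)
  have "indep_sets ?ns UNIV"
  proof (rule indep_sets_refine_by[where F=src_sets and I=UNIV and g=src_of])
    show "indep_sets src_sets UNIV"
      using independence unfolding src_sets_def[abs_def] ini_sets_def .
    show "Int_stable (src_sets i)" for i
    proof -
      have "Int_stable ini_sets"
        unfolding ini_sets_def by (rule Int_stable_sigma_sets[OF ini_generators_Pow])
      then show ?thesis unfolding src_sets_def
        by (cases i) (auto intro: generated_Int_stable)
    qed
    have fI: "indep_sets ?ns (range (Inc s))" for s
    proof (rule indep_sets_image)
      show "indep_sets (\<lambda>i. ?ns (Inc s i)) UNIV"
        using iv[of s] unfolding indep_vars_def2 inc_eq noise.case by blast
    qed (auto simp: inj_on_def)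
    have fM: "indep_sets ?ns (range (Mark s))" for s
    proof -
      have "indep_sets (\<lambda>j. {mark s j -` A \<inter> space \<Omega> | A. A \<in> sets borel}) {1..}"
        using mv[of s] unfolding indep_vars_def2 by blast
      then have "indep_sets (\<lambda>j. ?ns (Mark s (j - 1))) {1..}"
        by (subst indep_sets_cong[OF refl]) auto
      then have "indep_sets ?ns ((\<lambda>j. Mark s (j - 1)) ` {1..})"
        by (rule indep_sets_image) (auto simp: inj_on_def)
      moreover have "(\<lambda>j. Mark s (j - 1)) ` {1..} = range (Mark s)"
      proof safe
        fix k show "Mark s k \<in> (\<lambda>j. Mark s (j - 1)) ` {1..}" by (intro image_eqI[of _ _ "Suc k"]) auto
      qed auto
      ultimately show ?thesis by simp
    qed
    have fi: "indep_sets ?ns {Ini}"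
    proof (rule indep_setsI)
      show "?ns x \<subseteq> events" if "x \<in> {Ini}" for x using src[of Src_Initial] that by (simp add: src_sets_def)
      show "prob (\<Inter>j\<in>J. A j) = (\<Prod>j\<in>J. prob (A j))" if "J \<noteq> {}" "J \<subseteq> {Ini}" for A J
      proof -
        have "J = {Ini}" using that by blast
        then show ?thesis by simp
      qed
    qed
    show "indep_sets ?ns {x\<in>UNIV. src_of x = i}" for i
    proof -
      have "{x\<in>UNIV. src_of x = i} = (case i of Src_Arrivals \<Rightarrow> range (Inc Arrival) | Src_Services \<Rightarrow> range (Inc Service)
         | Src_Messages \<Rightarrow> range (Inc Message) | Src_U \<Rightarrow> range (Mark Arrival) | Src_V \<Rightarrow> range (Mark Message)
         | Src_W \<Rightarrow> range (Mark Service) | Src_Initial \<Rightarrow> {Ini})"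
      proof (rule set_eqI)
        fix x
        show "x \<in> {x\<in>UNIV. src_of x = i} \<longleftrightarrow> x \<in> (case i of Src_Arrivals \<Rightarrow> range (Inc Arrival) | Src_Services \<Rightarrow> range (Inc Service)
         | Src_Messages \<Rightarrow> range (Inc Message) | Src_U \<Rightarrow> range (Mark Arrival) | Src_V \<Rightarrow> range (Mark Message)
         | Src_W \<Rightarrow> range (Mark Service) | Src_Initial \<Rightarrow> {Ini})"
          by (cases x rule: src_of.cases; cases i; simp add: image_iff)
      qed
      then show ?thesis using fI fM fi by (cases i) auto
    qed
    show "?ns x \<subseteq> src_sets (src_of x)" for x
    proof (cases x)
      case (Inc s k)
      have "(\<lambda>w. X (tau (Suc k)) w - X (tau k) w) -` A \<inter> space \<Omega> \<in> generated (count_space UNIV) X {0..}" for X :: "real \<Rightarrow> 'w \<Rightarrow> nat" and A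
        by (rule incr_generated) (use tau in auto)
      moreover have "(\<lambda>w. (\<lambda>(n, t). N_mu n t) (n, tau (Suc k)) w - (\<lambda>(n, t). N_mu n t) (n, tau k) w) -` A \<inter> space \<Omega>
         \<in> generated (count_space UNIV) (\<lambda>(n, t). N_mu n t) ({1..} \<times> {0..})" for A
        by (rule incr_generated) (use tau n in auto)
      ultimately show ?thesis unfolding Inc by (cases s) (auto simp: src_sets_def inc_eq proc_def)
    next
      case (Mark s j)
      show ?thesis unfolding Mark by (cases s) (auto simp: src_sets_def generated_def mark_def)
    next
      case Ini
      then show ?thesis by (simp add: src_sets_def)
    qed
  qed auto
  then show ?thesis
  proof (unfold_locales)
    show "Int_stable ini_sets" unfolding ini_sets_def
      by (rule Int_stable_sigma_sets[OF ini_generators_Pow])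
    show "(\<lambda>w. (S0 n w, M0 n w)) \<in> measurable (sigma (space \<Omega>) ini_sets) state_measure" by (rule ini_measurable[OF n])
    show "incr d n s k \<in> measurable \<Omega> (count_space UNIV)" for s k by (rule incm)
    show "mark s (Suc j) \<in> borel_measurable \<Omega>" for s j by (rule mm)
    show "distr \<Omega> (count_space UNIV) (incr d n s k) = measure_pmf (poisson_pmf (rate n s * (real n * d n)))" for s k
    proof -
      have "distr \<Omega> (count_space UNIV) (\<lambda>w. proc n s (tau (Suc k)) w - proc n s (tau k) w) =
          measure_pmf (poisson_pmf (rate n s * (tau (Suc k) - tau k)))"
        using proc_poisson[OF n(1), of s] tau[of k] unfolding poisson_process_def by blast
      then show ?thesis unfolding inc_eq tau_diff .
    qed
    show "0 < rate n s * (real n * d n)" for s using rate_pos[OF lam n(1), of s] n d by simp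
    show "distr \<Omega> borel (mark s (Suc j)) = uniform_measure lborel {0..1}" for s j
      using mark_uniform[of s] by (simp add: iid_uniform_def)
  qed
qed

lemma AE_mark_bounds: "AE w in \<Omega>. \<forall>s j. 1 \<le> j \<longrightarrow> 0 \<le> mark s j w \<and> mark s j w < 1"
proof -
  have "AE w in \<Omega>. 0 \<le> mark s j w \<and> mark s j w < 1" if j: "1 \<le> j" for s j
  proof -
    have m: "mark s j \<in> borel_measurable \<Omega>"
      using mark_uniform[of s] j unfolding iid_uniform_def indep_vars_def by auto
    have d: "distr \<Omega> borel (mark s j) = uniform_measure lborel {0..1}"
      using mark_uniform[of s] j by (simp add: iid_uniform_def)
    interpret D: prob_space "distr \<Omega> borel (mark s j)" using m by (rule prob_space_distr)
    have "len (0, 1) = 1" by (simp add: len_def)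
    then have "measure (distr \<Omega> borel (mark s j)) {x. hit (0, 1) x} = 1" unfolding d prob_uniform_interval .
    moreover have "{x. hit (0, 1) x} \<in> sets borel"
    proof -
      have "{x. hit (0, 1) x} = {0..<1::real}" by (auto simp: hit_def)
      then show ?thesis by simp
    qed
    ultimately have "AE x in distr \<Omega> borel (mark s j). hit (0, 1) x"
      using D.AE_prob_1[of "{x. hit (0, 1) x}"] by simp
    moreover have "Measurable.pred borel (hit (0::real, 1::real))" unfolding hit_def[abs_def] by measurable
    ultimately have "AE w in \<Omega>. hit (0, 1) (mark s j w)"
      using AE_distr_iff[OF m, of "hit (0, 1)"] by (simp add: pred_def)
    then show ?thesis by (simp add: hit_def)
  qed
  then have "AE w in \<Omega>. 1 \<le> j \<longrightarrow> 0 \<le> mark s j w \<and> mark s j w < 1" for s j by (cases "1 \<le> j") auto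
  then have "AE w in \<Omega>. \<forall>j. 1 \<le> j \<longrightarrow> 0 \<le> mark s j w \<and> mark s j w < 1" for s
    by (subst AE_all_countable) auto
  then have "AE w in \<Omega>. (\<forall>j. 1 \<le> j \<longrightarrow> 0 \<le> mark Arrival j w \<and> mark Arrival j w < 1) \<and>
     (\<forall>j. 1 \<le> j \<longrightarrow> 0 \<le> mark Service j w \<and> mark Service j w < 1) \<and>
     (\<forall>j. 1 \<le> j \<longrightarrow> 0 \<le> mark Message j w \<and> mark Message j w < 1)"
    by (intro AE_conjI)
  then show ?thesis by (rule AE_mp) (auto intro!: AE_I2, (case_tac s, auto)+)
qed

lemma AE_sample_path:
  assumes n: "1 \<le> n" "c n \<le> n" and d: "0 < d n"
  shows "AE w in \<Omega>. (\<forall>k<K. (\<Sum>s\<in>{Arrival, Service, Message}. incr d n s k w) \<le> 1) \<longrightarrow>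
     sample_path n (c n) (\<lambda>s t. proc n s (real n * t) w) (\<lambda>s j. mark s j w) (\<lambda>t. S n t w) (\<lambda>t. M n t w)
       (S0 n w) (M0 n w) (d n) K"
proof -
  have P: "AE w in \<Omega>. proc n s 0 w = 0 \<and> mono_on {0..} (\<lambda>t. proc n s t w) \<and>
        (\<forall>t\<ge>0. continuous (at_right t) (\<lambda>u. proc n s u w))" for s
    using proc_poisson[OF n(1), of s] unfolding poisson_process_def by blast
  have "AE w in \<Omega>. \<forall>s. proc n s 0 w = 0 \<and> mono_on {0..} (\<lambda>t. proc n s t w) \<and>
        (\<forall>t\<ge>0. continuous (at_right t) (\<lambda>u. proc n s u w))"
  proof -
    have "AE w in \<Omega>. \<forall>s\<in>{Arrival, Service, Message}. proc n s 0 w = 0 \<and> mono_on {0..} (\<lambda>t. proc n s t w) \<and>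
        (\<forall>t\<ge>0. continuous (at_right t) (\<lambda>u. proc n s u w))"
      by (rule AE_finite_allI) (use P in auto)
    then show ?thesis
    proof eventually_elim
      case (elim w)
      have "s \<in> {Arrival, Service, Message}" for s by (cases s) auto
      then show ?case using elim by blast
    qed
  qed
  with AE_mark_bounds initial[OF n] S_evolution[OF n] M_evolution[OF n]
  show ?thesis
  proof eventually_elim
    case (elim w)
    show ?case
    proof
      assume single: "\<forall>k<K. (\<Sum>s\<in>{Arrival, Service, Message}. incr d n s k w) \<le> 1"
      show "sample_path n (c n) (\<lambda>s t. proc n s (real n * t) w) (\<lambda>s j. mark s j w) (\<lambda>t. S n t w) (\<lambda>t. M n t w)
       (S0 n w) (M0 n w) (d n) K"
      proof
        show "0 < n" using n by simp
        show "0 < d n" by (rule d)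
        show "mono_on {0..} (\<lambda>t. proc n s (real n * t) w)" for s
        proof (rule mono_onI)
          fix t t' :: real assume "t \<in> {0..}" "t' \<in> {0..}" "t \<le> t'"
          then show "proc n s (real n * t) w \<le> proc n s (real n * t') w"
            using elim(5) by (auto intro!: mono_onD[of "{0..}" "\<lambda>t. proc n s t w"] mult_left_mono)
        qed
        show "proc n s (real n * 0) w = 0" for s using elim(5) by simp
        show "continuous (at_right t) (\<lambda>t. proc n s (real n * t) w)" if t: "0 \<le> t" for s t
        proof -
          have "((\<lambda>u. proc n s u w) \<longlongrightarrow> proc n s (real n * t) w) (at_right (real n * t))"
            using elim(5) t by (simp add: continuous_within)
          moreover have "filterlim (\<lambda>u. real n * u) (at_right (real n * t)) (at_right t)"
            unfolding filterlim_at
          proof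
            show "\<forall>\<^sub>F x in at_right t. real n * x \<in> {real n * t<..} \<and> real n * x \<noteq> real n * t"
              using eventually_at_right_less[of t] by eventually_elim (use n in auto)
            show "((*) (real n) \<longlongrightarrow> real n * t) (at_right t)" by (intro tendsto_intros)
          qed
          ultimately have "((\<lambda>u. proc n s (real n * u) w) \<longlongrightarrow> proc n s (real n * t) w) (at_right t)"
            by (rule filterlim_compose)
          then show ?thesis by (simp add: continuous_within)
        qed
        show "0 \<le> mark s j w \<and> mark s j w < 1" if "1 \<le> j" for s j using elim(1) that by blast
        show "S n t w i = S0 n w i + arrivals n (c n) (\<lambda>t. proc n Arrival (real n * t) w) (\<lambda>j. mark Arrival j w) (\<lambda>t. S n t w) (\<lambda>t. M n t w) i t
           - departures n (\<lambda>t. proc n Service (real n * t) w) (\<lambda>j. mark Service j w) (\<lambda>t. S n t w) i t" if "0 \<le> t" for t i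
          using elim(3) that by (simp add: proc_def mark_def)
        show "real (M n t w) = real (M0 n w) + token_change n (c n) (\<lambda>t. proc n Arrival (real n * t) w) (\<lambda>t. proc n Message (real n * t) w)
            (\<lambda>j. mark Message j w) (\<lambda>t. S n t w) (\<lambda>t. M n t w) t" if "0 \<le> t" for t
          using elim(4) that by (simp add: proc_def mark_def)
        show "valid n (c n) (S0 n w, M0 n w)"
          using elim(2) Nats_subset_Ints by (auto simp: valid_def state_space_1_def state_space_def grid_def)
        show "(\<Sum>s\<in>{Arrival, Service, Message}. proc n s (real n * (d n * real (Suc k))) w - proc n s (real n * (d n * real k)) w) \<le> 1"
          if "k < K" for k using single that unfolding incr_def by blast
      qed
    qed
  qed
qed

end

lemma (in prob_space) AE_eventually_summable:
  assumes E: "\<And>n. P n \<Longrightarrow> \<exists>E\<in>events. prob E \<le> b n \<and> (\<forall>w\<in>space M - E. Q n w)"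
    and P: "eventually P sequentially" and b: "summable b" "\<And>n. 0 \<le> b n"
  shows "AE w in M. \<forall>\<^sub>F n in sequentially. Q n w"
proof -
  have "\<forall>n. \<exists>E\<in>events. P n \<longrightarrow> prob E \<le> b n \<and> (\<forall>w\<in>space M - E. Q n w)" using E by (metis sets.empty_sets)
  then obtain E' where E': "\<And>n. E' n \<in> events" "\<And>n. P n \<Longrightarrow> prob (E' n) \<le> b n"
     "\<And>n w. P n \<Longrightarrow> w \<in> space M - E' n \<Longrightarrow> Q n w" by metis
  define F where "F n = (if P n then E' n else {})" for n
  have F: "F n \<in> events" for n using E' by (simp add: F_def)
  have "prob (F n) \<le> b n" for n using E'(2) b(2) by (simp add: F_def)
  then have "summable (\<lambda>n. prob (F n))"
    by (intro summable_comparison_test'[OF b(1), of 0]) auto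
  then have "AE w in M. \<forall>\<^sub>F n in sequentially. w \<in> space M - F n"
    using F by (intro borel_cantelli_AE1) (auto simp: emeasure_eq_measure)
  then show ?thesis
  proof (rule AE_mp, intro AE_I2 impI)
    fix w assume "\<forall>\<^sub>F n in sequentially. w \<in> space M - F n"
    then show "\<forall>\<^sub>F n in sequentially. Q n w"
      using P by eventually_elim (auto simp: F_def intro: E'(3))
  qed
qed

text \<open>The exponent of the compensator in \<open>counts_concentrate\<close>; it is \<open>t\<close> to first order, so that small
  exponents of either sign give matching upper and lower bounds.\<close>

definition expexp :: "real \<Rightarrow> real" where "expexp t = exp (exp t - 1) - 1"

lemma expexp_quotient_limit: "((\<lambda>t. expexp t / t) \<longlongrightarrow> 1) (at 0)"
proof -
  have "(expexp has_real_derivative 1) (at 0)"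
    unfolding expexp_def[abs_def] by (auto intro!: derivative_eq_intros)
  then show ?thesis by (simp add: DERIV_def expexp_def)
qed

text \<open>Small positive exponents give the upper and small negative ones the lower bound. Countably many exponents
  suffice, which matters because each of them costs a null set.\<close>

lemma unif_null_of_exponential_bounds:
  fixes C Q :: "nat \<Rightarrow> nat \<Rightarrow> real" and \<pi> d :: "nat \<Rightarrow> real" and r :: real
  assumes bound: "\<And>t \<epsilon>. t \<in> range (\<lambda>j. 1 / real (Suc j)) \<union> range (\<lambda>j. - 1 / real (Suc j)) \<Longrightarrow> \<epsilon> \<in> range (\<lambda>j. 1 / real (Suc j)) \<Longrightarrow>
      \<forall>\<^sub>F n in sequentially. \<forall>k\<le>K n. t * C n k \<le> expexp t * \<pi> n * Q n k + 2 * (\<epsilon> * real n)"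
    and Q: "\<And>n k. 0 \<le> Q n k" "\<And>n k. Q n k \<le> real k"
    and d: "\<And>n. 0 < d n" "\<And>n. d n * real (K n) \<le> B" "(\<lambda>n. real n * d n) \<longlonglongrightarrow> 0"
    and r: "0 \<le> r" and \<pi>: "\<And>n. \<pi> n \<le> r * (real n * d n)" "\<And>n. r * (real n * d n) - (r * (real n * d n))\<^sup>2 \<le> \<pi> n" "\<And>n. 0 \<le> \<pi> n"
  shows "unif_null K (\<lambda>n k. C n k / real n - r * d n * Q n k)"
  unfolding unif_null_def
proof (intro allI impI)
  fix \<epsilon> :: real assume \<epsilon>: "0 < \<epsilon>"
  have B0: "0 \<le> B" using d(1)[of 0] d(2)[of 0] by (meson mult_nonneg_nonneg of_nat_0_le_iff order_trans less_imp_le)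
  have rB: "0 \<le> r * B" using r B0 by simp
  \<comment> \<open>The three errors, from the quotient of \<open>expexp\<close>, from the exponential bound and from \<open>\<pi>\<close>, get \<open>\<epsilon> / 3\<close> each.\<close>
  define \<delta> where "\<delta> = \<epsilon> / (3 * (r * B + 1))"
  have \<delta>: "0 < \<delta>" using \<epsilon> rB by (simp add: \<delta>_def)
  have \<delta>rB: "\<delta> * (r * B) \<le> \<epsilon> / 3"
  proof -
    have "\<delta> * (r * B) \<le> \<delta> * (r * B + 1)" using \<delta> by (intro mult_left_mono) auto
    also have "\<dots> = \<epsilon> / 3" using rB by (simp add: \<delta>_def field_simps)
    finally show ?thesis .
  qed
  have lim: "(\<lambda>j. 1 / real (Suc j)) \<longlonglongrightarrow> 0" using LIMSEQ_inverse_real_of_nat by (simp add: inverse_eq_divide)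
  have fp: "filterlim (\<lambda>j. 1 / real (Suc j)) (at 0) sequentially"
    unfolding filterlim_at using lim by (auto intro!: always_eventually)
  have fm: "filterlim (\<lambda>j. - 1 / real (Suc j)) (at 0) sequentially"
    unfolding filterlim_at using tendsto_minus[OF lim] by (auto intro!: always_eventually)
  have "\<forall>\<^sub>F j in sequentially. \<bar>expexp (1 / real (Suc j)) / (1 / real (Suc j)) - 1\<bar> < \<delta>"
    using tendstoD[OF filterlim_compose[OF expexp_quotient_limit fp] \<delta>] by (simp add: dist_real_def)
  moreover have "\<forall>\<^sub>F j in sequentially. \<bar>expexp (- 1 / real (Suc j)) / (- 1 / real (Suc j)) - 1\<bar> < \<delta>"
    using tendstoD[OF filterlim_compose[OF expexp_quotient_limit fm] \<delta>] by (simp add: dist_real_def)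
  ultimately have "\<forall>\<^sub>F j in sequentially. \<bar>expexp (1 / real (Suc j)) / (1 / real (Suc j)) - 1\<bar> < \<delta> \<and> \<bar>expexp (- 1 / real (Suc j)) / (- 1 / real (Suc j)) - 1\<bar> < \<delta>"
    by (rule eventually_conj)
  then obtain j where j: "\<bar>expexp (1 / real (Suc j)) / (1 / real (Suc j)) - 1\<bar> < \<delta>" "\<bar>expexp (- 1 / real (Suc j)) / (- 1 / real (Suc j)) - 1\<bar> < \<delta>"
    unfolding eventually_sequentially by blast
  define \<eta> where "\<eta> = 1 / real (Suc j)"
  have \<eta>: "0 < \<eta>" by (simp add: \<eta>_def)
  have j': "\<bar>expexp \<eta> / \<eta> - 1\<bar> < \<delta>" "\<bar>expexp (- \<eta>) / (- \<eta>) - 1\<bar> < \<delta>" using j unfolding \<eta>_def by auto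
  obtain i where i: "1 / real (Suc i) < \<epsilon> * \<eta> / 6" using reals_Archimedean[of "\<epsilon> * \<eta> / 6"] \<epsilon> \<eta> by (auto simp: inverse_eq_divide)
  define e where "e = 1 / real (Suc i)"
  have "e < \<epsilon> * \<eta> / 6" using i by (simp only: e_def)
  then have e: "2 * e / \<eta> \<le> \<epsilon> / 3" using \<eta> by (simp add: divide_le_eq)
  have bp: "\<forall>\<^sub>F n in sequentially. \<forall>k\<le>K n. \<eta> * C n k \<le> expexp \<eta> * \<pi> n * Q n k + 2 * (e * real n)"
    by (rule bound) (auto simp: \<eta>_def e_def)
  have bm: "\<forall>\<^sub>F n in sequentially. \<forall>k\<le>K n. (- \<eta>) * C n k \<le> expexp (- \<eta>) * \<pi> n * Q n k + 2 * (e * real n)"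
    by (rule bound) (auto simp: \<eta>_def e_def)
  have "(\<lambda>n. r * (r * B) * (real n * d n)) \<longlonglongrightarrow> 0" using tendsto_mult_left[OF d(3), of "r * (r * B)"] by simp
  then have nd: "\<forall>\<^sub>F n in sequentially. r * (r * B) * (real n * d n) < \<epsilon> / 3" by (rule order_tendstoD) (use \<epsilon> in simp)
  from bp bm nd eventually_gt_at_top[of 0]
  show "\<forall>\<^sub>F n in sequentially. \<forall>k\<le>K n. \<bar>C n k / real n - r * d n * Q n k\<bar> \<le> \<epsilon>"
  proof eventually_elim
    case (elim n)
    have n: "0 < real n" using elim by simp
    show ?case
    proof (intro allI impI)
      fix k assume k: "k \<le> K n"
      define q where "q = d n * Q n k"
      define u where "u = \<pi> n * Q n k / real n"
      have q: "0 \<le> q" "q \<le> B"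
      proof -
        have "d n * Q n k \<le> d n * real (K n)" using Q[of n k] d(1)[of n] k
          by (intro mult_left_mono) (auto intro: order_trans)
        then show "q \<le> B" using d(2)[of n] by (simp add: q_def)
      qed (use Q d(1)[of n] in \<open>simp add: q_def less_imp_le\<close>)
      have u_up: "u \<le> r * q"
      proof -
        have "\<pi> n * Q n k \<le> r * (real n * d n) * Q n k" using \<pi>(1) Q by (intro mult_right_mono) auto
        then show ?thesis using n by (simp add: u_def q_def divide_le_eq mult_ac)
      qed
      have u_lo: "r * q - r * (r * B) * (real n * d n) \<le> u"
      proof -
        have "(r * (real n * d n) - (r * (real n * d n))\<^sup>2) * Q n k \<le> \<pi> n * Q n k" using \<pi>(2) Q by (intro mult_right_mono) auto
        then have "(r * (real n * d n) - (r * (real n * d n))\<^sup>2) * Q n k / real n \<le> u" using n by (simp add: u_def divide_right_mono)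
        moreover have "(r * (real n * d n) - (r * (real n * d n))\<^sup>2) * Q n k / real n = r * q - r * (r * q) * (real n * d n)"
          using n by (simp add: q_def power2_eq_square field_simps)
        moreover have "r * (r * q) * (real n * d n) \<le> r * (r * B) * (real n * d n)"
          using q r n d(1)[of n] by (intro mult_right_mono mult_left_mono) auto
        ultimately show ?thesis by linarith
      qed
      have u0: "0 \<le> u" using \<pi>(3) Q n by (simp add: u_def)
      have uB: "u \<le> r * B" using u_up mult_left_mono[OF q(2) r] by linarith
      have up: "C n k / real n - r * q \<le> \<epsilon>"
      proof -
        have "\<eta> * C n k \<le> expexp \<eta> * \<pi> n * Q n k + 2 * (e * real n)" using elim k by blast
        then have "C n k / real n \<le> (expexp \<eta> / \<eta>) * u + 2 * e / \<eta>"
          using \<eta> n by (simp add: u_def field_simps)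
        also have "(expexp \<eta> / \<eta>) * u \<le> (1 + \<delta>) * u" using j'(1) u0 by (intro mult_right_mono) auto
        also have "(1 + \<delta>) * u = u + \<delta> * u" by (simp add: algebra_simps)
        also have "\<delta> * u \<le> \<delta> * (r * B)" using uB \<delta> by (intro mult_left_mono) auto
        finally show ?thesis using u_up \<delta>rB e \<epsilon> by linarith
      qed
      have lo: "- \<epsilon> \<le> C n k / real n - r * q"
      proof -
        have "(- \<eta>) * C n k \<le> expexp (- \<eta>) * \<pi> n * Q n k + 2 * (e * real n)" using elim k by blast
        then have "(- \<eta>) * C n k / (\<eta> * real n) \<le> (expexp (- \<eta>) * \<pi> n * Q n k + 2 * (e * real n)) / (\<eta> * real n)"
          using \<eta> n by (intro divide_right_mono) auto
        moreover have "(- \<eta>) * C n k / (\<eta> * real n) = - (C n k / real n)" using \<eta> by simp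
        moreover have "(expexp (- \<eta>) * \<pi> n * Q n k + 2 * (e * real n)) / (\<eta> * real n) = - ((expexp (- \<eta>) / (- \<eta>)) * u) + 2 * e / \<eta>"
          using \<eta> n by (simp add: u_def add_divide_distrib)
        ultimately have "(expexp (- \<eta>) / (- \<eta>)) * u - 2 * e / \<eta> \<le> C n k / real n" by linarith
        moreover have "(1 - \<delta>) * u \<le> (expexp (- \<eta>) / (- \<eta>)) * u" using j'(2) u0 by (intro mult_right_mono) auto
        moreover have "(1 - \<delta>) * u = u - \<delta> * u" by (simp add: algebra_simps)
        moreover have "\<delta> * u \<le> \<delta> * (r * B)" using uB \<delta> by (intro mult_left_mono) auto
        ultimately show ?thesis using u_lo elim(3) \<delta>rB e by linarith
      qed
      have eq: "r * d n * Q n k = r * q" by (simp add: q_def)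
      show "\<bar>C n k / real n - r * d n * Q n k\<bar> \<le> \<epsilon>" unfolding eq using up lo by (intro abs_leI) linarith+
    qed
  qed
qed

lemma in_regime_eventually_le:
  assumes "in_regime R c mu" shows "\<forall>\<^sub>F n in sequentially. 1 \<le> n \<and> c n \<le> n"
proof (cases R)
  case (High_Memory m)
  then have "(\<lambda>n. real (c n) / real n) \<longlonglongrightarrow> 0" using assms by simp
  then have "\<forall>\<^sub>F n in sequentially. real (c n) / real n < 1" by (rule order_tendstoD) simp
  with eventually_ge_at_top[of 1] show ?thesis by eventually_elim (simp add: divide_less_eq)
next
  case (High_Message k)
  then have "\<forall>n\<ge>1. c n = k" using assms by simp
  then show ?thesis using eventually_ge_at_top[of "max 1 k"] by (auto elim: eventually_mono)
next
  case (Constrained k m)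
  then have "\<forall>n\<ge>1. c n = k" using assms by simp
  then show ?thesis using eventually_ge_at_top[of "max 1 k"] by (auto elim: eventually_mono)
qed

text \<open>The mesh makes the expected number of crowded cells summable in \<open>n\<close>, however fast the message rate grows.
  The summand \<open>2\<close> bounds the other two rates, and the absolute value keeps the mesh positive at \<open>n = 0\<close>.\<close>

definition mesh :: "(nat \<Rightarrow> real) \<Rightarrow> nat \<Rightarrow> real" where
  "mesh mu n = 1 / (real (Suc n) ^ 4 * (2 + \<bar>mu n\<bar>)\<^sup>2)"

lemma mesh_pos: "0 < mesh mu n"
  by (auto simp: mesh_def intro!: divide_pos_pos mult_pos_pos add_pos_nonneg)

lemma mesh_bounds:
  shows "real n * mesh mu n * (2 + \<bar>mu n\<bar>) \<le> 1 / real (Suc n)" "mesh mu n \<le> 1 / real (Suc n)"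
    "(real n)\<^sup>2 * mesh mu n * (2 + \<bar>mu n\<bar>)\<^sup>2 \<le> 1 / (real (Suc n))\<^sup>2"
proof -
  define N m where "N = real (Suc n)" and "m = 2 + \<bar>mu n\<bar>"
  have N: "1 \<le> N" "real n \<le> N" and m: "2 \<le> m" by (auto simp: N_def m_def)
  have mesh: "mesh mu n = 1 / (N ^ 4 * m\<^sup>2)" by (simp add: mesh_def N_def m_def)
  have pos: "0 < N" "0 < m" using N m by auto
  have "real n * (1 / (N ^ 4 * m\<^sup>2)) * m = real n / (N ^ 4 * m)" using pos by (simp add: power2_eq_square)
  also have "\<dots> \<le> N / (N ^ 4 * m)" using N pos by (intro divide_right_mono) auto
  also have "\<dots> = 1 / (N ^ 3 * m)" using pos by (simp add: power_def numeral_eq_Suc)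
  also have "\<dots> \<le> 1 / N"
  proof (rule divide_left_mono)
    have "N * 1 \<le> N * (N\<^sup>2 * m)" using N m pos mult_mono[of 1 "N\<^sup>2" 1 m] by (intro mult_left_mono) auto
    then show "N \<le> N ^ 3 * m" by (simp add: power2_eq_square power3_eq_cube mult_ac)
  qed (use pos in auto)
  finally show "real n * mesh mu n * (2 + \<bar>mu n\<bar>) \<le> 1 / real (Suc n)" by (simp add: mesh N_def m_def)
  have "1 / (N ^ 4 * m\<^sup>2) \<le> 1 / N"
  proof (rule divide_left_mono)
    have "N * 1 \<le> N * (N ^ 3 * m\<^sup>2)" using N m pos mult_mono[of 1 "N ^ 3" 1 "m\<^sup>2"] by (intro mult_left_mono) auto
    then show "N \<le> N ^ 4 * m\<^sup>2" by (simp add: power_def numeral_eq_Suc mult_ac)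
  qed (use pos in auto)
  then show "mesh mu n \<le> 1 / real (Suc n)" by (simp add: mesh N_def)
  have "(real n)\<^sup>2 * (1 / (N ^ 4 * m\<^sup>2)) * m\<^sup>2 = (real n)\<^sup>2 / N ^ 4" using pos by simp
  also have "\<dots> \<le> N\<^sup>2 / N ^ 4" using N pos by (intro divide_right_mono power_mono) auto
  also have "\<dots> = 1 / N\<^sup>2" using pos by (simp add: power_def numeral_eq_Suc)
  finally show "(real n)\<^sup>2 * mesh mu n * (2 + \<bar>mu n\<bar>)\<^sup>2 \<le> 1 / (real (Suc n))\<^sup>2" by (simp add: mesh N_def m_def)
qed

lemma LIMSEQ_inverse_Suc: "(\<lambda>n. 1 / real (Suc n)) \<longlonglongrightarrow> 0"
  using LIMSEQ_inverse_real_of_nat by (simp add: inverse_eq_divide)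

lemma mesh_null: "mesh mu \<longlonglongrightarrow> 0"
  by (rule tendsto_sandwich[OF _ _ tendsto_const LIMSEQ_inverse_Suc])
    (rule always_eventually, rule allI, rule less_imp_le[OF mesh_pos],
     rule always_eventually, rule allI, rule mesh_bounds(2))

lemma n_mesh_null: "(\<lambda>n. real n * mesh mu n * (2 + \<bar>mu n\<bar>)) \<longlonglongrightarrow> 0"
  by (rule tendsto_sandwich[OF _ _ tendsto_const LIMSEQ_inverse_Suc])
    (simp add: less_imp_le[OF mesh_pos], rule always_eventually, rule allI, rule mesh_bounds(1))

definition cells :: "real \<Rightarrow> (nat \<Rightarrow> real) \<Rightarrow> nat \<Rightarrow> nat" where
  "cells T mu n = nat \<lceil>T / mesh mu n\<rceil>"

lemma cells_bounds:
  assumes "0 < T"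
  shows "T \<le> mesh mu n * real (cells T mu n)" "mesh mu n * real (cells T mu n) \<le> T + 1"
proof -
  have pos: "0 < T / mesh mu n" using assms mesh_pos[of mu n] by simp
  have r: "real (cells T mu n) = of_int \<lceil>T / mesh mu n\<rceil>" unfolding cells_def using pos by (simp add: less_imp_le)
  have "T / mesh mu n \<le> real (cells T mu n)" "real (cells T mu n) \<le> T / mesh mu n + 1"
    unfolding r using le_of_int_ceiling of_int_ceiling_le_add_one by blast+
  then have 1: "T \<le> real (cells T mu n) * mesh mu n" and 2: "real (cells T mu n) * mesh mu n \<le> (T / mesh mu n + 1) * mesh mu n"
    using mesh_pos[of mu n] by (simp_all add: divide_le_eq mult_right_mono)
  show "T \<le> mesh mu n * real (cells T mu n)" using 1 by (simp add: mult.commute)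
  have "(T / mesh mu n + 1) * mesh mu n = T + mesh mu n" using mesh_pos[of mu n] by (simp add: distrib_right)
  moreover have "mesh mu n \<le> 1" using mesh_bounds(2)[of mu n] by (rule order_trans) simp
  ultimately show "mesh mu n * real (cells T mu n) \<le> T + 1" using 2 by (simp add: mult.commute)
qed

context coupled_system
begin

abbreviation inc where "inc n s k w \<equiv> incr (mesh mu) n s k w"

text \<open>The notions of \<open>grid_noise\<close> for the \<open>n\<close>-th system. They are defined for every \<open>n\<close>, while the
  locale can be interpreted only where the \<open>n\<close>-th system exists.\<close>

definition grid_state :: "nat \<Rightarrow> nat \<Rightarrow> 'w \<Rightarrow> (nat \<Rightarrow> real) \<times> nat" where
  "grid_state n k w = chain n (c n) (S0 n w, M0 n w) (\<lambda>s l. inc n s l w) (\<lambda>s j. mark s (Suc j) w) k"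

definition hit_count :: "nat \<Rightarrow> flow \<Rightarrow> ((nat \<Rightarrow> real) \<times> nat \<Rightarrow> real \<times> real) \<Rightarrow> nat \<Rightarrow> 'w \<Rightarrow> real" where
  "hit_count n s iv k w = (\<Sum>l<k. of_bool (1 \<le> inc n s l w \<and> hit (iv (grid_state n l w)) (mark s (Suc (\<Sum>m<l. inc n s m w)) w)))"

definition hit_mass :: "nat \<Rightarrow> ((nat \<Rightarrow> real) \<times> nat \<Rightarrow> real \<times> real) \<Rightarrow> nat \<Rightarrow> 'w \<Rightarrow> real" where
  "hit_mass n iv k w = (\<Sum>l<k. len (iv (grid_state n l w)))"

definition uncrowded_path :: "nat \<Rightarrow> nat \<Rightarrow> 'w \<Rightarrow> bool" where
  "uncrowded_path n K w \<longleftrightarrow> (\<forall>k<K. inc n Arrival k w + inc n Service k w + inc n Message k w \<le> 1)"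

definition cell_prob :: "nat \<Rightarrow> flow \<Rightarrow> real" where
  "cell_prob n s = 1 - exp (- (rate n s * (real n * mesh mu n)))"

lemma AE_uncrowded:
  assumes "0 < lam" "lam < 1" "0 < T" "in_regime R c mu"
  shows "AE w in \<Omega>. \<forall>\<^sub>F n in sequentially. uncrowded_path n (cells T mu n) w"
proof (rule AE_eventually_summable[where P="\<lambda>n. 1 \<le> n \<and> c n \<le> n" and b="\<lambda>n. (T + 1) * (1 / (real (Suc n))\<^sup>2)"])
  show "eventually (\<lambda>n. 1 \<le> n \<and> c n \<le> n) sequentially" by (rule in_regime_eventually_le[OF assms(4)])
  have "summable (\<lambda>n. 1 / (real n)\<^sup>2)" using inverse_power_summable[of 2, where ?'a=real] by (simp add: inverse_eq_divide)
  then have "summable (\<lambda>n. 1 / (real (Suc n))\<^sup>2)" by (subst summable_Suc_iff)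
  then show "summable (\<lambda>n. (T + 1) * (1 / (real (Suc n))\<^sup>2))" by (rule summable_mult)
  show "0 \<le> (T + 1) * (1 / (real (Suc n))\<^sup>2)" for n using assms by simp
  fix n assume n: "1 \<le> n \<and> c n \<le> n"
  interpret G: grid_noise \<Omega> "\<lambda>w. (S0 n w, M0 n w)" "incr (mesh mu) n" "\<lambda>s j. mark s (Suc j)" ini_sets "\<lambda>s. rate n s * (real n * mesh mu n)" n "c n"
    using n assms(1) mesh_pos by (intro grid_noise_instance) auto
  let ?K = "cells T mu n" and ?d = "mesh mu n"
  have "real ?K * (rate n Arrival * (real n * ?d) + rate n Service * (real n * ?d) + rate n Message * (real n * ?d))\<^sup>2
    = (?d * real ?K) * ((real n)\<^sup>2 * ?d * (lam + 1 + mu n)\<^sup>2)"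
    by (simp add: rate_def power2_eq_square algebra_simps)
  also have "\<dots> \<le> (T + 1) * ((real n)\<^sup>2 * ?d * (2 + \<bar>mu n\<bar>)\<^sup>2)"
  proof (intro mult_mono cells_bounds assms power_mono)
    show "lam + 1 + mu n \<le> 2 + \<bar>mu n\<bar>" using assms by simp
    show "0 \<le> lam + 1 + mu n" using assms mu_pos[of n] n by simp
  qed (use assms mesh_pos[of mu n] in \<open>auto intro!: mult_nonneg_nonneg simp: less_imp_le\<close>)
  also have "\<dots> \<le> (T + 1) * (1 / (real (Suc n))\<^sup>2)"
    using assms by (intro mult_left_mono mesh_bounds) auto
  finally have le: "real ?K * (rate n Arrival * (real n * ?d) + rate n Service * (real n * ?d) + rate n Message * (real n * ?d))\<^sup>2 \<le> (T + 1) * (1 / (real (Suc n))\<^sup>2)" .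
  show "\<exists>E\<in>events. prob E \<le> (T + 1) * (1 / (real (Suc n))\<^sup>2) \<and> (\<forall>w\<in>space \<Omega> - E. uncrowded_path n ?K w)"
    using G.crowding_unlikely[of ?K] le unfolding G.uncrowded_def uncrowded_path_def by (meson order_trans)
qed

lemma AE_counts_bounded:
  assumes "0 < lam" "lam < 1" "0 < T" "in_regime R c mu"
    and iv: "\<And>n. iv n \<in> measurable state_measure (borel \<Otimes>\<^sub>M borel)" and \<epsilon>: "0 < \<epsilon>"
  shows "AE w in \<Omega>. \<forall>\<^sub>F n in sequentially. uncrowded_path n (cells T mu n) w \<longrightarrow>
     (\<forall>k\<le>cells T mu n. t * hit_count n s (iv n) k w \<le> expexp t * cell_prob n s * hit_mass n (iv n) k w + 2 * (\<epsilon> * real n))"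
proof (rule AE_eventually_summable[where P="\<lambda>n. 1 \<le> n \<and> c n \<le> n" and b="\<lambda>n. 2 * (exp (- \<epsilon>)) ^ n"])
  show "eventually (\<lambda>n. 1 \<le> n \<and> c n \<le> n) sequentially" by (rule in_regime_eventually_le[OF assms(4)])
  show "summable (\<lambda>n. 2 * (exp (- \<epsilon>)) ^ n)" using \<epsilon> by (intro summable_mult summable_geometric) auto
  show "0 \<le> 2 * (exp (- \<epsilon>)) ^ n" for n by simp
  fix n assume n: "1 \<le> n \<and> c n \<le> n"
  interpret G: grid_noise \<Omega> "\<lambda>w. (S0 n w, M0 n w)" "incr (mesh mu) n" "\<lambda>s j. mark s (Suc j)" ini_sets "\<lambda>s. rate n s * (real n * mesh mu n)" n "c n"
    using n assms(1) mesh_pos by (intro grid_noise_instance) auto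
  have state: "G.state k w = grid_state n k w" for k w by (simp add: G.state_def grid_state_def)
  have "2 * exp (- (\<epsilon> * real n)) = 2 * (exp (- \<epsilon>)) ^ n" by (simp add: exp_of_nat_mult[symmetric] mult.commute)
  with G.counts_concentrate[OF iv, of "\<epsilon> * real n" "cells T mu n" t s n]
  show "\<exists>E\<in>events. prob E \<le> 2 * (exp (- \<epsilon>)) ^ n \<and> (\<forall>w\<in>space \<Omega> - E. uncrowded_path n (cells T mu n) w \<longrightarrow>
     (\<forall>k\<le>cells T mu n. t * hit_count n s (iv n) k w \<le> expexp t * cell_prob n s * hit_mass n (iv n) k w + 2 * (\<epsilon> * real n)))"
    unfolding G.uncrowded_def uncrowded_path_def G.hit_count_def G.hit_mass_def G.events_before_def state hit_count_def hit_mass_def G.event_prob_def cell_prob_def expexp_def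
    by simp
qed

lemma cell_prob_bounds:
  assumes "0 < lam" "1 \<le> n"
  shows "0 \<le> cell_prob n s" "cell_prob n s \<le> rate n s * (real n * mesh mu n)"
    "rate n s * (real n * mesh mu n) - (rate n s * (real n * mesh mu n))\<^sup>2 \<le> cell_prob n s"
proof -
  have "0 \<le> rate n s * (real n * mesh mu n)" using rate_pos[OF assms, of s] mesh_pos[of mu n] by simp
  from one_minus_exp_bounds[OF this]
  show "0 \<le> cell_prob n s" "cell_prob n s \<le> rate n s * (real n * mesh mu n)"
    "rate n s * (real n * mesh mu n) - (rate n s * (real n * mesh mu n))\<^sup>2 \<le> cell_prob n s"
    by (auto simp: cell_prob_def)
qed

lemma hit_mass_bounds: "0 \<le> hit_mass n iv k w" "hit_mass n iv k w \<le> real k"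
proof -
  show "0 \<le> hit_mass n iv k w" unfolding hit_mass_def by (intro sum_nonneg len_nonneg)
  have "hit_mass n iv k w \<le> (\<Sum>l<k. 1)" unfolding hit_mass_def by (intro sum_mono len_le_1)
  then show "hit_mass n iv k w \<le> real k" by simp
qed

lemma AE_law_of_large_numbers:
  assumes "0 < lam" "lam < 1" "0 < T" "in_regime R c mu"
    and iv: "\<And>n. iv n \<in> measurable state_measure (borel \<Otimes>\<^sub>M borel)"
    and r: "\<And>n. 1 \<le> n \<Longrightarrow> rate n s = r"
  shows "AE w in \<Omega>. unif_null (cells T mu) (\<lambda>n k. hit_count n s (iv n) k w / real n - r * mesh mu n * hit_mass n (iv n) k w)"
proof -
  let ?TT = "range (\<lambda>j. 1 / real (Suc j)) \<union> range (\<lambda>j. - 1 / real (Suc j))" and ?EE = "range (\<lambda>j. 1 / real (Suc j))"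
  have cT: "countable ?TT" and cE: "countable ?EE"
    by auto
  have "AE w in \<Omega>. \<forall>t\<in>?TT. \<forall>\<epsilon>\<in>?EE. \<forall>\<^sub>F n in sequentially. uncrowded_path n (cells T mu n) w \<longrightarrow>
     (\<forall>k\<le>cells T mu n. t * hit_count n s (iv n) k w \<le> expexp t * cell_prob n s * hit_mass n (iv n) k w + 2 * (\<epsilon> * real n))"
    by (intro AE_ball_countable' cT cE AE_counts_bounded[OF assms(1-4) iv]) auto
  with AE_uncrowded[OF assms(1-4)]
  show ?thesis
  proof eventually_elim
    case (elim w)
    have r0: "0 \<le> r" using rate_pos[OF assms(1), of 1 s] r[of 1] by simp
    define \<pi> where "\<pi> n = (if n = 0 then 0 else cell_prob n s)" for n
    have \<pi>: "\<pi> n \<le> r * (real n * mesh mu n)" "r * (real n * mesh mu n) - (r * (real n * mesh mu n))\<^sup>2 \<le> \<pi> n" "0 \<le> \<pi> n" for n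
      using cell_prob_bounds[OF assms(1), of n s] r[of n] by (auto simp: \<pi>_def)
    have nm: "(\<lambda>n. real n * mesh mu n) \<longlonglongrightarrow> 0"
    proof (rule tendsto_sandwich[OF _ _ tendsto_const n_mesh_null[of mu]])
      show "\<forall>\<^sub>F n in sequentially. 0 \<le> real n * mesh mu n" by (simp add: less_imp_le[OF mesh_pos])
      show "\<forall>\<^sub>F n in sequentially. real n * mesh mu n \<le> real n * mesh mu n * (2 + \<bar>mu n\<bar>)"
      proof (intro always_eventually allI)
        fix n
        have "real n * mesh mu n * 1 \<le> real n * mesh mu n * (2 + \<bar>mu n\<bar>)"
          using mesh_pos[of mu n] by (intro mult_left_mono) auto
        then show "real n * mesh mu n \<le> real n * mesh mu n * (2 + \<bar>mu n\<bar>)" by simp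
      qed
    qed
    show ?case
    proof (rule unif_null_of_exponential_bounds[where \<pi>=\<pi> and d="mesh mu" and B="T + 1"])
      fix t \<epsilon> assume "t \<in> ?TT" "\<epsilon> \<in> ?EE"
      then have "\<forall>\<^sub>F n in sequentially. uncrowded_path n (cells T mu n) w \<longrightarrow>
         (\<forall>k\<le>cells T mu n. t * hit_count n s (iv n) k w \<le> expexp t * cell_prob n s * hit_mass n (iv n) k w + 2 * (\<epsilon> * real n))"
        using elim(2) by blast
      with elim(1) eventually_ge_at_top[of 1]
      show "\<forall>\<^sub>F n in sequentially. \<forall>k\<le>cells T mu n. t * hit_count n s (iv n) k w \<le> expexp t * \<pi> n * hit_mass n (iv n) k w + 2 * (\<epsilon> * real n)"
        by eventually_elim (simp add: \<pi>_def)
    qed (use hit_mass_bounds mesh_pos cells_bounds(2)[OF assms(3)] nm r0 \<pi> in auto)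
  qed
qed

end

section \<open>Token balances and convergence\<close>

text \<open>Marks do not matter for an arrival that finds a token. The interval \<open>[0, 1)\<close> turns such arrivals into hits, so
  that the general law of large numbers applies to them.\<close>

definition token_use_iv :: "(nat \<Rightarrow> bool) \<Rightarrow> (nat \<Rightarrow> real) \<times> nat \<Rightarrow> real \<times> real" where
  "token_use_iv Q z = (if Q (snd z) then (0, 1) else (0, 0))"

definition token_store_iv :: "nat \<Rightarrow> nat \<Rightarrow> (nat \<Rightarrow> bool) \<Rightarrow> (nat \<Rightarrow> real) \<times> nat \<Rightarrow> real \<times> real" where
  "token_store_iv n c P z = (if P (snd z) then msg_iv n c z else (0, 0))"

lemma token_use_iv_measurable: "token_use_iv Q \<in> measurable state_measure (borel \<Otimes>\<^sub>M borel)"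
  unfolding token_use_iv_def[abs_def] by measurable

lemma token_store_iv_measurable: "token_store_iv n c P \<in> measurable state_measure (borel \<Otimes>\<^sub>M borel)"
  unfolding token_store_iv_def[abs_def] by measurable

lemma len_token_use_iv: "len (token_use_iv Q z) = of_bool (Q (snd z))"
  by (simp add: token_use_iv_def len_def)

lemma len_token_store_iv:
  assumes "valid n c z" "0 < n"
  shows "len (token_store_iv n c P z) = of_bool (P (snd z) \<and> snd z < c) * (1 - fst z 1 - real (snd z) / real n)"
proof -
  have "0 \<le> fst z 1" "real (snd z) \<le> real n * (1 - fst z 1)" using assms by (auto simp: valid_def)
  then have "real (snd z) / real n \<le> 1 - fst z 1" using assms(2) by (simp add: divide_le_eq mult.commute)
  moreover have "0 \<le> real (snd z) / real n" by simp
  ultimately have "max 0 (min 1 (1 - fst z 1 - real (snd z) / real n)) = 1 - fst z 1 - real (snd z) / real n"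
    using \<open>0 \<le> fst z 1\<close> by linarith
  then show ?thesis by (auto simp: token_store_iv_def msg_iv_def len_def)
qed

lemma len_srv_iv:
  assumes "valid n c z" "1 \<le> i"
  shows "len (srv_iv i z) = fst z i - fst z (i + 1)"
  using valid_le_1[OF assms(1), of i] assms by (auto simp: srv_iv_def len_def valid_def)

lemma len_arr_iv:
  assumes "valid n c z" "1 \<le> i"
  shows "len (arr_iv i z) = (if i = 1 then 1 else 0) + random_gain i (fst z) * of_bool (snd z = 0)"
proof -
  have b: "0 \<le> fst z j" "fst z j \<le> 1" for j using valid_le_1[OF assms(1), of j] assms(1) by (auto simp: valid_def)
  have "fst z (Suc j) \<le> fst z j" for j using assms(1) by (simp add: valid_def)
  from this[of "i - 1"] have m: "fst z i \<le> fst z (i - 1)" using assms(2) by simp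
  show ?thesis using b[of i] b[of "i - 1"] b[of 1] m assms(2) by (auto simp: arr_iv_def len_def random_gain_def)
qed

context coupled_system
begin

lemma grid_state_Suc: "grid_state n (Suc k) w = step n (c n) (\<lambda>s. 1 \<le> inc n s k w) (\<lambda>s. mark s (Suc (\<Sum>m<k. inc n s m w)) w) (grid_state n k w)"
  by (simp add: grid_state_def)

lemma queue_balance:
  "fst (grid_state n k w) i - fst (grid_state n 0 w) i = (hit_count n Arrival (arr_iv i) k w - hit_count n Service (srv_iv i) k w) / real n"
proof (induction k)
  case (Suc k)
  have "fst (grid_state n (Suc k) w) i = fst (grid_state n k w) i +
     (of_bool (1 \<le> inc n Arrival k w \<and> hit (arr_iv i (grid_state n k w)) (mark Arrival (Suc (\<Sum>m<k. inc n Arrival m w)) w))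
     - of_bool (1 \<le> inc n Service k w \<and> hit (srv_iv i (grid_state n k w)) (mark Service (Suc (\<Sum>m<k. inc n Service m w)) w))) / real n"
    unfolding grid_state_Suc step_def by simp
  then show ?case using Suc unfolding hit_count_def sum.lessThan_Suc by (simp add: diff_divide_distrib add_divide_distrib)
qed (simp add: hit_count_def)

text \<open>A function of the token count changes only when a token is stored or used. With \<open>h\<close> the indicator of exceeding a level
  this counts the crossings of the level; with the identity it is the balance of all tokens.\<close>

lemma token_balance:
  assumes un: "uncrowded_path n K w" and k: "k \<le> K" and marks: "\<And>s j. 1 \<le> j \<Longrightarrow> 0 \<le> mark s j w \<and> mark s j w < 1"
    and h1: "\<And>m. h (Suc m) - h m = (of_bool (P m) :: real)" and h2: "\<And>m. Q m \<longleftrightarrow> 1 \<le> m \<and> P (m - 1)"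
  shows "h (snd (grid_state n k w)) - h (snd (grid_state n 0 w)) = hit_count n Message (token_store_iv n (c n) P) k w - hit_count n Arrival (token_use_iv Q) k w"
  using k
proof (induction k)
  case (Suc k)
  define m where "m = snd (grid_state n k w)"
  define eA eM where "eA = (1 \<le> inc n Arrival k w)" and "eM = (1 \<le> inc n Message k w)"
  define hM where "hM = hit (msg_iv n (c n) (grid_state n k w)) (mark Message (Suc (\<Sum>m<k. inc n Message m w)) w)"
  have "inc n Arrival k w + inc n Service k w + inc n Message k w \<le> 1"
    using un Suc.prems unfolding uncrowded_path_def by simp
  then have one: "\<not> (eA \<and> eM)" unfolding eA_def eM_def by linarith
  have S: "snd (grid_state n (Suc k) w) = m - of_bool (eA \<and> 1 \<le> m) + of_bool (eM \<and> hM)"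
    unfolding grid_state_Suc step_def m_def eA_def eM_def hM_def by simp
  have a: "(1 \<le> inc n Arrival k w \<and> hit (token_use_iv Q (grid_state n k w)) (mark Arrival (Suc (\<Sum>m<k. inc n Arrival m w)) w)) \<longleftrightarrow> eA \<and> Q m"
    using marks[of "Suc (\<Sum>m<k. inc n Arrival m w)" Arrival] by (auto simp: token_use_iv_def hit_def eA_def m_def)
  have b: "(1 \<le> inc n Message k w \<and> hit (token_store_iv n (c n) P (grid_state n k w)) (mark Message (Suc (\<Sum>m<k. inc n Message m w)) w)) \<longleftrightarrow> eM \<and> P m \<and> hM"
    by (auto simp: token_store_iv_def hit_def eM_def m_def hM_def)
  have "h (snd (grid_state n (Suc k) w)) - h m = of_bool (eM \<and> P m \<and> hM) - of_bool (eA \<and> Q m)"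
  proof (cases eA)
    case True
    then have "\<not> eM" using one by simp
    show ?thesis
    proof (cases m)
      case 0
      then show ?thesis using True \<open>\<not> eM\<close> h2[of m] by (simp add: S)
    next
      case (Suc m')
      then show ?thesis using True \<open>\<not> eM\<close> h2[of m] h1[of m'] by (simp add: S)
    qed
  next
    case False
    then show ?thesis using h1[of m] by (auto simp: S)
  qed
  then show ?case using Suc unfolding hit_count_def sum.lessThan_Suc a b by (simp add: m_def)
qed (simp add: hit_count_def)

lemma grid_limit_instance:
  assumes lam: "0 < lam" "lam < 1" and T: "0 < T" and R: "proper_regime R" and sol: "fluid_solution lam R s0 s"
    and val: "\<forall>\<^sub>F n in sequentially. 1 \<le> n \<and> (\<forall>k\<le>cells T mu n. valid n (c n) (grid_state n k w))"
    and arr: "\<And>i. unif_null (cells T mu) (\<lambda>n k. hit_count n Arrival (arr_iv i) k w / real n - lam * mesh mu n * hit_mass n (arr_iv i) k w)"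
    and srv: "\<And>i. unif_null (cells T mu) (\<lambda>n k. hit_count n Service (srv_iv i) k w / real n - 1 * mesh mu n * hit_mass n (srv_iv i) k w)"
    and start: "\<And>i. (\<lambda>n. fst (grid_state n 0 w) i) \<longlonglongrightarrow> s0 i"
  shows "grid_limit lam R s0 s (mesh mu) (cells T mu) (T + 1) (\<lambda>n k. fst (grid_state n k w)) (\<lambda>n k. of_bool (snd (grid_state n k w) = 0))"
proof
  show "0 < lam" "lam < 1" "proper_regime R" "fluid_solution lam R s0 s" by fact+
  show "0 < mesh mu n" for n by (rule mesh_pos)
  show "mesh mu \<longlonglongrightarrow> 0" by (rule mesh_null)
  show "mesh mu n * real (cells T mu n) \<le> T + 1" for n by (rule cells_bounds(2)[OF T])
  show "\<forall>\<^sub>F n in sequentially. \<forall>k\<le>cells T mu n. \<forall>i. 0 \<le> fst (grid_state n k w) i \<and> fst (grid_state n k w) i \<le> 1 \<and> fst (grid_state n k w) 0 = 1"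
    using val by eventually_elim (auto simp: valid_le_1 intro: valid_le_1, auto simp: valid_def)
  show "0 \<le> (of_bool (snd (grid_state n k w) = 0) :: real) \<and> (of_bool (snd (grid_state n k w) = 0) :: real) \<le> 1" for n k by simp
  show "(\<lambda>n. fst (grid_state n 0 w) i) \<longlonglongrightarrow> s0 i" for i by (rule start)
  show "unif_null (cells T mu) (\<lambda>n k. fst (grid_state n k w) i - fst (grid_state n 0 w) i -
        (\<Sum>l<k. (if i = 1 then lam * mesh mu n else 0) + random_gain i (fst (grid_state n l w)) * (lam * mesh mu n * of_bool (snd (grid_state n l w) = 0))
           - mesh mu n * (fst (grid_state n l w) i - fst (grid_state n l w) (i + 1))))" if i: "1 \<le> i" for i
  proof (rule unif_null_mono[OF unif_null_diff[OF arr[of i] srv[of i]]])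
    show "\<forall>\<^sub>F n in sequentially. \<forall>k\<le>cells T mu n. \<bar>fst (grid_state n k w) i - fst (grid_state n 0 w) i -
        (\<Sum>l<k. (if i = 1 then lam * mesh mu n else 0) + random_gain i (fst (grid_state n l w)) * (lam * mesh mu n * of_bool (snd (grid_state n l w) = 0))
           - mesh mu n * (fst (grid_state n l w) i - fst (grid_state n l w) (i + 1)))\<bar>
       \<le> \<bar>hit_count n Arrival (arr_iv i) k w / real n - lam * mesh mu n * hit_mass n (arr_iv i) k w -
          (hit_count n Service (srv_iv i) k w / real n - 1 * mesh mu n * hit_mass n (srv_iv i) k w)\<bar>"
      using val
    proof eventually_elim
      case (elim n)
      show ?case
      proof (intro allI impI)
        fix k assume k: "k \<le> cells T mu n"
        have "(\<Sum>l<k. (if i = 1 then lam * mesh mu n else 0) + random_gain i (fst (grid_state n l w)) * (lam * mesh mu n * of_bool (snd (grid_state n l w) = 0))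
           - mesh mu n * (fst (grid_state n l w) i - fst (grid_state n l w) (i + 1)))
          = (\<Sum>l<k. lam * mesh mu n * len (arr_iv i (grid_state n l w)) - mesh mu n * len (srv_iv i (grid_state n l w)))"
        proof (rule sum.cong[OF refl])
          fix l assume "l \<in> {..<k}"
          then have v: "valid n (c n) (grid_state n l w)" using elim k by auto
          show "(if i = 1 then lam * mesh mu n else 0) + random_gain i (fst (grid_state n l w)) * (lam * mesh mu n * of_bool (snd (grid_state n l w) = 0))
           - mesh mu n * (fst (grid_state n l w) i - fst (grid_state n l w) (i + 1)) = lam * mesh mu n * len (arr_iv i (grid_state n l w)) - mesh mu n * len (srv_iv i (grid_state n l w))"
            unfolding len_arr_iv[OF v i] len_srv_iv[OF v i] by (simp add: distrib_left)
        qed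
        also have "\<dots> = lam * mesh mu n * hit_mass n (arr_iv i) k w - mesh mu n * hit_mass n (srv_iv i) k w"
          unfolding hit_mass_def sum_subtractf sum_distrib_left ..
        finally show "\<bar>fst (grid_state n k w) i - fst (grid_state n 0 w) i -
        (\<Sum>l<k. (if i = 1 then lam * mesh mu n else 0) + random_gain i (fst (grid_state n l w)) * (lam * mesh mu n * of_bool (snd (grid_state n l w) = 0))
           - mesh mu n * (fst (grid_state n l w) i - fst (grid_state n l w) (i + 1)))\<bar>
          \<le> \<bar>hit_count n Arrival (arr_iv i) k w / real n - lam * mesh mu n * hit_mass n (arr_iv i) k w -
          (hit_count n Service (srv_iv i) k w / real n - 1 * mesh mu n * hit_mass n (srv_iv i) k w)\<bar>"
          unfolding queue_balance by (simp add: diff_divide_distrib)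
      qed
    qed
  qed
qed

lemma unif_null_token_balance:
  assumes un: "\<forall>\<^sub>F n in sequentially. uncrowded_path n (cells T mu n) w"
    and marks: "\<And>s j. 1 \<le> j \<Longrightarrow> 0 \<le> mark s j w \<and> mark s j w < 1"
    and val: "\<forall>\<^sub>F n in sequentially. 1 \<le> n \<and> (\<forall>k\<le>cells T mu n. valid n (c n) (grid_state n k w))"
    and h1: "\<And>m. h (Suc m) - h m = (of_bool (P m) :: real)" and h2: "\<And>m. Q m \<longleftrightarrow> 1 \<le> m \<and> P (m - 1)"
    and small: "unif_null (cells T mu) (\<lambda>n k. (h (snd (grid_state n k w)) - h (snd (grid_state n 0 w))) / real n)"
    and up: "unif_null (cells T mu) (\<lambda>n k. hit_count n Message (token_store_iv n (c n) P) k w / real n - b * mesh mu n * hit_mass n (token_store_iv n (c n) P) k w)"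
    and dn: "unif_null (cells T mu) (\<lambda>n k. hit_count n Arrival (token_use_iv Q) k w / real n - lam * mesh mu n * hit_mass n (token_use_iv Q) k w)"
    and tokens_small: "unif_null (cells T mu) (\<lambda>n l. real (snd (grid_state n l w)) / real n * of_bool (P (snd (grid_state n l w))))"
    and gl: "grid_limit lam R s0 s (mesh mu) (cells T mu) B (\<lambda>n k. fst (grid_state n k w)) (\<lambda>n k. of_bool (snd (grid_state n k w) = 0))"
  shows "grid_limit.weak_null (mesh mu) (cells T mu) (\<lambda>n l. b * (1 - fst (grid_state n l w) 1) * of_bool (P (snd (grid_state n l w)) \<and> snd (grid_state n l w) < c n) - lam * of_bool (Q (snd (grid_state n l w))))"
proof -
  interpret grid_limit lam R s0 s "mesh mu" "cells T mu" B "\<lambda>n k. fst (grid_state n k w)" "\<lambda>n k. of_bool (snd (grid_state n k w) = 0)" by (rule gl)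
  have 1: "unif_null (cells T mu) (\<lambda>n k. b * mesh mu n * hit_mass n (token_store_iv n (c n) P) k w - lam * mesh mu n * hit_mass n (token_use_iv Q) k w)"
  proof (rule unif_null_mono[OF unif_null_add[OF unif_null_diff[OF dn up] small]])
    show "\<forall>\<^sub>F n in sequentially. \<forall>k\<le>cells T mu n. \<bar>b * mesh mu n * hit_mass n (token_store_iv n (c n) P) k w - lam * mesh mu n * hit_mass n (token_use_iv Q) k w\<bar>
      \<le> \<bar>hit_count n Arrival (token_use_iv Q) k w / real n - lam * mesh mu n * hit_mass n (token_use_iv Q) k w -
         (hit_count n Message (token_store_iv n (c n) P) k w / real n - b * mesh mu n * hit_mass n (token_store_iv n (c n) P) k w)
         + (h (snd (grid_state n k w)) - h (snd (grid_state n 0 w))) / real n\<bar>"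
      using un
    proof eventually_elim
      case (elim n)
      show ?case
      proof (intro allI impI)
        fix k assume k: "k \<le> cells T mu n"
        show "\<bar>b * mesh mu n * hit_mass n (token_store_iv n (c n) P) k w - lam * mesh mu n * hit_mass n (token_use_iv Q) k w\<bar>
      \<le> \<bar>hit_count n Arrival (token_use_iv Q) k w / real n - lam * mesh mu n * hit_mass n (token_use_iv Q) k w -
         (hit_count n Message (token_store_iv n (c n) P) k w / real n - b * mesh mu n * hit_mass n (token_store_iv n (c n) P) k w)
         + (h (snd (grid_state n k w)) - h (snd (grid_state n 0 w))) / real n\<bar>"
        proof -
          have "h (snd (grid_state n k w)) - h (snd (grid_state n 0 w)) = hit_count n Message (token_store_iv n (c n) P) k w - hit_count n Arrival (token_use_iv Q) k w"
            by (rule token_balance[where h=h and P=P and Q=Q, OF elim k marks h1 h2])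
          then have "(h (snd (grid_state n k w)) - h (snd (grid_state n 0 w))) / real n =
              hit_count n Message (token_store_iv n (c n) P) k w / real n - hit_count n Arrival (token_use_iv Q) k w / real n"
            by (simp only: diff_divide_distrib)
          then show ?thesis by linarith
        qed
      qed
    qed
  qed
  have 2: "weak_null (\<lambda>n l. b * len (token_store_iv n (c n) P (grid_state n l w)) - lam * len (token_use_iv Q (grid_state n l w)))"
    unfolding weak_null_def
    by (rule unif_null_mono[OF 1], rule always_eventually)
       (simp add: hit_mass_def sum_subtractf sum_distrib_left right_diff_distrib mult_ac)
  have 3: "weak_null (\<lambda>n l. b * ((real (snd (grid_state n l w)) / real n * of_bool (P (snd (grid_state n l w)))) * of_bool (snd (grid_state n l w) < c n)))"
    by (intro weak_null_cmult weak_null_strong[OF tokens_small]) simp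
  show ?thesis
  proof (rule weak_null_cong[OF weak_null_add[OF 2 3]])
    show "\<forall>\<^sub>F n in sequentially. \<forall>l<cells T mu n. b * len (token_store_iv n (c n) P (grid_state n l w)) - lam * len (token_use_iv Q (grid_state n l w))
      + b * ((real (snd (grid_state n l w)) / real n * of_bool (P (snd (grid_state n l w)))) * of_bool (snd (grid_state n l w) < c n))
      = b * (1 - fst (grid_state n l w) 1) * of_bool (P (snd (grid_state n l w)) \<and> snd (grid_state n l w) < c n) - lam * of_bool (Q (snd (grid_state n l w)))"
      using val
    proof eventually_elim
      case (elim n)
      show ?case
      proof (intro allI impI)
        fix l assume "l < cells T mu n"
        then have "valid n (c n) (grid_state n l w)" "0 < n" using elim by auto
        note la = len_token_store_iv[OF this, of P]
        show "b * len (token_store_iv n (c n) P (grid_state n l w)) - lam * len (token_use_iv Q (grid_state n l w))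
      + b * ((real (snd (grid_state n l w)) / real n * of_bool (P (snd (grid_state n l w)))) * of_bool (snd (grid_state n l w) < c n))
      = b * (1 - fst (grid_state n l w) 1) * of_bool (P (snd (grid_state n l w)) \<and> snd (grid_state n l w) < c n) - lam * of_bool (Q (snd (grid_state n l w)))"
          unfolding la len_token_use_iv by (cases "P (snd (grid_state n l w))"; cases "snd (grid_state n l w) < c n") (simp_all add: algebra_simps)
      qed
    qed
  qed
qed

end

lemma wnorm_eq: "wnorm y = sqrt (wsum (\<lambda>i. (y i)\<^sup>2))"
  by (simp add: wnorm_def wsum_def)

lemma unif_null_dominated:
  assumes "\<forall>\<^sub>F n in sequentially. \<forall>k\<le>K n. \<bar>f n k\<bar> \<le> b n" "b \<longlonglongrightarrow> 0"
  shows "unif_null K f"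
  by (rule unif_null_mono[OF unif_null_const[OF assms(2)]])
     (use assms(1) in \<open>auto elim!: eventually_mono intro: order_trans[OF _ abs_ge_self]\<close>)

text \<open>Inside a cell the path takes only its values at the two ends, and the fluid solution moves by at most
  \<open>Lip * d n\<close>.\<close>

lemma (in fluid) sup_distance_null:
  fixes X :: "nat \<Rightarrow> real \<Rightarrow> nat \<Rightarrow> real" and x :: "nat \<Rightarrow> nat \<Rightarrow> nat \<Rightarrow> real" and d :: "nat \<Rightarrow> real"
  assumes T: "0 < T" and d: "\<And>n. 0 < d n" "d \<longlonglongrightarrow> 0" and dK: "\<And>n. T \<le> d n * real (K n)"
    and Y: "unif_null K (\<lambda>n k. wsum (\<lambda>i. (x n k i - s (d n * real k) i)\<^sup>2))"
    and X: "\<forall>\<^sub>F n in sequentially. (\<forall>k\<le>K n. \<forall>i. 0 \<le> x n k i \<and> x n k i \<le> 1) \<and>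
       (\<forall>k<K n. \<forall>t. d n * real k \<le> t \<longrightarrow> t \<le> d n * real (Suc k) \<longrightarrow> X n t = x n k \<or> X n t = x n (Suc k))"
  shows "(\<lambda>n. SUP t\<in>{0..T}. wnorm (\<lambda>i. X n t i - s t i)) \<longlonglongrightarrow> 0"
proof (rule tendstoI)
  fix \<epsilon>' :: real assume "0 < \<epsilon>'"
  define \<epsilon> where "\<epsilon> = \<epsilon>' / 2"
  have \<epsilon>: "0 < \<epsilon>" "\<epsilon> < \<epsilon>'" using \<open>0 < \<epsilon>'\<close> by (auto simp: \<epsilon>_def)
  have e2: "0 < \<epsilon>\<^sup>2 / 4" using \<epsilon> by simp
  have "(\<lambda>n. 4 * (Lip * d n)\<^sup>2) \<longlonglongrightarrow> 4 * (Lip * 0)\<^sup>2" by (intro tendsto_intros d(2))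
  then have "(\<lambda>n. 4 * (Lip * d n)\<^sup>2) \<longlonglongrightarrow> 0" by simp
  then have "\<forall>\<^sub>F n in sequentially. 4 * (Lip * d n)\<^sup>2 < \<epsilon>\<^sup>2 / 2" by (rule order_tendstoD) (use \<epsilon> in simp)
  with unif_nullD[OF Y e2] X
  show "\<forall>\<^sub>F n in sequentially. dist (SUP t\<in>{0..T}. wnorm (\<lambda>i. X n t i - s t i)) 0 < \<epsilon>'"
  proof eventually_elim
    case (elim n)
    have bd: "0 \<le> wnorm (\<lambda>i. X n t i - s t i) \<and> wnorm (\<lambda>i. X n t i - s t i) \<le> \<epsilon>" if t: "t \<in> {0..T}" for t
    proof -
      define k' where "k' = nat \<lfloor>t / d n\<rfloor>"
      have Kpos: "0 < K n" using dK[of n] T by (cases "K n") auto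
      have k': "d n * real k' \<le> t" "t < d n * real (Suc k')"
      proof -
        have "0 \<le> t / d n" using t d(1)[of n] by simp
        then have r: "real k' = of_int \<lfloor>t / d n\<rfloor>" by (simp add: k'_def)
        have "real k' \<le> t / d n" "t / d n < real k' + 1" unfolding r by linarith+
        then show "d n * real k' \<le> t" "t < d n * real (Suc k')" using d(1)[of n] by (auto simp: field_simps)
      qed
      define k where "k = min k' (K n - 1)"
      have kK: "k < K n" using Kpos by (simp add: k_def)
      have k: "d n * real k \<le> t" "t \<le> d n * real (Suc k)"
      proof -
        have "d n * real k \<le> d n * real k'" using d(1)[of n] by (intro mult_left_mono) (auto simp: k_def)
        then show "d n * real k \<le> t" using k' by simp
        show "t \<le> d n * real (Suc k)"
        proof (cases "k' \<le> K n - 1")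
          case True then show ?thesis using k' by (simp add: k_def min_def)
        next
          case False
          then have "Suc k = K n" using Kpos by (simp add: k_def)
          then show ?thesis using dK[of n] t by simp
        qed
      qed
      obtain m where m: "m \<le> K n" "X n t = x n m" "\<bar>d n * real m - t\<bar> \<le> d n"
      proof -
        have "d n * real (Suc k) = d n * real k + d n" by (simp add: algebra_simps)
        then have "\<bar>d n * real k - t\<bar> \<le> d n" "\<bar>d n * real (Suc k) - t\<bar> \<le> d n" using k by auto
        moreover have "X n t = x n k \<or> X n t = x n (Suc k)" using elim(2) kK k by blast
        ultimately show ?thesis using that[of k] that[of "Suc k"] kK by auto
      qed
      let ?e = "\<lambda>i. x n m i - s (d n * real m) i"
      have t0: "0 \<le> t" "0 \<le> d n * real m" using t d(1)[of n] by auto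
      have xb: "0 \<le> x n m i" "x n m i \<le> 1" for i using elim(2) m(1) by auto
      have eb: "(?e i)\<^sup>2 \<le> 1" for i
      proof -
        have "\<bar>?e i\<bar> \<le> 1" using xb[of i] s_bounds(1,2)[OF t0(2), of i] by linarith
        then show ?thesis by (simp add: abs_le_square_iff[of _ 1, simplified])
      qed
      have pt: "(X n t i - s t i)\<^sup>2 \<le> 2 * (?e i)\<^sup>2 + 2 * (Lip * d n)\<^sup>2" for i
      proof -
        have "\<bar>s (d n * real m) i - s t i\<bar> \<le> Lip * d n"
          using s_lip[OF t0(2,1), of i] mult_left_mono[OF m(3) Lip_nonneg] by linarith
        then have "\<bar>s (d n * real m) i - s t i\<bar>\<^sup>2 \<le> (Lip * d n)\<^sup>2" by (intro power_mono) auto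
        then have sq: "(s (d n * real m) i - s t i)\<^sup>2 \<le> (Lip * d n)\<^sup>2" by simp
        have "X n t i - s t i = ?e i + (s (d n * real m) i - s t i)" by (simp add: m(2))
        moreover have "(p + q)\<^sup>2 \<le> 2 * p\<^sup>2 + 2 * q\<^sup>2" for p q :: real
          using zero_le_power2[of "p - q"] by (simp add: power2_eq_square algebra_simps)
        ultimately show ?thesis using sq by (smt (verit))
      qed
      have w0: "0 \<le> wsum (\<lambda>i. (X n t i - s t i)\<^sup>2)"
      proof (rule wsum_nonneg)
        show "(X n t i - s t i)\<^sup>2 \<le> 2 * 1 + 2 * (Lip * d n)\<^sup>2" for i using pt[of i] eb[of i] by linarith
      qed simp
      have "wsum (\<lambda>i. (X n t i - s t i)\<^sup>2) \<le> wsum (\<lambda>i. 2 * (?e i)\<^sup>2 + 2 * (Lip * d n)\<^sup>2)"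
      proof (rule wsum_mono)
        show "2 * (?e i)\<^sup>2 + 2 * (Lip * d n)\<^sup>2 \<le> 2 * 1 + 2 * (Lip * d n)\<^sup>2" for i using eb[of i] by linarith
      qed (use pt in auto)
      also have "\<dots> = wsum (\<lambda>i. 2 * (?e i)\<^sup>2) + wsum (\<lambda>i. 2 * (Lip * d n)\<^sup>2)"
        by (rule wsum_add[where b=2 and b'="2 * (Lip * d n)\<^sup>2"]) (use eb in auto)
      also have "wsum (\<lambda>i. 2 * (?e i)\<^sup>2) = 2 * wsum (\<lambda>i. (?e i)\<^sup>2)"
        by (rule wsum_cmult[where b=1]) (use eb in auto)
      also have "wsum (\<lambda>i. 2 * (Lip * d n)\<^sup>2) = 4 * (Lip * d n)\<^sup>2" by (simp add: wsum_const)
      also have "2 * wsum (\<lambda>i. (?e i)\<^sup>2) \<le> \<epsilon>\<^sup>2 / 2" using abs_le_D1[OF elim(1)[rule_format, OF m(1)]] by linarith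
      finally have "wsum (\<lambda>i. (X n t i - s t i)\<^sup>2) \<le> \<epsilon>\<^sup>2" using elim(3) by linarith
      then show ?thesis unfolding wnorm_eq using w0 \<epsilon> by (auto intro: real_le_lsqrt)
    qed
    have ne: "{0..T} \<noteq> {}" using T by simp
    have "(SUP t\<in>{0..T}. wnorm (\<lambda>i. X n t i - s t i)) \<le> \<epsilon>"
      using ne bd by (intro cSUP_least) auto
    moreover have "0 \<le> (SUP t\<in>{0..T}. wnorm (\<lambda>i. X n t i - s t i))"
    proof (rule cSUP_upper2[where x=0])
      show "bdd_above ((\<lambda>t. wnorm (\<lambda>i. X n t i - s t i)) ` {0..T})" using bd by (auto intro!: bdd_aboveI[of _ \<epsilon>])
    qed (use bd[of 0] T in auto)
    ultimately show ?case using \<epsilon> by (simp add: dist_real_def)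
  qed
qed

context coupled_system
begin

text \<open>From some \<open>n\<close> on no cell is crowded, and then the paths follow the recursion.\<close>

lemma AE_grid_paths:
  assumes lam: "0 < lam" "lam < 1" and T: "0 < T" and R: "in_regime R c mu"
  shows "AE w in \<Omega>. \<forall>\<^sub>F n in sequentially. 1 \<le> n \<and> uncrowded_path n (cells T mu n) w \<and>
     (\<forall>k\<le>cells T mu n. S n (mesh mu n * real k) w = fst (grid_state n k w) \<and> valid n (c n) (grid_state n k w)) \<and>
     (\<forall>k<cells T mu n. \<forall>t. mesh mu n * real k \<le> t \<longrightarrow> t \<le> mesh mu n * real (Suc k) \<longrightarrow>
        S n t w = fst (grid_state n k w) \<or> S n t w = fst (grid_state n (Suc k) w))"
proof -
  have "AE w in \<Omega>. \<forall>n. 1 \<le> n \<and> c n \<le> n \<longrightarrow>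
     (\<forall>k<cells T mu n. (\<Sum>s\<in>{Arrival, Service, Message}. inc n s k w) \<le> 1) \<longrightarrow>
     sample_path n (c n) (\<lambda>s t. proc n s (real n * t) w) (\<lambda>s j. mark s j w) (\<lambda>t. S n t w) (\<lambda>t. M n t w)
       (S0 n w) (M0 n w) (mesh mu n) (cells T mu n)"
  proof (subst AE_all_countable, intro allI)
    fix n
    show "AE w in \<Omega>. 1 \<le> n \<and> c n \<le> n \<longrightarrow>
     (\<forall>k<cells T mu n. (\<Sum>s\<in>{Arrival, Service, Message}. inc n s k w) \<le> 1) \<longrightarrow>
     sample_path n (c n) (\<lambda>s t. proc n s (real n * t) w) (\<lambda>s j. mark s j w) (\<lambda>t. S n t w) (\<lambda>t. M n t w)
       (S0 n w) (M0 n w) (mesh mu n) (cells T mu n)"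
      using AE_sample_path[of n "mesh mu" "cells T mu n", OF _ _ mesh_pos] by (cases "1 \<le> n \<and> c n \<le> n") auto
  qed
  with AE_uncrowded[OF lam T R]
  show ?thesis
  proof eventually_elim
    case (elim w)
    from elim(1) in_regime_eventually_le[OF R]
    show ?case
    proof eventually_elim
      case (elim n)
      have "(\<Sum>s\<in>{Arrival, Service, Message}. inc n s k w) \<le> 1" if "k < cells T mu n" for k
        using elim(1) that by (simp add: uncrowded_path_def add.assoc)
      then have "sample_path n (c n) (\<lambda>s t. proc n s (real n * t) w) (\<lambda>s j. mark s j w) (\<lambda>t. S n t w) (\<lambda>t. M n t w)
       (S0 n w) (M0 n w) (mesh mu n) (cells T mu n)"
        using \<open>\<forall>n. 1 \<le> n \<and> c n \<le> n \<longrightarrow> _ n\<close> elim(2) by blast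
      then interpret P: sample_path n "c n" "\<lambda>s t. proc n s (real n * t) w" "\<lambda>s j. mark s j w" "\<lambda>t. S n t w" "\<lambda>t. M n t w"
       "S0 n w" "M0 n w" "mesh mu n" "cells T mu n" .
      have "P.inc = (\<lambda>s k. inc n s k w)" by (intro ext) (simp add: P.inc_def incr_def)
      then have ch: "P.ch k = grid_state n k w" for k by (simp add: grid_state_def)
      have g: "S n (mesh mu n * real k) w = fst (grid_state n k w) \<and> valid n (c n) (grid_state n k w)" if "k \<le> cells T mu n" for k
        using P.grid_eq_chain[OF that] unfolding ch by (metis fst_conv)
      moreover have "S n t w = fst (grid_state n k w) \<or> S n t w = fst (grid_state n (Suc k) w)"
        if "k < cells T mu n" "mesh mu n * real k \<le> t" "t \<le> mesh mu n * real (Suc k)" for k t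
        using P.within_cell[OF that] g[of k] g[of "Suc k"] that(1) by simp
      ultimately show ?case using elim by auto
    qed
  qed
qed

lemma level_balance:
  assumes un: "\<forall>\<^sub>F n in sequentially. uncrowded_path n (cells T mu n) w"
    and marks: "\<And>s j. 1 \<le> j \<Longrightarrow> 0 \<le> mark s j w \<and> mark s j w < 1"
    and val: "\<forall>\<^sub>F n in sequentially. 1 \<le> n \<and> (\<forall>k\<le>cells T mu n. valid n (c n) (grid_state n k w))"
    and up: "unif_null (cells T mu) (\<lambda>n k. hit_count n Message (token_store_iv n (c n) (\<lambda>m. m = j)) k w / real n - b * mesh mu n * hit_mass n (token_store_iv n (c n) (\<lambda>m. m = j)) k w)"
    and dn: "unif_null (cells T mu) (\<lambda>n k. hit_count n Arrival (token_use_iv (\<lambda>m. m = Suc j)) k w / real n - lam * mesh mu n * hit_mass n (token_use_iv (\<lambda>m. m = Suc j)) k w)"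
    and gl: "grid_limit lam R s0 s (mesh mu) (cells T mu) B (\<lambda>n k. fst (grid_state n k w)) (\<lambda>n k. of_bool (snd (grid_state n k w) = 0))"
    and cj: "\<forall>\<^sub>F n in sequentially. j < c n"
  shows "grid_limit.weak_null (mesh mu) (cells T mu) (\<lambda>n l. b * (1 - fst (grid_state n l w) 1) * of_bool (snd (grid_state n l w) = j) - lam * of_bool (snd (grid_state n l w) = Suc j))"
proof -
  interpret grid_limit lam R s0 s "mesh mu" "cells T mu" B "\<lambda>n k. fst (grid_state n k w)" "\<lambda>n k. of_bool (snd (grid_state n k w) = 0)" by (rule gl)
  have "weak_null (\<lambda>n l. b * (1 - fst (grid_state n l w) 1) * of_bool (snd (grid_state n l w) = j \<and> snd (grid_state n l w) < c n) - lam * of_bool (snd (grid_state n l w) = Suc j))"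
  proof (rule unif_null_token_balance[where h="\<lambda>m. of_bool (j < m)" and P="\<lambda>m. m = j" and Q="\<lambda>m. m = Suc j", OF un marks val _ _ _ up dn _ gl])
    show "unif_null (cells T mu) (\<lambda>n k. (of_bool (j < snd (grid_state n k w)) - of_bool (j < snd (grid_state n 0 w))) / real n)"
    proof (rule unif_null_dominated[OF always_eventually lim_const_over_n[of 1]], intro allI impI)
      fix n k show "\<bar>(of_bool (j < snd (grid_state n k w)) - of_bool (j < snd (grid_state n 0 w))) / real n\<bar> \<le> 1 / real n"
        by (auto simp: abs_divide divide_right_mono)
    qed
    show "unif_null (cells T mu) (\<lambda>n l. real (snd (grid_state n l w)) / real n * of_bool (snd (grid_state n l w) = j))"
      by (rule unif_null_dominated[OF always_eventually lim_const_over_n[of "real j"]]) auto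
  qed auto
  then show ?thesis
  proof (rule weak_null_cong)
    show "\<forall>\<^sub>F n in sequentially. \<forall>l<cells T mu n. b * (1 - fst (grid_state n l w) 1) * of_bool (snd (grid_state n l w) = j \<and> snd (grid_state n l w) < c n) - lam * of_bool (snd (grid_state n l w) = Suc j)
      = b * (1 - fst (grid_state n l w) 1) * of_bool (snd (grid_state n l w) = j) - lam * of_bool (snd (grid_state n l w) = Suc j)"
      using cj by eventually_elim auto
  qed
qed

lemma total_balance:
  assumes un: "\<forall>\<^sub>F n in sequentially. uncrowded_path n (cells T mu n) w"
    and marks: "\<And>s j. 1 \<le> j \<Longrightarrow> 0 \<le> mark s j w \<and> mark s j w < 1"
    and val: "\<forall>\<^sub>F n in sequentially. 1 \<le> n \<and> (\<forall>k\<le>cells T mu n. valid n (c n) (grid_state n k w))"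
    and up: "unif_null (cells T mu) (\<lambda>n k. hit_count n Message (token_store_iv n (c n) (\<lambda>m. True)) k w / real n - b * mesh mu n * hit_mass n (token_store_iv n (c n) (\<lambda>m. True)) k w)"
    and dn: "unif_null (cells T mu) (\<lambda>n k. hit_count n Arrival (token_use_iv (\<lambda>m. 1 \<le> m)) k w / real n - lam * mesh mu n * hit_mass n (token_use_iv (\<lambda>m. 1 \<le> m)) k w)"
    and gl: "grid_limit lam R s0 s (mesh mu) (cells T mu) B (\<lambda>n k. fst (grid_state n k w)) (\<lambda>n k. of_bool (snd (grid_state n k w) = 0))"
    and c0: "(\<lambda>n. real (c n) / real n) \<longlonglongrightarrow> 0"
  shows "grid_limit.weak_null (mesh mu) (cells T mu) (\<lambda>n l. b * (1 - fst (grid_state n l w) 1) * of_bool (snd (grid_state n l w) < c n) - lam * (1 - of_bool (snd (grid_state n l w) = 0)))"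
proof -
  interpret grid_limit lam R s0 s "mesh mu" "cells T mu" B "\<lambda>n k. fst (grid_state n k w)" "\<lambda>n k. of_bool (snd (grid_state n k w) = 0)" by (rule gl)
  have Mc: "\<forall>\<^sub>F n in sequentially. \<forall>k\<le>cells T mu n. real (snd (grid_state n k w)) / real n \<le> real (c n) / real n"
    using val by eventually_elim (auto simp: valid_def intro!: divide_right_mono)
  have "weak_null (\<lambda>n l. b * (1 - fst (grid_state n l w) 1) * of_bool (True \<and> snd (grid_state n l w) < c n) - lam * of_bool (1 \<le> snd (grid_state n l w)))"
  proof (rule unif_null_token_balance[where h="real" and P="\<lambda>m. True" and Q="\<lambda>m. 1 \<le> m", OF un marks val _ _ _ up dn _ gl])
    show "unif_null (cells T mu) (\<lambda>n k. (real (snd (grid_state n k w)) - real (snd (grid_state n 0 w))) / real n)"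
    proof (rule unif_null_dominated[OF _ c0])
      show "\<forall>\<^sub>F n in sequentially. \<forall>k\<le>cells T mu n. \<bar>(real (snd (grid_state n k w)) - real (snd (grid_state n 0 w))) / real n\<bar> \<le> real (c n) / real n"
        using Mc
      proof eventually_elim
        case (elim n)
        show ?case
        proof (intro allI impI)
          fix k assume k: "k \<le> cells T mu n"
          have "real (snd (grid_state n k w)) / real n \<le> real (c n) / real n" "real (snd (grid_state n 0 w)) / real n \<le> real (c n) / real n" using elim k by auto
          moreover have "0 \<le> real (snd (grid_state n k w)) / real n" "0 \<le> real (snd (grid_state n 0 w)) / real n" by auto
          ultimately show "\<bar>(real (snd (grid_state n k w)) - real (snd (grid_state n 0 w))) / real n\<bar> \<le> real (c n) / real n"
            unfolding diff_divide_distrib by linarith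
        qed
      qed
    qed
    show "unif_null (cells T mu) (\<lambda>n l. real (snd (grid_state n l w)) / real n * of_bool True)"
      by (rule unif_null_dominated[OF _ c0]) (use Mc in simp)
  qed auto
  moreover have "(of_bool (1 \<le> m) :: real) = 1 - of_bool (m = 0)" for m :: nat by (cases m) auto
  ultimately show ?thesis by simp
qed

text \<open>Each token that leaves level \<open>0\<close> upwards is matched by an arrival, so there are at most of order \<open>n\<close> such
  crossings. Their compensator is \<open>mu n\<close> times the integral in question, and the exponential bound with
  exponent \<open>-1\<close> compares it with the count up to a constant factor and a term of order \<open>n\<close>. This holds however
  large the number of messages is.\<close>

lemma high_message_starvation:
  assumes lam: "0 < lam" "lam < 1" and T: "0 < T"
    and un: "\<forall>\<^sub>F n in sequentially. uncrowded_path n (cells T mu n) w"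
    and marks: "\<And>s j. 1 \<le> j \<Longrightarrow> 0 \<le> mark s j w \<and> mark s j w < 1"
    and val: "\<forall>\<^sub>F n in sequentially. 1 \<le> n \<and> (\<forall>k\<le>cells T mu n. valid n (c n) (grid_state n k w))"
    and dn: "unif_null (cells T mu) (\<lambda>n k. hit_count n Arrival (token_use_iv (\<lambda>m. m = Suc 0)) k w / real n - lam * mesh mu n * hit_mass n (token_use_iv (\<lambda>m. m = Suc 0)) k w)"
    and up: "\<forall>\<^sub>F n in sequentially. uncrowded_path n (cells T mu n) w \<longrightarrow> (\<forall>k\<le>cells T mu n. - 1 * hit_count n Message (token_store_iv n (c n) (\<lambda>m. m = 0)) k w
       \<le> expexp (- 1) * cell_prob n Message * hit_mass n (token_store_iv n (c n) (\<lambda>m. m = 0)) k w + 2 * (1 * real n))"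
    and c1: "\<forall>\<^sub>F n in sequentially. 0 < c n" and mu: "filterlim mu at_top sequentially"
  shows "unif_null (cells T mu) (\<lambda>n k. mesh mu n * (\<Sum>l<k. (1 - fst (grid_state n l w) 1) * of_bool (snd (grid_state n l w) = 0)))"
proof -
  define a where "a = - expexp (- 1)"
  have "exp (- 1) < (1::real)" by simp
  then have a: "0 < a" by (simp add: a_def expexp_def)
  \<comment> \<open>Arrivals contribute at most \<open>lam * (T + 1) + 1\<close> per server; the rest is the slack \<open>2 n\<close> of the exponential bound and one crossing.\<close>
  define C where "C = lam * (T + 1) + 4"
  have mu0: "(\<lambda>n. (2 * C / a) * inverse (mu n)) \<longlonglongrightarrow> 0"
    using tendsto_mult_left[OF tendsto_inverse_0_at_top[OF mu], of "2 * C / a"] by simp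
  show ?thesis
  proof (rule unif_null_dominated[OF _ mu0])
    show "\<forall>\<^sub>F n in sequentially. \<forall>k\<le>cells T mu n. \<bar>mesh mu n * (\<Sum>l<k. (1 - fst (grid_state n l w) 1) * of_bool (snd (grid_state n l w) = 0))\<bar> \<le> (2 * C / a) * inverse (mu n)"
      using un val unif_nullD[OF dn zero_less_one] up c1
    proof eventually_elim
      case (elim n)
      have n: "1 \<le> n" "0 < real n" using elim(2) by auto
      show ?case
      proof (intro allI impI)
        fix k assume k: "k \<le> cells T mu n"
        let ?g = "hit_mass n (token_store_iv n (c n) (\<lambda>m. m = 0)) k w"
        have len_eq: "len (token_store_iv n (c n) (\<lambda>m. m = 0) (grid_state n l w)) = (1 - fst (grid_state n l w) 1) * of_bool (snd (grid_state n l w) = 0)" if "l < k" for l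
        proof -
          have v: "valid n (c n) (grid_state n l w)" "0 < n" using elim(2) that k by auto
          show ?thesis unfolding len_token_store_iv[OF v] using elim(5) by auto
        qed
        have sum_eq: "(\<Sum>l<k. (1 - fst (grid_state n l w) 1) * of_bool (snd (grid_state n l w) = 0)) = ?g"
          unfolding hit_mass_def using len_eq by (intro sum.cong) auto
        have "of_bool (0 < snd (grid_state n k w)) - of_bool (0 < snd (grid_state n 0 w)) =
            hit_count n Message (token_store_iv n (c n) (\<lambda>m. m = 0)) k w - hit_count n Arrival (token_use_iv (\<lambda>m. m = Suc 0)) k w"
          by (rule token_balance[where h="\<lambda>m. of_bool (0 < m)" and P="\<lambda>m. m = 0" and Q="\<lambda>m. m = Suc 0", OF elim(1) k marks]) auto
        moreover have "of_bool (0 < snd (grid_state n k w)) - of_bool (0 < snd (grid_state n 0 w)) \<le> (1::real)" by simp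
        ultimately have cm: "hit_count n Message (token_store_iv n (c n) (\<lambda>m. m = 0)) k w \<le> hit_count n Arrival (token_use_iv (\<lambda>m. m = Suc 0)) k w + 1" by linarith
        have "\<bar>hit_count n Arrival (token_use_iv (\<lambda>m. m = Suc 0)) k w / real n - lam * mesh mu n * hit_mass n (token_use_iv (\<lambda>m. m = Suc 0)) k w\<bar> \<le> 1"
          using elim(3) k by blast
        moreover have "lam * mesh mu n * hit_mass n (token_use_iv (\<lambda>m. m = Suc 0)) k w \<le> lam * (T + 1)"
        proof -
          have "mesh mu n * hit_mass n (token_use_iv (\<lambda>m. m = Suc 0)) k w \<le> mesh mu n * real (cells T mu n)"
            using hit_mass_bounds(2)[of n "token_use_iv (\<lambda>m. m = Suc 0)" k w] k mesh_pos[of mu n] by (intro mult_left_mono) auto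
          then have "mesh mu n * hit_mass n (token_use_iv (\<lambda>m. m = Suc 0)) k w \<le> T + 1" using cells_bounds(2)[OF T, of mu n] by linarith
          then show ?thesis using lam by (simp add: mult.assoc)
        qed
        ultimately have "hit_count n Arrival (token_use_iv (\<lambda>m. m = Suc 0)) k w / real n \<le> lam * (T + 1) + 1" by linarith
        then have "hit_count n Arrival (token_use_iv (\<lambda>m. m = Suc 0)) k w \<le> (lam * (T + 1) + 1) * real n" using n by (simp add: divide_le_eq)
        moreover have "a * cell_prob n Message * ?g \<le> hit_count n Message (token_store_iv n (c n) (\<lambda>m. m = 0)) k w + 2 * real n"
          using elim(4) elim(1) k by (fastforce simp: a_def)
        moreover have "(lam * (T + 1) + 1) * real n + 1 + 2 * real n \<le> C * real n" using n by (simp add: C_def algebra_simps)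
        ultimately have up': "a * cell_prob n Message * ?g \<le> C * real n" using cm by linarith
        define \<rho> where "\<rho> = mu n * (real n * mesh mu n)"
        have mup: "0 < mu n" using mu_pos n by simp
        have \<rho>0: "0 \<le> \<rho>" unfolding \<rho>_def using mup mesh_pos[of mu n] by simp
        have "\<rho> \<le> real n * mesh mu n * (2 + \<bar>mu n\<bar>)"
          unfolding \<rho>_def using mup mesh_pos[of mu n] by (simp add: distrib_left mult_ac)
        also have "\<dots> \<le> 1 / real (Suc n)" by (rule mesh_bounds)
        also have "\<dots> \<le> 1 / 2" using n by (intro divide_left_mono) auto
        finally have "\<rho> * \<rho> \<le> \<rho> * (1 / 2)" using \<rho>0 by (rule mult_left_mono)
        then have "\<rho> / 2 \<le> \<rho> - \<rho>\<^sup>2" by (simp add: power2_eq_square)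
        also have "\<dots> \<le> cell_prob n Message" using cell_prob_bounds(3)[OF lam(1) n(1), of Message] by (simp add: rate_def \<rho>_def)
        finally have "a * (\<rho> / 2) * ?g \<le> a * cell_prob n Message * ?g"
          using a hit_mass_bounds(1) by (intro mult_right_mono mult_left_mono) auto
        then have "a * (\<rho> / 2) * ?g \<le> C * real n" using up' by linarith
        then have "real n * (a * mu n * (mesh mu n * ?g)) \<le> real n * (2 * C)" by (simp add: \<rho>_def mult_ac)
        then have "a * mu n * (mesh mu n * ?g) \<le> 2 * C" using n by simp
        then have "mesh mu n * ?g \<le> (2 * C / a) * inverse (mu n)" using a mup by (simp add: field_simps)
        moreover have "0 \<le> mesh mu n * ?g" using hit_mass_bounds(1) mesh_pos[of mu n] by (simp add: less_imp_le)
        ultimately show "\<bar>mesh mu n * (\<Sum>l<k. (1 - fst (grid_state n l w) 1) * of_bool (snd (grid_state n l w) = 0))\<bar> \<le> (2 * C / a) * inverse (mu n)"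
          unfolding sum_eq by simp
      qed
    qed
  qed
qed

end

context coupled_system
begin

text \<open>Collects the countably many almost sure statements and hands them to the deterministic theorem of the regime.\<close>

lemma AE_distance_null:
  assumes lam: "0 < lam" "lam < 1" and T: "0 < T" and reg: "in_regime R c mu"
    and sol: "fluid_solution lam R s0 s"
    and init: "AE w in \<Omega>. (\<lambda>n. wnorm (\<lambda>i. S n 0 w i - s0 i)) \<longlonglongrightarrow> 0"
  shows "AE w in \<Omega>. unif_null (cells T mu) (\<lambda>n k. wsum (\<lambda>i. (fst (grid_state n k w) i - s (mesh mu n * real k) i)\<^sup>2))"
proof -
  note LLN = AE_law_of_large_numbers[OF lam T reg]
  interpret fluid lam R s0 s using lam in_regime_proper[OF reg] sol by unfold_locales
  have rA: "rate n Arrival = lam" and rS: "rate n Service = 1" for n by (auto simp: rate_def)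
  have arr: "AE w in \<Omega>. \<forall>i. unif_null (cells T mu) (\<lambda>n k. hit_count n Arrival (arr_iv i) k w / real n - lam * mesh mu n * hit_mass n (arr_iv i) k w)"
    by (subst AE_all_countable) (auto intro!: LLN rA)
  have srv: "AE w in \<Omega>. \<forall>i. unif_null (cells T mu) (\<lambda>n k. hit_count n Service (srv_iv i) k w / real n - 1 * mesh mu n * hit_mass n (srv_iv i) k w)"
    unfolding AE_all_countable by (intro allI LLN srv_iv_measurable rS)
  have dn: "AE w in \<Omega>. \<forall>j. unif_null (cells T mu) (\<lambda>n k. hit_count n Arrival (token_use_iv (\<lambda>m. m = Suc j)) k w / real n - lam * mesh mu n * hit_mass n (token_use_iv (\<lambda>m. m = Suc j)) k w)"
    unfolding AE_all_countable by (intro allI LLN token_use_iv_measurable rA)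
  have dn1: "AE w in \<Omega>. unif_null (cells T mu) (\<lambda>n k. hit_count n Arrival (token_use_iv (\<lambda>m. 1 \<le> m)) k w / real n - lam * mesh mu n * hit_mass n (token_use_iv (\<lambda>m. 1 \<le> m)) k w)"
    by (intro LLN token_use_iv_measurable rA)
  have up: "AE w in \<Omega>. \<forall>j. unif_null (cells T mu) (\<lambda>n k. hit_count n Message (token_store_iv n (c n) (\<lambda>m. m = j)) k w / real n - b * mesh mu n * hit_mass n (token_store_iv n (c n) (\<lambda>m. m = j)) k w)"
    and up1: "AE w in \<Omega>. unif_null (cells T mu) (\<lambda>n k. hit_count n Message (token_store_iv n (c n) (\<lambda>m. True)) k w / real n - b * mesh mu n * hit_mass n (token_store_iv n (c n) (\<lambda>m. True)) k w)"
    if b: "\<forall>n\<ge>1. mu n = b" for b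
  proof -
    have rM: "1 \<le> n \<Longrightarrow> rate n Message = b" for n using b by (auto simp: rate_def)
    show "AE w in \<Omega>. \<forall>j. unif_null (cells T mu) (\<lambda>n k. hit_count n Message (token_store_iv n (c n) (\<lambda>m. m = j)) k w / real n - b * mesh mu n * hit_mass n (token_store_iv n (c n) (\<lambda>m. m = j)) k w)"
      unfolding AE_all_countable by (intro allI LLN token_store_iv_measurable rM)
    show "AE w in \<Omega>. unif_null (cells T mu) (\<lambda>n k. hit_count n Message (token_store_iv n (c n) (\<lambda>m. True)) k w / real n - b * mesh mu n * hit_mass n (token_store_iv n (c n) (\<lambda>m. True)) k w)"
      by (intro LLN token_store_iv_measurable rM)
  qed
  have common: "AE w in \<Omega>. (\<forall>s j. 1 \<le> j \<longrightarrow> 0 \<le> mark s j w \<and> mark s j w < 1) \<and>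
     (\<forall>\<^sub>F n in sequentially. uncrowded_path n (cells T mu n) w) \<and>
     (\<forall>\<^sub>F n in sequentially. 1 \<le> n \<and> (\<forall>k\<le>cells T mu n. valid n (c n) (grid_state n k w))) \<and>
     grid_limit lam R s0 s (mesh mu) (cells T mu) (T + 1) (\<lambda>n k. fst (grid_state n k w)) (\<lambda>n k. of_bool (snd (grid_state n k w) = 0))"
    using AE_mark_bounds AE_grid_paths[OF lam T reg] arr srv init
  proof eventually_elim
    case (elim w)
    have un: "\<forall>\<^sub>F n in sequentially. uncrowded_path n (cells T mu n) w" using elim(2) by eventually_elim simp
    have val: "\<forall>\<^sub>F n in sequentially. 1 \<le> n \<and> (\<forall>k\<le>cells T mu n. valid n (c n) (grid_state n k w))" using elim(2) by eventually_elim simp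
    have S0: "\<forall>\<^sub>F n in sequentially. S n 0 w = fst (grid_state n 0 w)"
      using elim(2)
    proof eventually_elim
      case (elim n)
      then have "S n (mesh mu n * real 0) w = fst (grid_state n 0 w)" by blast
      then show ?case by simp
    qed
    have start: "(\<lambda>n. fst (grid_state n 0 w) i) \<longlonglongrightarrow> s0 i" for i
    proof -
      have "(\<lambda>n. sqrt (2 ^ i) * wnorm (\<lambda>i. S n 0 w i - s0 i)) \<longlonglongrightarrow> 0"
        using tendsto_mult_left[OF elim(5), of "sqrt (2 ^ i)"] by simp
      then have "(\<lambda>n. fst (grid_state n 0 w) i - s0 i) \<longlonglongrightarrow> 0"
      proof (rule Lim_null_comparison[rotated])
        show "\<forall>\<^sub>F n in sequentially. norm (fst (grid_state n 0 w) i - s0 i) \<le> sqrt (2 ^ i) * wnorm (\<lambda>i. S n 0 w i - s0 i)"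
          using S0 val
        proof eventually_elim
          case (elim n)
          have v: "valid n (c n) (grid_state n 0 w)" using elim by simp
          let ?f = "\<lambda>j. (fst (grid_state n 0 w) j - s0 j)\<^sup>2"
          have "?f j \<le> 1" for j
          proof -
            have "0 \<le> fst (grid_state n 0 w) j" "fst (grid_state n 0 w) j \<le> 1" using v valid_le_1[OF v, of j] by (auto simp: valid_def)
            then have "\<bar>fst (grid_state n 0 w) j - s0 j\<bar> \<le> 1" using s_bounds(1,2)[of 0 j] s_0 by auto
            then show ?thesis by (simp add: abs_le_square_iff[of _ 1, simplified])
          qed
          then have "?f i \<le> 2 ^ i * wsum ?f" by (intro wsum_term_le[of ?f 1]) auto
          then have "sqrt (?f i) \<le> sqrt (2 ^ i * wsum ?f)" by (rule real_sqrt_le_mono)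
          then show ?case unfolding wnorm_eq elim(1) by (simp add: real_sqrt_mult)
        qed
      qed
      then show ?thesis by (rule LIM_zero_cancel)
    qed
    have "grid_limit lam R s0 s (mesh mu) (cells T mu) (T + 1) (\<lambda>n k. fst (grid_state n k w)) (\<lambda>n k. of_bool (snd (grid_state n k w) = 0))"
      by (rule grid_limit_instance[OF lam T in_regime_proper[OF reg] sol val])
        (use elim(3,4) start in auto)
    with un val show ?case using elim(1) by blast
  qed
  show ?thesis
  proof (cases R)
    case (Constrained c0 b)
    then have cR: "\<forall>n\<ge>1. c n = c0" "\<forall>n\<ge>1. mu n = b" using reg by auto
    show ?thesis using common dn up[OF cR(2)]
    proof eventually_elim
      case (elim w)
      interpret G: grid_limit lam R s0 s "mesh mu" "cells T mu" "T + 1" "\<lambda>n k. fst (grid_state n k w)" "\<lambda>n k. of_bool (snd (grid_state n k w) = 0)"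
        using elim(1) by blast
      have "unif_null (cells T mu) G.Y"
      proof (rule G.Y_null_Constrained[OF Constrained, where I="\<lambda>j n l. of_bool (snd (grid_state n l w) = j)"])
        fix j assume "j < c0"
        then have "\<forall>\<^sub>F n in sequentially. j < c n"
          using cR(1) by (intro eventually_mono[OF eventually_ge_at_top[of 1]]) auto
        then show "G.weak_null (\<lambda>n l. b * (1 - fst (grid_state n l w) 1) * of_bool (snd (grid_state n l w) = j) - lam * of_bool (snd (grid_state n l w) = Suc j))"
          using elim by (intro level_balance[where B="T + 1" and R=R and ?s0.0=s0 and s=s]) auto
      next
        have val: "\<forall>\<^sub>F n in sequentially. 1 \<le> n \<and> (\<forall>k\<le>cells T mu n. valid n (c n) (grid_state n k w))" using elim(1) by blast
        show "\<forall>\<^sub>F n in sequentially. \<forall>l<cells T mu n. (\<Sum>j\<le>c0. of_bool (snd (grid_state n l w) = j)) = (1::real)"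
          using val
        proof eventually_elim
          case (elim n)
          show ?case
          proof (intro allI impI)
            fix l assume "l < cells T mu n"
            then have "valid n (c n) (grid_state n l w)" using elim by auto
            then have "snd (grid_state n l w) \<le> c0" using cR(1) elim by (simp add: valid_def)
            then show "(\<Sum>j\<le>c0. of_bool (snd (grid_state n l w) = j)) = (1::real)"
              by (simp add: of_bool_def sum.delta)
          qed
        qed
      qed auto
      then show ?case unfolding G.Y_def[abs_def] G.e_def .
    qed
  next
    case (High_Memory b)
    then have cR: "filterlim c at_top sequentially" "(\<lambda>n. real (c n) / real n) \<longlonglongrightarrow> 0" "\<forall>n\<ge>1. mu n = b" using reg by auto
    show ?thesis using common dn up[OF cR(3)] dn1 up1[OF cR(3)]
    proof eventually_elim
      case (elim w)
      interpret G: grid_limit lam R s0 s "mesh mu" "cells T mu" "T + 1" "\<lambda>n k. fst (grid_state n k w)" "\<lambda>n k. of_bool (snd (grid_state n k w) = 0)"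
        using elim(1) by blast
      have "unif_null (cells T mu) G.Y"
      proof (rule G.Y_null_High_Memory[OF High_Memory, where I="\<lambda>j n l. of_bool (snd (grid_state n l w) = j)" and E="\<lambda>n l. of_bool (snd (grid_state n l w) < c n)"])
        fix j
        have "\<forall>\<^sub>F n in sequentially. Suc j \<le> c n" using cR(1) unfolding filterlim_at_top by blast
        then have "\<forall>\<^sub>F n in sequentially. j < c n" by (simp add: Suc_le_eq)
        then show "G.weak_null (\<lambda>n l. b * (1 - fst (grid_state n l w) 1) * of_bool (snd (grid_state n l w) = j) - lam * of_bool (snd (grid_state n l w) = Suc j))"
          using elim by (intro level_balance[where B="T + 1" and R=R and ?s0.0=s0 and s=s]) auto
      next
        fix J n l
        show "(\<Sum>j<J. of_bool (snd (grid_state n l w) = j)) \<le> (1::real)" by (simp add: of_bool_def sum.delta)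
      next
        show "G.weak_null (\<lambda>n l. b * (1 - fst (grid_state n l w) 1) * of_bool (snd (grid_state n l w) < c n) - lam * (1 - of_bool (snd (grid_state n l w) = 0)))"
          using elim cR by (intro total_balance[where B="T + 1" and R=R and ?s0.0=s0 and s=s]) auto
      qed auto
      then show ?case unfolding G.Y_def[abs_def] G.e_def .
    qed
  next
    case (High_Message c0)
    then have cR: "1 \<le> c0" "\<forall>n\<ge>1. c n = c0" "filterlim mu at_top sequentially" using reg by auto
    have cpos: "\<forall>\<^sub>F n in sequentially. 0 < c n"
      using cR(1,2) by (intro eventually_mono[OF eventually_ge_at_top[of 1]]) auto
    have "AE w in \<Omega>. \<forall>\<^sub>F n in sequentially. uncrowded_path n (cells T mu n) w \<longrightarrow> (\<forall>k\<le>cells T mu n. - 1 * hit_count n Message (token_store_iv n (c n) (\<lambda>m. m = 0)) k w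
       \<le> expexp (- 1) * cell_prob n Message * hit_mass n (token_store_iv n (c n) (\<lambda>m. m = 0)) k w + 2 * (1 * real n))"
      by (rule AE_counts_bounded[OF lam T reg token_store_iv_measurable zero_less_one])
    with common dn show ?thesis
    proof eventually_elim
      case (elim w)
      interpret G: grid_limit lam R s0 s "mesh mu" "cells T mu" "T + 1" "\<lambda>n k. fst (grid_state n k w)" "\<lambda>n k. of_bool (snd (grid_state n k w) = 0)"
        using elim(1) by blast
      have "unif_null (cells T mu) G.Y"
        using elim by (intro G.Y_null_High_Message[OF High_Message] high_message_starvation[OF lam T _ _ _ _ _ cpos cR(3)]) auto
      then show ?case unfolding G.Y_def[abs_def] G.e_def .
    qed
  qed
qed

end

theorem theorem3p2:
  fixes \<Omega> :: "'w measure"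
    and lam T :: real and R :: regime
    and c :: "nat \<Rightarrow> nat" and mu :: "nat \<Rightarrow> real"
    and N_lam N_one :: "real \<Rightarrow> 'w \<Rightarrow> nat" and N_mu :: "nat \<Rightarrow> real \<Rightarrow> 'w \<Rightarrow> nat"
    and U V W :: "nat \<Rightarrow> 'w \<Rightarrow> real"
    and S0 :: "nat \<Rightarrow> 'w \<Rightarrow> nat \<Rightarrow> real" and M0 :: "nat \<Rightarrow> 'w \<Rightarrow> nat"
    and S :: "nat \<Rightarrow> real \<Rightarrow> 'w \<Rightarrow> nat \<Rightarrow> real" and M :: "nat \<Rightarrow> real \<Rightarrow> 'w \<Rightarrow> nat"
    and s0 :: "nat \<Rightarrow> real" and s :: "real \<Rightarrow> nat \<Rightarrow> real"
  assumes "0 < lam" "lam < 1" "0 < T" "s0 \<in> state_space_1"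
    and "in_regime R c mu"
    and "coupled_system \<Omega> lam c mu N_lam N_one N_mu U V W S0 M0 S M"
    and "fluid_solution lam R s0 s"
    and "AE w in \<Omega>. (\<lambda>n. wnorm (\<lambda>i. S n 0 w i - s0 i)) \<longlonglongrightarrow> 0"
  shows "AE w in \<Omega>. (\<lambda>n. SUP t\<in>{0..T}. wnorm (\<lambda>i. S n t w i - s t i)) \<longlonglongrightarrow> 0"
proof -
  interpret coupled_system \<Omega> lam c mu N_lam N_one N_mu U V W S0 M0 S M by fact
  interpret fluid lam R s0 s
    using assms(1,2,7) in_regime_proper[OF assms(5)] by unfold_locales
  from AE_distance_null[OF assms(1,2,3,5,7,8)] AE_grid_paths[OF assms(1,2,3,5)]
  show ?thesis
  proof eventually_elim
    case (elim w)
    show ?case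
    proof (rule sup_distance_null[OF assms(3) mesh_pos mesh_null cells_bounds(1)[OF assms(3)] elim(1)])
      show "\<forall>\<^sub>F n in sequentially. (\<forall>k\<le>cells T mu n. \<forall>i. 0 \<le> fst (grid_state n k w) i \<and> fst (grid_state n k w) i \<le> 1) \<and>
       (\<forall>k<cells T mu n. \<forall>t. mesh mu n * real k \<le> t \<longrightarrow> t \<le> mesh mu n * real (Suc k) \<longrightarrow> S n t w = fst (grid_state n k w) \<or> S n t w = fst (grid_state n (Suc k) w))"
        using elim(2)
      proof eventually_elim
        case (elim n)
        have "0 \<le> fst (grid_state n k w) i \<and> fst (grid_state n k w) i \<le> 1" if "k \<le> cells T mu n" for k i
        proof -
          have v: "valid n (c n) (grid_state n k w)" using elim that by blast
          then show ?thesis using valid_le_1[OF v, of i] by (simp add: valid_def)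
        qed
        then show ?case using elim by blast
      qed
    qed
  qed
qed

end
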